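(* Let $K$ be a local field with finite residue field $k$ of characteristic $p$ and cardinality $q$, and let $e>0$ be an integer with $e\not\equiv 0\pmod p$ such that the group ${}_eK^\times$ of $e$-th roots of $1$ in $K$ has order $e$ (equivalently, $q\equiv1\pmod e$). Let $M=K(\sqrt[e]{K^\times})$ be the maximal abelian extension of $K$ of exponent dividing $e$, and consider the perfect pairing $$\mathrm{Gal}(M|K)\times(K^\times/K^{\times e})\to{}_eK^\times,\qquad(\sigma,\bar x)=\frac{\sigma(y)}{y}\quad(y\in M^\times,\ y^e=x).$$ Then the orthogonal complement of the inertia subgroup $\Gamma_0$ of $\mathrm{Gal}(M|K)$ is the subgroup $k^\times/k^{\times e}$ of $K^\times/K^{\times e}$, and conversely the orthogonal complement of $k^\times/k^{\times e}$ is $\Gamma_0$.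
   Context: A local field is a field complete for a discrete valuation with finite residue field. The group $k^\times$ is identified with its Teichmüller lift in $K^\times$, and $k^\times/k^{\times e}$ is thereby identified with a subgroup of $K^\times/K^{\times e}$, namely the kernel of the map $K^\times/K^{\times e}\to\mathbf Z/e\mathbf Z$ induced by the normalised valuation. *)

theory Defs
  imports "HOL-Algebra.Algebra" "HOL-Number_Theory.Cong"
begin

section \<open>Local fields\<close>

text \<open>
  A normalised discrete valuation is an integer-valued function \<^term>\<open>v\<close> on the nonzero elements;
  the value of \<^term>\<open>v\<close> at zero is irrelevant, and \<open>vge R v x n\<close> stands for \<open>v x \<ge> n\<close> with the
  convention \<open>v 0 = \<infinity>\<close>.
\<close>

definition vge :: "('a, 'b) ring_scheme \<Rightarrow> ('a \<Rightarrow> int) \<Rightarrow> 'a \<Rightarrow> int \<Rightarrow> bool"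
  where "vge R v x n \<longleftrightarrow> x = \<zero>\<^bsub>R\<^esub> \<or> n \<le> v x"

definition valuation_ring :: "('a, 'b) ring_scheme \<Rightarrow> ('a \<Rightarrow> int) \<Rightarrow> 'a set"
  where "valuation_ring R v = {x \<in> carrier R. vge R v x 0}"

definition valuation_ideal :: "('a, 'b) ring_scheme \<Rightarrow> ('a \<Rightarrow> int) \<Rightarrow> 'a set"
  where "valuation_ideal R v = {x \<in> carrier R. vge R v x 1}"

definition residue_field :: "('a, 'b) ring_scheme \<Rightarrow> ('a \<Rightarrow> int) \<Rightarrow> 'a set ring"
  where "residue_field R v = (R\<lparr>carrier := valuation_ring R v\<rparr>) Quot (valuation_ideal R v)"

definition valuation_Cauchy :: "('a, 'b) ring_scheme \<Rightarrow> ('a \<Rightarrow> int) \<Rightarrow> (nat \<Rightarrow> 'a) \<Rightarrow> bool"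
  where "valuation_Cauchy R v s \<longleftrightarrow>
    (\<forall>N. \<exists>n0. \<forall>m\<ge>n0. \<forall>n\<ge>n0. vge R v (s m \<ominus>\<^bsub>R\<^esub> s n) N)"

definition valuation_tendsto ::
    "('a, 'b) ring_scheme \<Rightarrow> ('a \<Rightarrow> int) \<Rightarrow> (nat \<Rightarrow> 'a) \<Rightarrow> 'a \<Rightarrow> bool"
  where "valuation_tendsto R v s l \<longleftrightarrow> (\<forall>N. \<exists>n0. \<forall>n\<ge>n0. vge R v (s n \<ominus>\<^bsub>R\<^esub> l) N)"

locale local_field = field R for R (structure) +
  fixes v :: "'a \<Rightarrow> int"
  assumes v_mult: "\<lbrakk> x \<in> carrier R - {\<zero>}; y \<in> carrier R - {\<zero>} \<rbrakk> \<Longrightarrow> v (x \<otimes> y) = v x + v y"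
    and v_add: "\<lbrakk> x \<in> carrier R - {\<zero>}; y \<in> carrier R - {\<zero>}; x \<oplus> y \<noteq> \<zero> \<rbrakk>
                  \<Longrightarrow> min (v x) (v y) \<le> v (x \<oplus> y)"
    and v_normalised: "v ` (carrier R - {\<zero>}) = UNIV"
    and complete: "\<lbrakk> range s \<subseteq> carrier R; valuation_Cauchy R v s \<rbrakk>
                     \<Longrightarrow> \<exists>l \<in> carrier R. valuation_tendsto R v s l"
    and finite_residue_field: "finite (carrier (residue_field R v))"

definition ring_char :: "('a, 'b) ring_scheme \<Rightarrow> nat"
  where "ring_char R = group.ord (add_monoid R) \<one>\<^bsub>R\<^esub>"

text \<open>
  An element \<open>a\<close> of the residue field is a coset of the valuation ideal, so \<open>x \<in> a\<close> says that
  \<open>x\<close> lifts \<open>a\<close>. The Teichmueller lift of \<open>a\<close> is its only lift fixed by the \<open>q\<close>-th power map.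
\<close>

definition teichmuller :: "('a, 'b) ring_scheme \<Rightarrow> ('a \<Rightarrow> int) \<Rightarrow> 'a set \<Rightarrow> 'a"
  where "teichmuller R v a =
    (THE x. x \<in> a \<and> x [^]\<^bsub>R\<^esub> card (carrier (residue_field R v)) = x)"

section \<open>Classes of units modulo powers\<close>

definition unit_powers :: "('a, 'b) ring_scheme \<Rightarrow> nat \<Rightarrow> 'a set"
  where "unit_powers R e = (\<lambda>x. x [^]\<^bsub>R\<^esub> e) ` carrier (Multiplicative_Group.mult_of R)"

definition unit_classes :: "('a, 'b) ring_scheme \<Rightarrow> nat \<Rightarrow> 'a set monoid"
  where "unit_classes R e = Multiplicative_Group.mult_of R Mod unit_powers R e"

definition roots_of_unity :: "('a, 'b) ring_scheme \<Rightarrow> nat \<Rightarrow> 'a set"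
  where "roots_of_unity R e = {z \<in> carrier (Multiplicative_Group.mult_of R). z [^]\<^bsub>R\<^esub> e = \<one>\<^bsub>R\<^esub>}"

text \<open>The image of the units of the residue field under the Teichmueller lift, modulo powers.\<close>

definition residue_unit_classes ::
    "('a, 'b) ring_scheme \<Rightarrow> ('a \<Rightarrow> int) \<Rightarrow> nat \<Rightarrow> 'a set set"
  where "residue_unit_classes R v e =
    (\<lambda>a. unit_powers R e #>\<^bsub>Multiplicative_Group.mult_of R\<^esub> teichmuller R v a) ` carrier (Multiplicative_Group.mult_of (residue_field R v))"

section \<open>The Galois group and its inertia subgroup\<close>

text \<open>
  Subfields of an ambient field \<open>L\<close> are given by their carriers. Automorphisms of \<open>M\<close> are
  extensional functions, as in \<^const>\<open>AutoGroup\<close>.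
\<close>

definition galois_group :: "('a, 'b) ring_scheme \<Rightarrow> 'a set \<Rightarrow> 'a set \<Rightarrow> ('a \<Rightarrow> 'a) monoid"
  where "galois_group L M K = (BijGroup M)\<lparr>carrier :=
    {\<sigma> \<in> Bij M. \<sigma> \<in> ring_hom (L\<lparr>carrier := M\<rparr>) (L\<lparr>carrier := M\<rparr>) \<and> (\<forall>x\<in>K. \<sigma> x = x)}\<rparr>"

definition integral_closure :: "('a, 'b) ring_scheme \<Rightarrow> 'a set \<Rightarrow> 'a set \<Rightarrow> 'a set"
  where "integral_closure L A M =
    {x \<in> M. \<exists>p. p \<noteq> [] \<and> set p \<subseteq> A \<and> hd p = \<one>\<^bsub>L\<^esub> \<and> ring.eval L p x = \<zero>\<^bsub>L\<^esub>}"

text \<open>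
  For a local field \<open>K\<close> with valuation \<open>v\<close> and an algebraic extension \<open>M\<close>, the valuation ring of
  \<open>M\<close> is the integral closure of that of \<open>K\<close>. It is a local ring, so its maximal ideal consists
  of its non-units.
\<close>

definition extension_integers ::
    "('a, 'b) ring_scheme \<Rightarrow> 'a set \<Rightarrow> 'a set \<Rightarrow> ('a \<Rightarrow> int) \<Rightarrow> ('a, 'b) ring_scheme"
  where "extension_integers L M K v =
    L\<lparr>carrier := integral_closure L (valuation_ring (L\<lparr>carrier := K\<rparr>) v) M\<rparr>"

definition extension_ideal ::
    "('a, 'b) ring_scheme \<Rightarrow> 'a set \<Rightarrow> 'a set \<Rightarrow> ('a \<Rightarrow> int) \<Rightarrow> 'a set"
  where "extension_ideal L M K v =
    carrier (extension_integers L M K v) - Units (extension_integers L M K v)"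

definition inertia_subgroup ::
    "('a, 'b) ring_scheme \<Rightarrow> 'a set \<Rightarrow> 'a set \<Rightarrow> ('a \<Rightarrow> int) \<Rightarrow> ('a \<Rightarrow> 'a) set"
  where "inertia_subgroup L M K v =
    {\<sigma> \<in> carrier (galois_group L M K).
       \<forall>x \<in> carrier (extension_integers L M K v). \<sigma> x \<ominus>\<^bsub>L\<^esub> x \<in> extension_ideal L M K v}"

section \<open>The Kummer pairing\<close>

definition kummer_extension :: "('a, 'b) ring_scheme \<Rightarrow> 'a set \<Rightarrow> nat \<Rightarrow> 'a set"
  where "kummer_extension L K e =
    generate_field L (K \<union> {y \<in> carrier L. y [^]\<^bsub>L\<^esub> e \<in> K - {\<zero>\<^bsub>L\<^esub>}})"

definition kummer_pairing ::
    "('a, 'b) ring_scheme \<Rightarrow> 'a set \<Rightarrow> nat \<Rightarrow> ('a \<Rightarrow> 'a) \<Rightarrow> 'a set \<Rightarrow> 'a"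
  where "kummer_pairing L M e \<sigma> C =
    (THE z. \<exists>x\<in>C. \<exists>y\<in>M - {\<zero>\<^bsub>L\<^esub>}. y [^]\<^bsub>L\<^esub> e = x \<and> z = \<sigma> y \<otimes>\<^bsub>L\<^esub> inv\<^bsub>L\<^esub> y)"

lemma (in field) eval_binomial:
  assumes "x \<in> carrier R" "y \<in> carrier R" "n > 0"
  shows "eval (\<one> # replicate (n - 1) \<zero> @ [\<ominus> x]) y = y [^] n \<ominus> x"
proof -
  have "eval ((\<one> # replicate (n - 1) \<zero>) @ [\<ominus> x]) y
      = eval (\<one> # replicate (n - 1) \<zero>) y \<otimes> y [^] length [\<ominus> x] \<oplus> eval [\<ominus> x] y"
    by (rule eval_append) (use assms in auto)
  moreover have "eval (\<one> # replicate (n - 1) \<zero>) y = y [^] (n - 1)"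
    using eval_monom[of \<one> y "n - 1"] assms by (simp add: monom_def)
  ultimately show ?thesis
    using assms by (cases n) (auto simp: minus_eq)
qed

lemma (in field) binomial_in_poly_ring:
  assumes "x \<in> carrier R"
  shows "\<one> # replicate (n - 1) \<zero> @ [\<ominus> x] \<in> carrier (poly_ring R)"
  using assms by (auto simp: sym[OF univ_poly_carrier] polynomial_def)

lemma (in field) card_power_roots:
  fixes n :: nat
  assumes x: "x \<in> carrier R" and n: "n > 0"
  shows "finite {y \<in> carrier R. y [^] n = x}" "card {y \<in> carrier R. y [^] n = x} \<le> n"
proof -
  let ?p = "\<one> # replicate (n - 1) \<zero> @ [\<ominus> x]"
  have sub: "{y \<in> carrier R. y [^] n = x} \<subseteq> set_mset (roots ?p)"
  proof
    fix y assume y: "y \<in> {y \<in> carrier R. y [^] n = x}"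
    then have "is_root ?p y"
      using eval_binomial[OF x _ n, of y] x unfolding is_root_def by (auto simp: r_neg minus_eq)
    then show "y \<in> set_mset (roots ?p)"
      using roots_mem_iff_is_root[OF binomial_in_poly_ring[OF x]] by blast
  qed
  show "finite {y \<in> carrier R. y [^] n = x}"
    using sub by (rule finite_subset) simp
  have "card {y \<in> carrier R. y [^] n = x} \<le> card (set_mset (roots ?p))"
    using sub by (simp add: card_mono)
  also have "\<dots> \<le> size (roots ?p)"
    by (metis size_multiset_overloaded_eq card_eq_sum count_greater_eq_one_iff sum_mono)
  also have "\<dots> \<le> n"
    using size_roots_le_degree[OF binomial_in_poly_ring[OF x, of n]] n by simp
  finally show "card {y \<in> carrier R. y [^] n = x} \<le> n" .
qed

lemma (in algebraically_closed) exists_power_root: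
  fixes n :: nat
  assumes x: "x \<in> carrier L" and n: "n > 0"
  shows "\<exists>y \<in> carrier L. y [^] n = x"
proof -
  let ?p = "\<one> # replicate (n - 1) \<zero> @ [\<ominus> x]"
  have "size (roots ?p) = n"
    using roots_over_carrier[OF binomial_in_poly_ring[OF x]] n unfolding splitted_def by simp
  then obtain y where "y \<in># roots ?p"
    using n by (metis less_numeral_extra(3) multiset_nonemptyE size_empty)
  then have y: "is_root ?p y"
    using roots_mem_iff_is_root[OF binomial_in_poly_ring[OF x]] by blast
  then have "y \<in> carrier L" "y [^] n \<ominus> x = \<zero>"
    using eval_binomial[OF x _ n] unfolding is_root_def by auto
  then show ?thesis using x by (metis nat_pow_closed r_right_minus_eq)
qed

text \<open>
  The pairing is well defined: \<open>\<sigma> y / y\<close> depends neither on the representative \<open>x\<close> of the class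
  nor on the choice of its \<open>e\<close>-th root \<open>y\<close>.
\<close>

lemma kummer_pairing_well_defined:
  fixes L (structure)
  assumes cl: "algebraic_closure L K" and e: "e > 0"
    and card: "card (roots_of_unity (L\<lparr>carrier := K\<rparr>) e) = e"
    and M: "M = kummer_extension L K e"
    and \<sigma>: "\<sigma> \<in> carrier (galois_group L M K)"
    and C: "C \<in> carrier (unit_classes (L\<lparr>carrier := K\<rparr>) e)"
  shows "\<exists>!z. \<exists>x\<in>C. \<exists>y\<in>M - {\<zero>}. y [^] e = x \<and> z = \<sigma> y \<otimes> inv y" (is "\<exists>!z. ?P z")
    and "\<lbrakk> x \<in> C; y \<in> M - {\<zero>}; y [^] e = x \<rbrakk> \<Longrightarrow> kummer_pairing L M e \<sigma> C = \<sigma> y \<otimes> inv y"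
    and "kummer_pairing L M e \<sigma> C \<in> roots_of_unity (L\<lparr>carrier := K\<rparr>) e"
proof -
  interpret algebraic_closure L K by (rule cl)
  have pw: "y [^]\<^bsub>L\<lparr>carrier := K\<rparr>\<^esub> (n::nat) = y [^] n" for y n
    by (simp add: nat_pow_def)
  have KL: "K \<subseteq> carrier L" using subset .
  have KM: "K \<subseteq> M" unfolding M kummer_extension_def by (auto intro: generate_field.incl)
  have MsubL: "M \<subseteq> carrier L" unfolding M kummer_extension_def
    using generate_field_in_carrier[of "K \<union> {y \<in> carrier L. y [^] e \<in> K - {\<zero>}}"] KL by auto
  have Mm: "a \<otimes> b \<in> M" if "a \<in> M" "b \<in> M" for a b
    using that unfolding M kummer_extension_def by (rule generate_field.eng_mult)
  have Mpow: "a [^] (n::nat) \<in> M" if "a \<in> M" for a n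
    using that KM by (induction n) (auto intro: Mm)
  have \<sigma>K: "\<sigma> c = c" if "c \<in> K" for c
    using \<sigma> that by (auto simp: galois_group_def)
  have \<sigma>m: "\<sigma> (a \<otimes> b) = \<sigma> a \<otimes> \<sigma> b" if "a \<in> M" "b \<in> M" for a b
    using \<sigma> that by (auto simp: galois_group_def ring_hom_def)
  have \<sigma>M: "\<sigma> a \<in> M" if "a \<in> M" for a
    using \<sigma> that by (auto simp: galois_group_def ring_hom_def)
  have \<sigma>pow: "\<sigma> (a [^] (n::nat)) = \<sigma> a [^] n" if "a \<in> M" for a n
    using that \<sigma>K by (induction n) (auto simp: \<sigma>m Mpow)
  have mu: "roots_of_unity (L\<lparr>carrier := K\<rparr>) e = {z \<in> carrier L. z [^] e = \<one>}"
  proof (rule card_seteq)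
    show "finite {z \<in> carrier L. z [^] e = \<one>}" using card_power_roots[OF _ e] by simp
    show "roots_of_unity (L\<lparr>carrier := K\<rparr>) e \<subseteq> {z \<in> carrier L. z [^] e = \<one>}"
      using KL by (auto simp: roots_of_unity_def pw)
    show "card {z \<in> carrier L. z [^] e = \<one>} \<le> card (roots_of_unity (L\<lparr>carrier := K\<rparr>) e)"
      using card_power_roots[OF _ e] card by simp
  qed
  have muK: "z \<in> K" if "z \<in> carrier L" "z [^] e = \<one>" for z
    using that mu by (auto simp: roots_of_unity_def)
  obtain x0 where x0: "x0 \<in> K" "x0 \<noteq> \<zero>"
    and Ceq: "C = unit_powers (L\<lparr>carrier := K\<rparr>) e #>\<^bsub>Multiplicative_Group.mult_of (L\<lparr>carrier := K\<rparr>)\<^esub> x0"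
    using C by (auto simp: unit_classes_def FactGroup_def RCOSETS_def)
  have Cmem: "x \<in> C \<longleftrightarrow> (\<exists>a \<in> K - {\<zero>}. x = a [^] e \<otimes> x0)" for x
    unfolding Ceq r_coset_def unit_powers_def by (auto simp: pw)
  have inv_closed: "inv a \<in> carrier L" "inv a \<noteq> \<zero>" "a \<otimes> inv a = \<one>" "inv a \<otimes> a = \<one>"
    if "a \<in> carrier L" "a \<noteq> \<zero>" for a
    using that field_Units by auto
  have Kinv: "inv a \<in> K" if "a \<in> K" "a \<noteq> \<zero>" for a
    using that subfield_m_inv(1)[OF subfield_axioms] by auto
  have pow0: "a [^] (n::nat) \<noteq> \<zero>" if "a \<in> carrier L" "a \<noteq> \<zero>" for a n
    using that by (induction n) (auto simp: integral_iff)
  have unique: "\<sigma> y \<otimes> inv y = \<sigma> y' \<otimes> inv y'"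
    if y: "y \<in> M - {\<zero>}" "y' \<in> M - {\<zero>}" "y [^] e \<in> C" "y' [^] e \<in> C" for y y'
  proof -
    obtain a a' where a: "a \<in> K" "a \<noteq> \<zero>" "y [^] e = a [^] e \<otimes> x0"
      and a': "a' \<in> K" "a' \<noteq> \<zero>" "y' [^] e = a' [^] e \<otimes> x0"
      using y(3,4) by (auto simp: Cmem)
    have [simp]: "y \<in> carrier L" "y' \<in> carrier L" "a \<in> carrier L" "a' \<in> carrier L" "x0 \<in> carrier L"
      using y a a' MsubL KL x0 by auto
    have y0: "y \<noteq> \<zero>" "y' \<noteq> \<zero>" using y by auto
    define w where "w = a \<otimes> y'"
    have w: "w \<in> carrier L" "w \<noteq> \<zero>" using a y0 by (auto simp: w_def integral_iff)
    define z where "z = (a' \<otimes> y) \<otimes> inv w"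
    have zL: "z \<in> carrier L" using w by (auto simp: z_def inv_closed)
    have zw: "z \<otimes> w = a' \<otimes> y" using w by (simp add: z_def m_assoc inv_closed)
    have "(a' \<otimes> y) [^] e = w [^] e"
      by (simp add: w_def nat_pow_distrib a a' m_ac)
    then have "z [^] e \<otimes> w [^] e = \<one> \<otimes> w [^] e"
      using zw zL w by (simp flip: nat_pow_distrib)
    then have "z [^] e = \<one>"
      using m_rcancel[OF pow0[OF w, of e], of "z [^] e" \<one>] zL w by simp
    then have zK: "z \<in> K" using muK zL by blast
    define c where "c = inv a' \<otimes> (z \<otimes> a)"
    have cK: "c \<in> K" using zK a a' Kinv by (simp add: c_def)
    have [simp]: "c \<in> carrier L" using cK KL by auto
    have "y = inv a' \<otimes> (a' \<otimes> y)"
      using a' by (simp add: inv_closed flip: m_assoc)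
    also have "\<dots> = c \<otimes> y'"
      using zL a' by (simp add: c_def w_def inv_closed m_assoc flip: zw)
    finally have yc: "y = c \<otimes> y'" .
    have c0: "c \<noteq> \<zero>" using yc y0 by auto
    have [simp]: "\<sigma> y' \<in> carrier L" using \<sigma>M y MsubL by auto
    have s: "\<sigma> y = c \<otimes> \<sigma> y'" using yc \<sigma>m \<sigma>K cK KM y by auto
    have "(\<sigma> y \<otimes> inv y) \<otimes> y = (\<sigma> y' \<otimes> inv y') \<otimes> y"
    proof -
      have "(\<sigma> y \<otimes> inv y) \<otimes> y = \<sigma> y"
        using y0 s by (simp add: m_assoc inv_closed)
      also have "\<dots> = c \<otimes> (\<sigma> y' \<otimes> (inv y' \<otimes> y'))" using s y0 by (simp add: inv_closed)
      also have "\<dots> = (\<sigma> y' \<otimes> inv y') \<otimes> y"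
        unfolding yc using y0 inv_closed(1)[of y'] by (simp add: m_ac)
      finally show ?thesis .
    qed
    then show ?thesis
      using y0 s m_rcancel[of y "\<sigma> y \<otimes> inv y" "\<sigma> y' \<otimes> inv y'"] inv_closed(1) by auto
  qed
  obtain y0 where y0: "y0 \<in> carrier L" "y0 [^] e = x0"
    using exists_power_root[of x0 e] x0 KL e by auto
  have y0M: "y0 \<in> M" unfolding M kummer_extension_def
    by (rule generate_field.incl) (use y0 x0 in auto)
  have y0n: "y0 \<noteq> \<zero>" using y0 x0 e by (metis nat_pow_zero neq0_conv)
  have y0C: "y0 [^] e \<in> C"
    unfolding Cmem using y0 x0 KL by (intro bexI[of _ \<one>]) auto
  have P0: "?P (\<sigma> y0 \<otimes> inv y0)" using y0C y0M y0n by auto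
  have eq0: "z = \<sigma> y0 \<otimes> inv y0" if z: "?P z" for z
  proof -
    obtain y where "y \<in> M - {\<zero>}" "y [^] e \<in> C" "z = \<sigma> y \<otimes> inv y" using z by blast
    then show ?thesis using unique[of y y0] y0C y0M y0n by simp
  qed
  show ex1: "\<exists>!z. ?P z" by (rule ex1I[where P = ?P, OF P0 eq0])
  show eq: "kummer_pairing L M e \<sigma> C = \<sigma> y \<otimes> inv y"
    if "x \<in> C" "y \<in> M - {\<zero>}" "y [^] e = x" for x y
    unfolding kummer_pairing_def by (rule the1_equality[OF ex1]) (use that in blast)
  have sL: "\<sigma> y0 \<in> carrier L" using \<sigma>M y0M MsubL by auto
  have "(\<sigma> y0 \<otimes> inv y0) [^] e = \<sigma> y0 [^] e \<otimes> inv y0 [^] e"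
    using sL y0 y0n by (simp add: nat_pow_distrib inv_closed)
  also have "\<sigma> y0 [^] e = y0 [^] e" using \<sigma>pow[OF y0M, of e] y0 x0 \<sigma>K by simp
  also have "y0 [^] e \<otimes> inv y0 [^] e = \<one>"
    using nat_pow_distrib[of y0 "inv y0" e] y0(1) y0n by (simp add: inv_closed)
  finally have "\<sigma> y0 \<otimes> inv y0 \<in> roots_of_unity (L\<lparr>carrier := K\<rparr>) e"
    unfolding mu using sL y0 y0n by (simp add: inv_closed)
  then show "kummer_pairing L M e \<sigma> C \<in> roots_of_unity (L\<lparr>carrier := K\<rparr>) e"
    using eq[OF y0C _ refl] y0M y0n by simp
qed

definition kummer_orth_classes ::
    "('a, 'b) ring_scheme \<Rightarrow> 'a set \<Rightarrow> 'a set \<Rightarrow> nat \<Rightarrow> ('a \<Rightarrow> 'a) set \<Rightarrow> 'a set set"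
  where "kummer_orth_classes L M K e H =
    {C \<in> carrier (unit_classes (L\<lparr>carrier := K\<rparr>) e). \<forall>\<sigma>\<in>H. kummer_pairing L M e \<sigma> C = \<one>\<^bsub>L\<^esub>}"

definition kummer_orth_galois ::
    "('a, 'b) ring_scheme \<Rightarrow> 'a set \<Rightarrow> 'a set \<Rightarrow> nat \<Rightarrow> 'a set set \<Rightarrow> ('a \<Rightarrow> 'a) set"
  where "kummer_orth_galois L M K e S =
    {\<sigma> \<in> carrier (galois_group L M K). \<forall>C\<in>S. kummer_pairing L M e \<sigma> C = \<one>\<^bsub>L\<^esub>}"

end

theory Submission
  imports Defs
begin

text \<open>
  Let \<open>\<pi>\<close> be a uniformiser of \<open>K\<close>, let \<open>u\<close> be a unit generating the units of the residue field,
  and choose \<open>\<eta>\<close>, \<open>\<omega>\<close> with \<open>\<eta>\<^sup>e = u\<close> and \<open>\<omega>\<^sup>e = \<pi>\<close>. As the principal units are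
  uniquely \<open>e\<close>-divisible, \<open>M = K(\<eta>, \<omega>)\<close>, and the classes of the Teichmueller lifts are the
  classes of the units of \<open>K\<close>. No valuation is extended to \<open>M\<close>. Instead put \<open>A0 = O[\<eta>]\<close> and
  \<open>A = A0[\<omega>]\<close>, where \<open>O\<close> is the valuation ring of \<open>K\<close>. These are integral over \<open>O\<close>, so \<open>\<omega>\<close> is
  not invertible in \<open>A\<close>; a trace argument with the Frobenius map shows that \<open>A0/\<pi>A0\<close> is a field.
  Hence \<open>A/\<omega>A\<close> is reduced, \<open>A\<close> is the ring of integers of \<open>M\<close>, and \<open>1, \<omega>, \<dots>, \<omega>\<^sup>e\<^sup>-\<^sup>1\<close> are
  linearly independent over \<open>K(\<eta>)\<close>. An automorphism of \<open>M\<close> over \<open>K\<close> that fixes \<open>\<eta>\<close> moves each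
  element of \<open>A\<close> by an element of \<open>\<omega>A\<close>, so it lies in the inertia subgroup. Conversely, if \<open>y\<^sup>e\<close>
  is a unit and \<open>\<sigma> y = z y\<close> with \<open>z \<noteq> 1\<close>, then \<open>\<sigma> y - y = (z - 1) y\<close> is a unit. The independence
  gives the automorphisms \<open>\<omega> \<mapsto> z \<omega>\<close> over \<open>K(\<eta>)\<close>, and these detect the valuation modulo \<open>e\<close>.
\<close>

section \<open>Discrete valuations\<close>

text \<open>Inertia is defined through the integral closure and its non-units, so the difficulty is
  to know that closure explicitly, with \<open>A\<close> as the candidate. That \<omega> is not a
  unit of \<open>A\<close> comes from integrality alone: an inverse of \<pi> in \<open>A\<close>
  would be integral over the valuation ring of K, and clearing denominators in its equation would
  make \<pi> a unit there. That \<open>A\<close> is integrally closed in M comes from reducedness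
  modulo \<omega>: if x is integral and x\<omega>^m lies in \<open>A\<close> with m > 0, then some
  power of x\<omega>^m lies in \<omega>A, hence x\<omega>^m itself does, and m can be lowered.
  Independence of the powers of \<omega> is an Eisenstein argument: in a relation over
  \<open>A0\<close> each coefficient is divisible by \<pi>, hence by all powers of \<pi>. That e is
  prime to p enters through Hensel's lemma for e-th powers of principal units and through the trace,
  since the trace of an idempotent is e times itself. That e divides q - 1 makes the q-th power map
  multiply \<eta> by u^((q-1)/e), which modulo \<pi> is a root of unity of exact order e; so
  Frobenius acts on monomials in \<eta> by scalars.\<close>

text \<open>The additive inverse is a definite description over the carrier, so, unlike sum and
  product, it does not pass by definition to a smaller carrier. Uniqueness of the inverse in the
  large ring identifies the two.\<close>

lemma (in ring) subring_a_inv: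
  assumes "subring S R" "x \<in> S"
  shows "\<ominus>\<^bsub>R\<lparr>carrier := S\<rparr>\<^esub> x = \<ominus> x"
proof -
  interpret S: ring "R\<lparr>carrier := S\<rparr>" by (rule subring_is_ring[OF assms(1)])
  have S: "S \<subseteq> carrier R" by (rule subringE(1)[OF assms(1)])
  have "x \<oplus> \<ominus>\<^bsub>R\<lparr>carrier := S\<rparr>\<^esub> x = \<zero>" "\<ominus>\<^bsub>R\<lparr>carrier := S\<rparr>\<^esub> x \<in> S"
    using S.r_neg[of x] S.a_inv_closed[of x] assms(2) by auto
  then show ?thesis using S assms(2) by (metis a_comm minus_equality subsetD)
qed

lemma (in ring) subring_minus:
  assumes "subring S R" "x \<in> S" "y \<in> S"
  shows "x \<ominus>\<^bsub>R\<lparr>carrier := S\<rparr>\<^esub> y = x \<ominus> y"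
  using subring_a_inv[OF assms(1,3)] by (simp add: a_minus_def)

lemma (in ring) subring_nat_pow: "x [^]\<^bsub>R\<lparr>carrier := S\<rparr>\<^esub> (n::nat) = x [^] n"
  by (simp add: nat_pow_def)

lemma (in ideal) rcos_eq_iff:
  assumes "x \<in> carrier R" "y \<in> carrier R"
  shows "I +> x = I +> y \<longleftrightarrow> x \<ominus> y \<in> I"
  using quotient_eq_iff_same_a_r_cos[OF ideal_axioms assms] by auto

context local_field
begin

lemma v_one: "v \<one> = 0"
  using v_mult[of \<one> \<one>] by simp

lemma nz_mult: "\<lbrakk>x \<in> carrier R - {\<zero>}; y \<in> carrier R - {\<zero>}\<rbrakk> \<Longrightarrow> x \<otimes> y \<in> carrier R - {\<zero>}"
  by (auto simp: integral_iff)

lemma nz_inv: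
  assumes "x \<in> carrier R - {\<zero>}"
  shows "inv x \<in> carrier R - {\<zero>}" "x \<otimes> inv x = \<one>" "inv x \<otimes> x = \<one>"
  using assms field_Units by (auto simp: Units_inv_Units)

lemma nz_pow: "x \<in> carrier R - {\<zero>} \<Longrightarrow> x [^] (n::nat) \<in> carrier R - {\<zero>}"
  by (induction n) (auto simp: integral_iff)

lemma v_inv:
  assumes "x \<in> carrier R - {\<zero>}" shows "v (inv x) = - v x"
  using v_mult[OF assms nz_inv(1)[OF assms]] nz_inv[OF assms] v_one by simp

lemma v_pow:
  assumes "x \<in> carrier R - {\<zero>}" shows "v (x [^] (n::nat)) = int n * v x"
proof (induction n)
  case (Suc n)
  then show ?case using v_mult[OF nz_pow[OF assms, of n] assms] by (simp add: algebra_simps)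
qed (simp add: v_one)

text \<open>As (-1)(-1) = 1, twice the integer v(-1) is 0.\<close>

lemma v_minus:
  assumes "x \<in> carrier R - {\<zero>}" shows "v (\<ominus> x) = v x"
proof -
  have m: "\<ominus> \<one> \<in> carrier R - {\<zero>}" by (metis Diff_iff add.inv_closed minus_minus minus_zero
        one_closed one_not_zero singletonD)
  have "v (\<ominus> \<one>) + v (\<ominus> \<one>) = v (\<ominus> \<one> \<otimes> \<ominus> \<one>)" using v_mult[OF m m] by simp
  also have "\<ominus> \<one> \<otimes> \<ominus> \<one> = \<one>" by algebra
  finally have "v (\<ominus> \<one>) = 0" using v_one by simp
  moreover have "\<ominus> \<one> \<otimes> x = \<ominus> x" using assms by (simp add: l_minus)
  ultimately show ?thesis using v_mult[OF m assms] by simp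
qed

lemma exists_uniformiser: "\<exists>\<pi> \<in> carrier R - {\<zero>}. v \<pi> = 1"
  by (metis UNIV_I imageE v_normalised)

lemma vge_zero [simp]: "vge R v \<zero> n" by (simp add: vge_def)

lemma vge_mono: "\<lbrakk>vge R v x m; n \<le> m\<rbrakk> \<Longrightarrow> vge R v x n" by (auto simp: vge_def)

lemma vge_add:
  assumes "x \<in> carrier R" "y \<in> carrier R" "vge R v x n" "vge R v y n"
  shows "vge R v (x \<oplus> y) n"
proof (cases "x = \<zero> \<or> y = \<zero> \<or> x \<oplus> y = \<zero>")
  case False
  then show ?thesis using v_add[of x y] assms by (auto simp: vge_def)
qed (use assms in auto)

lemma vge_minus: "\<lbrakk>x \<in> carrier R; vge R v x n\<rbrakk> \<Longrightarrow> vge R v (\<ominus> x) n"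
  using v_minus[of x] by (auto simp: vge_def)

lemma vge_mult:
  assumes "x \<in> carrier R" "y \<in> carrier R" "vge R v x m" "vge R v y n"
  shows "vge R v (x \<otimes> y) (m + n)"
  using v_mult[of x y] assms by (cases "x = \<zero> \<or> y = \<zero>") (auto simp: vge_def)

lemma vge_diff:
  "\<lbrakk>x \<in> carrier R; y \<in> carrier R; vge R v x n; vge R v y n\<rbrakk> \<Longrightarrow> vge R v (x \<ominus> y) n"
  by (simp add: minus_eq vge_add vge_minus)

lemma vge_diff_commute:
  assumes "x \<in> carrier R" "y \<in> carrier R" "vge R v (x \<ominus> y) n"
  shows "vge R v (y \<ominus> x) n"
proof -
  have "y \<ominus> x = \<ominus> (x \<ominus> y)" using assms by (simp add: minus_add minus_eq a_comm)
  then show ?thesis using assms vge_minus[of "x \<ominus> y" n] by simp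
qed

lemma vge_diff_trans:
  assumes "x \<in> carrier R" "y \<in> carrier R" "z \<in> carrier R"
    "vge R v (x \<ominus> y) n" "vge R v (y \<ominus> z) n"
  shows "vge R v (x \<ominus> z) n"
proof -
  have "x \<ominus> z = (x \<ominus> y) \<oplus> (y \<ominus> z)" using assms(1-3) by algebra
  then show ?thesis using assms vge_add[of "x \<ominus> y" "y \<ominus> z" n] by simp
qed

lemma valuation_ring_subring: "subring (valuation_ring R v) R"
proof (rule subringI)
  show "\<And>a b. a \<in> valuation_ring R v \<Longrightarrow> b \<in> valuation_ring R v \<Longrightarrow> a \<otimes> b \<in> valuation_ring R v"
    using vge_mult[of _ _ 0 0] by (auto simp: valuation_ring_def)
qed (auto simp: valuation_ring_def vge_add vge_minus, simp add: vge_def v_one)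

section \<open>The residue field\<close>

abbreviation \<O> where "\<O> \<equiv> R\<lparr>carrier := valuation_ring R v\<rparr>"
abbreviation \<mm> where "\<mm> \<equiv> valuation_ideal R v"
abbreviation \<kk> where "\<kk> \<equiv> residue_field R v"

lemma valuation_ring_carrier: "x \<in> valuation_ring R v \<Longrightarrow> x \<in> carrier R"
  by (simp add: valuation_ring_def)

lemma OO_cring: "cring \<O>"
  using subring_is_domain[OF valuation_ring_subring] by (simp add: domain_def)

lemma valuation_ring_unit:
  assumes "x \<in> valuation_ring R v" "x \<notin> \<mm>"
  shows "x \<in> carrier R - {\<zero>}" "v x = 0" "inv x \<in> valuation_ring R v" "inv x \<otimes> x = \<one>" "x \<otimes> inv x = \<one>"
proof -
  show x: "x \<in> carrier R - {\<zero>}" and vx: "v x = 0"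
    using assms by (auto simp: valuation_ring_def valuation_ideal_def vge_def)
  show "inv x \<in> valuation_ring R v" "inv x \<otimes> x = \<one>" "x \<otimes> inv x = \<one>"
    using nz_inv[OF x] v_inv[OF x] vx by (auto simp: valuation_ring_def vge_def)
qed

lemma valuation_ring_unit_iff:
  "x \<in> valuation_ring R v \<and> x \<notin> \<mm> \<longleftrightarrow> x \<in> carrier R - {\<zero>} \<and> v x = 0"
  by (auto simp: valuation_ring_def valuation_ideal_def vge_def)

lemma mm_ideal: "ideal \<mm> \<O>"
proof -
  interpret OO: cring \<O> by (rule OO_cring)
  show ?thesis
  proof (rule idealI)
    show "subgroup \<mm> (add_monoid \<O>)"
    proof (rule OO.add.subgroupI)
      show "\<mm> \<subseteq> carrier \<O>"
        by (auto simp: valuation_ideal_def valuation_ring_def intro: vge_mono[of _ 1 0])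
      show "\<mm> \<noteq> {}" by (auto simp: valuation_ideal_def intro!: exI[of _ \<zero>])
      fix a assume a: "a \<in> \<mm>"
      then have "a \<in> valuation_ring R v"
        by (auto simp: valuation_ideal_def valuation_ring_def intro: vge_mono[of _ 1 0])
      then show "\<ominus>\<^bsub>\<O>\<^esub> a \<in> \<mm>"
        using subring_a_inv[OF valuation_ring_subring] a
        by (simp add: a_inv_def[symmetric] valuation_ideal_def vge_minus)
    next
      show "\<And>a b. a \<in> \<mm> \<Longrightarrow> b \<in> \<mm> \<Longrightarrow> a \<oplus>\<^bsub>\<O>\<^esub> b \<in> \<mm>"
        by (simp add: valuation_ideal_def vge_add)
    qed
  next
    show "\<And>a x. a \<in> \<mm> \<Longrightarrow> x \<in> carrier \<O> \<Longrightarrow> x \<otimes>\<^bsub>\<O>\<^esub> a \<in> \<mm>"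
         "\<And>a x. a \<in> \<mm> \<Longrightarrow> x \<in> carrier \<O> \<Longrightarrow> a \<otimes>\<^bsub>\<O>\<^esub> x \<in> \<mm>"
      using vge_mult[of _ _ 0 1] vge_mult[of _ _ 1 0]
      by (auto simp: valuation_ideal_def valuation_ring_def)
  qed (rule OO.ring_axioms)
qed

sublocale OO: cring \<O>
  by (rule OO_cring)

sublocale mm: ideal \<mm> \<O>
  by (rule mm_ideal)

lemma one_notin_mm: "\<one> \<notin> \<mm>"
  by (simp add: valuation_ideal_def vge_def v_one)

text \<open>Elements outside the ideal have valuation 0, so their inverses stay in the valuation
  ring and any larger ideal contains 1.\<close>

lemma mm_maximal: "maximalideal \<mm> \<O>"
proof (rule maximalidealI[OF mm_ideal])
  show "carrier \<O> \<noteq> \<mm>" using one_notin_mm OO.one_closed by auto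
  fix J assume J: "ideal J \<O>" "\<mm> \<subseteq> J" "J \<subseteq> carrier \<O>"
  interpret J: ideal J \<O> by fact
  show "J = \<mm> \<or> J = carrier \<O>"
  proof (cases "J = \<mm>")
    case False
    then obtain x where x: "x \<in> J" "x \<notin> \<mm>" using J by auto
    then have "x \<in> valuation_ring R v" using J by auto
    then have "\<one>\<^bsub>\<O>\<^esub> \<in> J"
      using J.I_l_closed[OF x(1), of "inv x"] valuation_ring_unit[of x] x by auto
    then show ?thesis using J.one_imp_carrier by simp
  qed simp
qed

sublocale kk: field \<kk>
  unfolding residue_field_def by (rule maximalideal.quotient_is_field[OF mm_maximal OO_cring])

abbreviation res where "res x \<equiv> \<mm> +>\<^bsub>\<O>\<^esub> x"

sublocale res: ring_hom_ring \<O> \<kk> "\<lambda>x. res x"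
  unfolding residue_field_def by (rule mm.rcos_ring_hom_ring)

lemma carrier_kk: "carrier \<kk> = (\<lambda>x. res x) ` valuation_ring R v"
  by (auto simp: residue_field_def FactRing_def A_RCOSETS_def')

lemma res_eq_iff:
  "\<lbrakk>x \<in> valuation_ring R v; y \<in> valuation_ring R v\<rbrakk> \<Longrightarrow> res x = res y \<longleftrightarrow> x \<ominus> y \<in> \<mm>"
  using mm.rcos_eq_iff[of x y] subring_minus[OF valuation_ring_subring] by simp

lemma res_eq_zero_iff: "x \<in> valuation_ring R v \<Longrightarrow> res x = \<zero>\<^bsub>\<kk>\<^esub> \<longleftrightarrow> x \<in> \<mm>"
  using res_eq_iff[of x \<zero>] res.hom_zero OO.zero_closed valuation_ring_carrier[of x]
  by (simp add: minus_eq)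

text \<open>Residue classes are literally sets of lifts; this turns the membership in the definition
  of \<open>teichmuller\<close> into an equation between residues.\<close>

lemma mem_res_iff:
  assumes "x \<in> valuation_ring R v"
  shows "y \<in> res x \<longleftrightarrow> y \<in> valuation_ring R v \<and> res y = res x"
proof -
  show ?thesis
    using assms mm.a_rcos_self[of y] mm.a_elemrcos_carrier[of x y]
      OO.a_repr_independence[OF _ _ mm.a_subgroup, of y x] by auto
qed

lemma finite_kk: "finite (carrier \<kk>)" by (rule finite_residue_field)

abbreviation q where "q \<equiv> card (carrier \<kk>)"

lemma res_pow: "x \<in> valuation_ring R v \<Longrightarrow> res (x [^] (n::nat)) = res x [^]\<^bsub>\<kk>\<^esub> n"
  using res.hom_nat_pow[of x n] by (simp add: subring_nat_pow)

lemma res_one: "res \<one> = \<one>\<^bsub>\<kk>\<^esub>" using res.hom_one by simp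

lemma valuation_ring_pow: "x \<in> valuation_ring R v \<Longrightarrow> x [^] (n::nat) \<in> valuation_ring R v"
  using OO.nat_pow_closed[of x n] by (simp add: subring_nat_pow)

lemma valuation_ring_one: "\<one> \<in> valuation_ring R v"
  using OO.one_closed by simp

lemma order_mult_of_kk: "order (Multiplicative_Group.mult_of \<kk>) = q - 1"
  using kk.order_mult_of[OF finite_kk] by (simp add: order_def)

lemma q_gt_1: "q > 1"
  by (metis card_1_singletonE finite_kk kk.one_closed kk.one_not_zero kk.zero_closed less_one
      linorder_neqE_nat card_0_eq empty_iff singletonD)

lemma valuation_ring_pow_q:
  assumes "x \<in> valuation_ring R v"
  shows "x [^] q \<ominus> x \<in> \<mm>"
proof -
  have r: "res x \<in> carrier \<kk>" using assms by (auto simp: carrier_kk)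
  have "res x [^]\<^bsub>\<kk>\<^esub> q = res x"
  proof (cases "res x = \<zero>\<^bsub>\<kk>\<^esub>")
    case True
    then show ?thesis using q_gt_1 by (simp add: kk.nat_pow_zero)
  next
    case False
    then have "res x [^]\<^bsub>\<kk>\<^esub> (q - 1) = \<one>\<^bsub>\<kk>\<^esub>"
      using group.pow_order_eq_1[OF kk.field_mult_group, of "res x"] r
      by (simp add: order_mult_of_kk Multiplicative_Group.nat_pow_mult_of)
    then have "res x [^]\<^bsub>\<kk>\<^esub> Suc (q - 1) = res x" using r by simp
    then show ?thesis using q_gt_1 by simp
  qed
  then show ?thesis using res_eq_iff[of "x [^] q" x] valuation_ring_pow[of x] assms res_pow by simp
qed

lemma unit_pow_q_minus_1:
  assumes "x \<in> carrier R - {\<zero>}" "v x = 0"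
  shows "x [^] (q - 1) \<ominus> \<one> \<in> \<mm>"
proof -
  have x: "x \<in> valuation_ring R v" "x \<notin> \<mm>" using assms valuation_ring_unit_iff by auto
  have r: "res x \<in> carrier \<kk>" using x by (auto simp: carrier_kk)
  have "res x [^]\<^bsub>\<kk>\<^esub> (q - 1) = \<one>\<^bsub>\<kk>\<^esub>"
    using group.pow_order_eq_1[OF kk.field_mult_group, of "res x"] r x
    by (simp add: order_mult_of_kk Multiplicative_Group.nat_pow_mult_of res_eq_zero_iff)
  then show ?thesis
    using res_eq_iff[of "x [^] (q - 1)" \<one>] valuation_ring_pow[of x] x res_pow res_one
      valuation_ring_one by simp
qed

text \<open>The multiplicative group of a finite field is cyclic, and \<open>u\<close> lifts a
  generator. The last clause records that its order is the full q - 1, which later yields elements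
  of exact order e.\<close>

lemma residue_generator:
  obtains u where "u \<in> carrier R - {\<zero>}" "v u = 0"
    "\<And>x. \<lbrakk>x \<in> carrier R - {\<zero>}; v x = 0\<rbrakk> \<Longrightarrow> \<exists>i::nat. x \<ominus> u [^] i \<in> \<mm>"
    "\<And>j::nat. u [^] j \<ominus> \<one> \<in> \<mm> \<Longrightarrow> q - 1 dvd j"
proof -
  obtain a where a: "a \<in> carrier (Multiplicative_Group.mult_of \<kk>)"
    and gen: "carrier (Multiplicative_Group.mult_of \<kk>) = {a [^]\<^bsub>\<kk>\<^esub> i | i::nat. i \<in> UNIV}"
    using kk.finite_field_mult_group_has_gen[OF finite_kk] by auto
  obtain u where u: "u \<in> valuation_ring R v" "a = res u" using a by (auto simp: carrier_kk)
  then have u2: "u \<notin> \<mm>" using a res_eq_zero_iff by auto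
  interpret G: group "Multiplicative_Group.mult_of \<kk>" by (rule kk.field_mult_group)
  show ?thesis
  proof (rule that)
    show "u \<in> carrier R - {\<zero>}" "v u = 0" using valuation_ring_unit u u2 by auto
    fix x assume x: "x \<in> carrier R - {\<zero>}" "v x = 0"
    then have x: "x \<in> valuation_ring R v" "x \<notin> \<mm>" using valuation_ring_unit_iff by auto
    then have "res x \<in> carrier (Multiplicative_Group.mult_of \<kk>)" using res_eq_zero_iff by (auto simp: carrier_kk)
    then obtain i :: nat where "res x = a [^]\<^bsub>\<kk>\<^esub> i" using gen by auto
    then show "\<exists>i::nat. x \<ominus> u [^] i \<in> \<mm>"
      using u x res_eq_iff[of x "u [^] i"] valuation_ring_pow[of u] res_pow by auto
  next
    fix j :: nat assume "u [^] j \<ominus> \<one> \<in> \<mm>"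
    then have "res (u [^] j) = res \<one>"
      using res_eq_iff u valuation_ring_pow[of u] valuation_ring_one by simp
    then have "a [^]\<^bsub>Multiplicative_Group.mult_of \<kk>\<^esub> j = \<one>\<^bsub>Multiplicative_Group.mult_of \<kk>\<^esub>"
      using res_pow u res_one by (simp add: Multiplicative_Group.nat_pow_mult_of)
    then have j: "G.ord a dvd j" using G.pow_eq_id[OF a] by simp
    have fin: "finite (carrier (Multiplicative_Group.mult_of \<kk>))" using finite_kk by simp
    \<comment> \<open>Every power of \<open>a\<close> already occurs with exponent below the order
      of \<open>a\<close>; counting these gives q - 1 as a lower bound for the order.\<close>
    have "carrier (Multiplicative_Group.mult_of \<kk>) \<subseteq> (\<lambda>i. a [^]\<^bsub>\<kk>\<^esub> i) ` {0..G.ord a - 1}"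
      using gen G.ord_elems[OF fin a] by (auto simp: Multiplicative_Group.nat_pow_mult_of)
    then have "card (carrier (Multiplicative_Group.mult_of \<kk>)) \<le> card {0..G.ord a - 1}"
      by (meson card_image_le card_mono finite_atLeastAtMost finite_imageI le_trans)
    also have "\<dots> = G.ord a" using G.ord_ge_1[OF fin a] by simp
    finally have "q - 1 \<le> G.ord a" using order_mult_of_kk by (simp add: order_def)
    moreover have "G.ord a dvd q - 1" using G.ord_dvd_group_order[OF a] order_mult_of_kk by simp
    ultimately have "G.ord a = q - 1" using q_gt_1 by (metis dvd_imp_le le_antisym zero_less_diff)
    then show "q - 1 dvd j" using j by simp
  qed
qed

section \<open>Characteristic and cardinality of the residue field\<close>

lemma res_add_pow: "res (add_pow R (n::nat) \<one>) = add_pow \<kk> (n) \<one>\<^bsub>\<kk>\<^esub>" and add_pow_valuation_ring: "add_pow R (n) \<one> \<in> valuation_ring R v"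
proof -
  have "res (add_pow R (n::nat) \<one>) = add_pow \<kk> (n) \<one>\<^bsub>\<kk>\<^esub> \<and> add_pow R (n) \<one> \<in> valuation_ring R v"
  proof (induction n)
    case 0
    show ?case using res.hom_zero OO.zero_closed by simp
  next
    case (Suc n)
    then show ?case using res.hom_add[of "add_pow R (n) \<one>" \<one>] OO.a_closed[of "add_pow R (n) \<one>" \<one>] valuation_ring_one res_one
      by simp
  qed
  then show "res (add_pow R (n::nat) \<one>) = add_pow \<kk> (n) \<one>\<^bsub>\<kk>\<^esub>" "add_pow R (n) \<one> \<in> valuation_ring R v" by auto
qed

lemma kk_add_pow_one: "add_pow \<kk> (n::nat) \<one>\<^bsub>\<kk>\<^esub> = \<zero>\<^bsub>\<kk>\<^esub> \<longleftrightarrow> ring_char \<kk> dvd n"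
  using kk.add.pow_eq_id[of "\<one>\<^bsub>\<kk>\<^esub>" n] by (simp add: ring_char_def add_pow_def)

lemma add_pow_one_mem_mm: "add_pow R (n::nat) \<one> \<in> \<mm> \<longleftrightarrow> ring_char \<kk> dvd n"
  using res_add_pow kk_add_pow_one res_eq_zero_iff add_pow_valuation_ring by metis

text \<open>Cauchy's theorem, taken from Sylow with exponent one: the additive group has a nonzero h
  killed by r, and cancelling h gives r = 0 in the field. So the characteristic divides the prime r,
  and it is not 1.\<close>

lemma prime_factor_of_q:
  assumes r: "Factorial_Ring.prime r" "r dvd q"
  shows "r = ring_char \<kk>"
proof -
  obtain m where "q = r * m" using r by auto
  then obtain H where H: "subgroup H (add_monoid \<kk>)" "card H = r"
    using sylow_thm[OF r(1) kk.a_group, of 1 m] finite_kk by (auto simp: order_def)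
  interpret H: group "add_monoid \<kk>\<lparr>carrier := H\<rparr>"
    by (rule subgroup.subgroup_is_group[OF H(1) kk.a_group])
  have "H \<noteq> {\<zero>\<^bsub>\<kk>\<^esub>}" using H(2) r by auto
  then obtain h where h: "h \<in> H" "h \<noteq> \<zero>\<^bsub>\<kk>\<^esub>"
    using subgroup.one_closed[OF H(1)] by auto
  have hc: "h \<in> carrier \<kk>" using h subgroup.subset[OF H(1)] by auto
  have "h [^]\<^bsub>add_monoid \<kk>\<lparr>carrier := H\<rparr>\<^esub> r = \<zero>\<^bsub>\<kk>\<^esub>"
    using H.pow_order_eq_1[of h] h H by (simp add: order_def)
  then have "add_pow \<kk> (r) h = \<zero>\<^bsub>\<kk>\<^esub>" by (simp add: add_pow_def nat_pow_def)
  then have "(add_pow \<kk> (r) \<one>\<^bsub>\<kk>\<^esub>) \<otimes>\<^bsub>\<kk>\<^esub> h = \<zero>\<^bsub>\<kk>\<^esub>" using kk.add_pow_ldistr[of "\<one>\<^bsub>\<kk>\<^esub>" h r] hc by simp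
  then have "add_pow \<kk> (r) \<one>\<^bsub>\<kk>\<^esub> = \<zero>\<^bsub>\<kk>\<^esub>" using kk.integral_iff hc h by simp
  then have "ring_char \<kk> dvd r" using kk_add_pow_one by simp
  moreover have "ring_char \<kk> \<noteq> 1" using kk_add_pow_one[of 1] by auto
  ultimately show ?thesis using r by (auto simp: prime_nat_iff)
qed

lemma residue_char_prime: "Factorial_Ring.prime (ring_char \<kk>)"
  using prime_factor_of_q q_gt_1 prime_factor_nat[of q] by auto

text \<open>Only one prime divides q. This form makes the q-th power map an iterated Frobenius,
  hence additive in characteristic p.\<close>

lemma q_prime_power: "\<exists>f>0. q = ring_char \<kk> ^ f"
proof -
  have "prime_factors q \<subseteq> {ring_char \<kk>}" using prime_factor_of_q by auto
  then have "q = ring_char \<kk> ^ multiplicity (ring_char \<kk>) q"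
    using prime_factorization_nat[of q] q_gt_1 by (cases "prime_factors q = {}")
      (auto simp: subset_singleton_iff prime_factorization_1)
  then show ?thesis using q_gt_1 by (metis gr0I less_irrefl power_0)
qed

section \<open>Principal units and Teichmueller lifts\<close>

lemma vge_all_imp_zero: "(\<And>N. vge R v x N) \<Longrightarrow> x = \<zero>"
  unfolding vge_def by (metis less_add_one not_less)

lemma vge_pow_diff:
  assumes "a \<in> valuation_ring R v" "b \<in> valuation_ring R v" "vge R v (a \<ominus> b) N"
  shows "vge R v (a [^] (n::nat) \<ominus> b [^] n) N"
proof (induction n)
  case 0
  show ?case by (simp add: minus_eq r_neg)
next
  case (Suc n)
  have c: "a \<in> carrier R" "b \<in> carrier R" using assms valuation_ring_carrier by auto
  have g: "A \<otimes> a \<ominus> B \<otimes> b = A \<otimes> (a \<ominus> b) \<oplus> (A \<ominus> B) \<otimes> b"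
    if "A \<in> carrier R" "B \<in> carrier R" for A B
    using that c by algebra
  have "vge R v (a [^] n \<otimes> (a \<ominus> b)) (0 + N)"
    by (rule vge_mult) (use assms c valuation_ring_pow[of a n] in \<open>auto simp: valuation_ring_def\<close>)
  moreover have "vge R v ((a [^] n \<ominus> b [^] n) \<otimes> b) (N + 0)"
    by (rule vge_mult) (use assms c Suc in \<open>auto simp: valuation_ring_def\<close>)
  ultimately show ?case using g[of "a [^] n" "b [^] n"] vge_add c by simp
qed

section \<open>Roots of principal units\<close>

lemma vge_add_pow:
  assumes "x \<in> carrier R" "vge R v x j" shows "vge R v (add_pow R (n::nat) x) j"
  by (induction n) (use assms in \<open>auto intro: vge_add\<close>)

text \<open>The binomial expansion to first order: what is neglected is quadratic in \<delta>. Both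
  existence and uniqueness of roots of principal units rest on this estimate.\<close>

lemma vge_one_plus_pow:
  assumes \<delta>: "\<delta> \<in> carrier R" "vge R v \<delta> j" and j: "j \<ge> 0"
  shows "vge R v ((\<one> \<oplus> \<delta>) [^] (n::nat) \<ominus> (\<one> \<oplus> add_pow R n \<delta>)) (2 * j)"
proof (induction n)
  case 0
  show ?case by (simp add: minus_eq r_neg)
next
  case (Suc n)
  let ?a = "(\<one> \<oplus> \<delta>) [^] n" and ?b = "add_pow R n \<delta>"
  have c: "?a \<in> carrier R" "?b \<in> carrier R" using \<delta> by auto
  have "vge R v (\<one> \<oplus> \<delta>) 0"
    using vge_add[of \<one> \<delta> 0] vge_mono[OF \<delta>(2) j] \<delta>(1) by (simp add: vge_def v_one)
  then have "vge R v ((?a \<ominus> (\<one> \<oplus> ?b)) \<otimes> (\<one> \<oplus> \<delta>)) (2 * j + 0)"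
    using c \<delta> Suc by (intro vge_mult) auto
  moreover have "vge R v (?b \<otimes> \<delta>) (j + j)"
    by (rule vge_mult) (use c \<delta> vge_add_pow in auto)
  moreover have "A \<otimes> (\<one> \<oplus> \<delta>) \<ominus> (\<one> \<oplus> (B \<oplus> \<delta>)) = (A \<ominus> (\<one> \<oplus> B)) \<otimes> (\<one> \<oplus> \<delta>) \<oplus> B \<otimes> \<delta>"
    if "A \<in> carrier R" "B \<in> carrier R" for A B
    using that \<delta>(1) by (algebra; simp add: a_ac)
  ultimately show ?case using c \<delta> vge_add by simp
qed

lemma mm_iff: "x \<in> \<mm> \<longleftrightarrow> x \<in> carrier R \<and> vge R v x 1"
  by (simp add: valuation_ideal_def)

lemma one_unit:
  assumes "x \<in> carrier R" "vge R v (x \<ominus> \<one>) 1"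
  shows "x \<in> carrier R - {\<zero>}" "v x = 0" "x \<in> valuation_ring R v" "x \<notin> \<mm>"
proof -
  have x: "x = \<one> \<oplus> (x \<ominus> \<one>)" using assms(1) by algebra
  have "vge R v (\<one> \<oplus> (x \<ominus> \<one>)) 0"
    by (rule vge_add) (use assms vge_mono[OF assms(2), of 0] in \<open>auto simp: vge_def v_one\<close>)
  then show 1: "x \<in> valuation_ring R v" using x assms by (simp add: valuation_ring_def)
  show 2: "x \<notin> \<mm>"
  proof
    assume "x \<in> \<mm>"
    then have "vge R v (x \<ominus> (x \<ominus> \<one>)) 1" using assms by (auto simp: mm_iff intro!: vge_diff)
    moreover have "x \<ominus> (x \<ominus> \<one>) = \<one>" using assms(1) by algebra
    ultimately show False using one_notin_mm by (simp add: mm_iff)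
  qed
  show "x \<in> carrier R - {\<zero>}" "v x = 0" using valuation_ring_unit[OF 1 2] by auto
qed

text \<open>The linearised equation 1 + n\<delta> = x is solved by \<delta> = (x - 1)/n, as n is a
  unit. The error has valuation at least 2j, and j \<ge> 1 makes this at least j + 1.\<close>

lemma hensel_step:
  assumes n: "add_pow R (n::nat) \<one> \<notin> \<mm>" and x: "x \<in> carrier R" "vge R v (x \<ominus> \<one>) j" and j: "j \<ge> 1"
  shows "\<exists>w\<in>carrier R. vge R v (w \<ominus> \<one>) j \<and> vge R v (x \<ominus> w [^] n) (j + 1)"
proof -
  let ?n = "add_pow R n \<one>"
  note u = valuation_ring_unit[OF add_pow_valuation_ring n]
  define \<delta> where "\<delta> = inv ?n \<otimes> (x \<ominus> \<one>)"
  have c: "inv ?n \<in> carrier R" "\<delta> \<in> carrier R" using u x by (auto simp: valuation_ring_carrier \<delta>_def)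
  have \<delta>: "vge R v \<delta> (0 + j)" unfolding \<delta>_def
    by (rule vge_mult) (use u x c in \<open>auto simp: valuation_ring_def\<close>)
  have "add_pow R n \<delta> = ?n \<otimes> \<delta>" using c add_pow_ldistr[of \<one> \<delta> n] by simp
  also have "\<dots> = x \<ominus> \<one>" using u(5) c x by (simp add: \<delta>_def flip: m_assoc)
  finally have "\<one> \<oplus> add_pow R n \<delta> = \<one> \<oplus> (x \<ominus> \<one>)" by simp
  also have "\<dots> = x" using x(1) by algebra
  finally have "vge R v ((\<one> \<oplus> \<delta>) [^] n \<ominus> x) (2 * j)"
    using vge_one_plus_pow[of \<delta> j n] c \<delta> j by simp
  then have "vge R v (x \<ominus> (\<one> \<oplus> \<delta>) [^] n) (j + 1)"
    using c x j vge_mono[of _ "2 * j" "j + 1"] vge_diff_commute[of _ x "j + 1"] by simp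
  moreover have "(\<one> \<oplus> \<delta>) \<ominus> \<one> = \<delta>" using c(2) by algebra
  ultimately show ?thesis using c \<delta> by (intro bexI[of _ "\<one> \<oplus> \<delta>"]) auto
qed

lemma one_unit_root:
  assumes n: "add_pow R (n::nat) \<one> \<notin> \<mm>" and x: "x \<in> carrier R" "vge R v (x \<ominus> \<one>) 1"
  shows "\<exists>w\<in>carrier R. vge R v (w \<ominus> \<one>) 1 \<and> w [^] n = x"
proof -
  \<comment> \<open>The approximation of index j is correct to order j + 1, so that 1 can serve as
    index 0; \<open>?Q\<close> makes the sequence Cauchy.\<close>
  let ?P = "\<lambda>(j::nat) W. W \<in> carrier R \<and> vge R v (W \<ominus> \<one>) 1 \<and> vge R v (x \<ominus> W [^] n) (int j + 1)"
  let ?Q = "\<lambda>(j::nat) W W'. vge R v (W' \<ominus> W) (int j + 1)"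
  have "\<exists>f. \<forall>j. ?P j (f j) \<and> ?Q j (f j) (f (Suc j))"
  proof (rule dependent_nat_choice[of ?P ?Q])
    show "\<exists>W. ?P 0 W"
      by (rule exI[of _ \<one>]) (use x in \<open>auto simp: minus_eq r_neg\<close>)
  next
    fix W j assume W: "?P j W"
    note W1 = one_unit[of W]
    have Wn: "W [^] n \<in> carrier R - {\<zero>}" "v (W [^] n) = 0" using W1 W nz_pow v_pow by auto
    \<comment> \<open>The quotient of x by W^n is close to 1 to the order reached so far, so
      \<open>hensel_step\<close> applies to it, and the correction w enters as a factor of
      W.\<close>
    define y where "y = inv (W [^] n) \<otimes> x"
    have yc: "y \<in> carrier R" using nz_inv[OF Wn(1)] x by (auto simp: y_def)
    have Wy: "W [^] n \<otimes> y = x" using nz_inv[OF Wn(1)] x Wn by (auto simp: y_def simp flip: m_assoc)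
    have "y \<ominus> \<one> = inv (W [^] n) \<otimes> (x \<ominus> W [^] n)"
      using nz_inv[OF Wn(1)] Wn x by (simp add: y_def minus_eq r_distr r_minus)
    moreover have "vge R v (inv (W [^] n) \<otimes> (x \<ominus> W [^] n)) (0 + (int j + 1))"
      by (rule vge_mult) (use W x Wn nz_inv[OF Wn(1)] v_inv[OF Wn(1)] in \<open>auto simp: vge_def\<close>)
    ultimately have "vge R v (y \<ominus> \<one>) (int j + 1)" by simp
    then obtain w where w: "w \<in> carrier R" "vge R v (w \<ominus> \<one>) (int j + 1)" "vge R v (y \<ominus> w [^] n) (int j + 1 + 1)"
      using hensel_step[OF n yc, of "int j + 1"] by auto
    have "x \<ominus> (W \<otimes> w) [^] n = W [^] n \<otimes> (y \<ominus> w [^] n)"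
      using W w yc Wy Wn by (simp add: nat_pow_distrib minus_eq r_distr r_minus)
    moreover have "vge R v (W [^] n \<otimes> (y \<ominus> w [^] n)) (0 + (int j + 2))"
      by (rule vge_mult) (use W w yc Wn in \<open>auto simp: vge_def\<close>)
    ultimately have A: "vge R v (x \<ominus> (W \<otimes> w) [^] n) (int (Suc j) + 1)" by (simp add: algebra_simps)
    have "W \<otimes> w \<ominus> W = W \<otimes> (w \<ominus> \<one>)" using W w by (simp add: minus_eq r_distr r_minus)
    moreover have "vge R v (W \<otimes> (w \<ominus> \<one>)) (0 + (int j + 1))"
      by (rule vge_mult) (use W w W1 in \<open>auto simp: vge_def\<close>)
    ultimately have B: "vge R v (W \<otimes> w \<ominus> W) (int j + 1)" by simp
    have "vge R v (W \<otimes> w \<ominus> \<one>) 1"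
      by (rule vge_diff_trans[of _ W]) (use W w vge_mono[OF B, of 1] in auto)
    then show "\<exists>W'. ?P (Suc j) W' \<and> ?Q j W W'" using A B W w by auto
  qed
  then obtain f where f: "\<And>j. f j \<in> carrier R" "\<And>j. vge R v (f j \<ominus> \<one>) 1"
      "\<And>j. vge R v (x \<ominus> f j [^] n) (int j + 1)" "\<And>j. vge R v (f (Suc j) \<ominus> f j) (int j + 1)"
    by blast
  have mono: "vge R v (f (j + i) \<ominus> f j) (int j + 1)" for i j
  proof (induction i)
    case 0
    show ?case using f(1) by (simp add: minus_eq r_neg)
  next
    case (Suc i)
    show ?case using vge_diff_trans[OF f(1) f(1) f(1) _ Suc.IH, of "j + Suc i"] vge_mono[OF f(4)[of "j + i"]] by simp
  qed
  have mono': "vge R v (f m \<ominus> f j) (int j + 1)" if "m \<ge> j" for m j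
    using mono[of j "m - j"] that by simp
  have "valuation_Cauchy R v f"
    unfolding valuation_Cauchy_def
  proof (intro allI)
    fix N
    have "vge R v (f m \<ominus> f j) N" if "m \<ge> nat N" "j \<ge> nat N" for m j
      using vge_diff_trans[OF f(1) f(1) f(1) vge_mono[OF mono'[OF that(1)], of N]
          vge_diff_commute[OF f(1) f(1) vge_mono[OF mono'[OF that(2)], of N]]] by simp
    then show "\<exists>n0. \<forall>m\<ge>n0. \<forall>n\<ge>n0. vge R v (f m \<ominus> f n) N" by blast
  qed
  then obtain l where l: "l \<in> carrier R" and lim: "valuation_tendsto R v f l"
    using complete[of f] f(1) by auto
  have lim': "\<exists>j\<ge>n0. vge R v (f j \<ominus> l) N" for N and n0 :: nat
    using lim unfolding valuation_tendsto_def by (meson nat_le_linear order_refl)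
  obtain j1 where "vge R v (f j1 \<ominus> l) 1" using lim' by blast
  then have l1: "vge R v (l \<ominus> \<one>) 1"
    using vge_diff_trans[OF l f(1)[of j1] one_closed] vge_diff_commute[OF f(1) l] f(2) by blast
  have "vge R v (x \<ominus> l [^] n) N" for N
  proof -
    obtain j where j: "j \<ge> nat N" "vge R v (f j \<ominus> l) N" using lim' by blast
    have "vge R v (f j [^] n \<ominus> l [^] n) N"
      by (rule vge_pow_diff) (use j one_unit f l l1 in auto)
    moreover have "vge R v (x \<ominus> f j [^] n) N" using vge_mono[OF f(3)[of j], of N] j by simp
    ultimately show ?thesis using vge_diff_trans[of x "f j [^] n" "l [^] n" N] x l f by simp
  qed
  then have "x \<ominus> l [^] n = \<zero>" using vge_all_imp_zero by blast
  then show ?thesis using x l l1 by auto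
qed

text \<open>If w = 1 + \<delta> with \<delta> nonzero, the first-order estimate bounds v(n\<delta>)
  = v(\<delta>) below by 2v(\<delta>), which is impossible for v(\<delta>) \<ge> 1.\<close>

lemma one_unit_root_unique:
  assumes n: "add_pow R (n::nat) \<one> \<notin> \<mm>" and w: "w \<in> carrier R" "vge R v (w \<ominus> \<one>) 1" "w [^] n = \<one>"
  shows "w = \<one>"
proof (rule ccontr)
  assume "w \<noteq> \<one>"
  let ?n = "add_pow R n \<one>"
  define \<delta> where "\<delta> = w \<ominus> \<one>"
  have \<delta>: "\<delta> \<in> carrier R - {\<zero>}" using w \<open>w \<noteq> \<one>\<close> by (auto simp: \<delta>_def)
  have w\<delta>: "w = \<one> \<oplus> \<delta>" using w(1) unfolding \<delta>_def by algebra
  have v1: "v \<delta> \<ge> 1" using w \<delta> by (auto simp: \<delta>_def vge_def)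
  have "vge R v (\<one> \<ominus> (\<one> \<oplus> add_pow R n \<delta>)) (2 * v \<delta>)"
    using vge_one_plus_pow[of \<delta> "v \<delta>" n] v1 w w\<delta> \<delta> by (auto simp: vge_def)
  moreover have "\<one> \<ominus> (\<one> \<oplus> A) = \<ominus> A" if "A \<in> carrier R" for A
    using that by algebra
  ultimately have "vge R v (\<ominus> (add_pow R n \<delta>)) (2 * v \<delta>)" using \<delta> by simp
  then have "vge R v (add_pow R n \<delta>) (2 * v \<delta>)"
    using \<delta> vge_minus[of "\<ominus> (add_pow R n \<delta>)"] by simp
  moreover have "add_pow R n \<delta> = ?n \<otimes> \<delta>" using \<delta> add_pow_ldistr[of \<one> \<delta> n] by simp
  moreover note u = valuation_ring_unit[OF add_pow_valuation_ring n]
  ultimately show False using v_mult[OF u(1) \<delta>] u \<delta> v1 by (auto simp: vge_def integral_iff)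
qed

text \<open>Modulo p the number q - 1 is -1. Thus principal units are uniquely divisible by q - 1 as
  well, which is what Teichmueller lifts require.\<close>

lemma q_minus_1_unit: "add_pow R (q - 1) \<one> \<notin> \<mm>"
proof
  assume "add_pow R (q - 1) \<one> \<in> \<mm>"
  then have "ring_char \<kk> dvd q - 1" using add_pow_one_mem_mm by simp
  moreover have "ring_char \<kk> dvd q" using q_prime_power by auto
  ultimately have "ring_char \<kk> dvd 1" using q_gt_1 by (metis diff_diff_cancel dvd_diff_nat less_imp_le)
  then show False using residue_char_prime by simp
qed

lemma div_in_one_units:
  assumes "x \<in> carrier R - {\<zero>}" "v x = 0" "y \<in> carrier R - {\<zero>}" "v y = 0" "x \<ominus> y \<in> \<mm>"
  shows "x \<otimes> inv y \<in> carrier R" "vge R v (x \<otimes> inv y \<ominus> \<one>) 1"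
proof -
  note iy = nz_inv[OF assms(3)]
  show "x \<otimes> inv y \<in> carrier R" using iy assms by simp
  have "x \<otimes> inv y \<ominus> \<one> = (x \<ominus> y) \<otimes> inv y"
    using iy assms by (simp add: minus_eq l_distr l_minus)
  moreover have "vge R v ((x \<ominus> y) \<otimes> inv y) (1 + 0)"
    by (rule vge_mult) (use assms iy v_inv[OF assms(3)] in \<open>auto simp: mm_iff vge_def\<close>)
  ultimately show "vge R v (x \<otimes> inv y \<ominus> \<one>) 1" by simp
qed

text \<open>For any lift c, c^(q-1) is a principal unit, hence w^(q-1) for a principal unit w, and
  c/w is the lift sought. Two such lifts have as quotient a principal unit that is a (q-1)-th root
  of 1, hence 1.\<close>

lemma teichmuller_lift:
  assumes a: "a \<in> carrier \<kk> - {\<zero>\<^bsub>\<kk>\<^esub>}"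
  shows "teichmuller R v a \<in> valuation_ring R v" "res (teichmuller R v a) = a"
proof -
  obtain c where c: "c \<in> valuation_ring R v" "a = res c" using a by (auto simp: carrier_kk)
  have memb: "x \<in> carrier R - {\<zero>} \<and> v x = 0" if "x \<in> a" for x
    using that c mem_res_iff[OF c(1), of x] a valuation_ring_unit[of x] res_eq_zero_iff by auto
  have cu: "c \<in> carrier R - {\<zero>}" "v c = 0" using memb[of c] mem_res_iff[OF c(1), of c] c by auto
  have q: "Suc (q - 1) = q" using q_gt_1 by simp
  let ?T = "\<lambda>x. x \<in> a \<and> x [^] q = x"
  have "\<exists>x. ?T x"
  proof -
    obtain w where w: "w \<in> carrier R" "vge R v (w \<ominus> \<one>) 1" "w [^] (q - 1) = c [^] (q - 1)"
      using one_unit_root[OF q_minus_1_unit, of "c [^] (q - 1)"] unit_pow_q_minus_1[OF cu] cu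
      by (auto simp: mm_iff)
    note wu = one_unit[OF w(1,2)]
    note iw = nz_inv[OF wu(1)]
    let ?x = "c \<otimes> inv w"
    have x: "?x \<in> valuation_ring R v"
      using valuation_ring_unit(3)[OF wu(3,4)] c OO.m_closed[of c "inv w"] by auto
    have "?x [^] (q - 1) = w [^] (q - 1) \<otimes> inv w [^] (q - 1)"
      using w cu iw by (simp add: nat_pow_distrib)
    also have "\<dots> = \<one>" using iw w nat_pow_distrib[of w "inv w" "q - 1"] by simp
    finally have "?x [^] Suc (q - 1) = ?x" using iw cu by simp
    then have xq: "?x [^] q = ?x" using q by simp
    have "c \<ominus> ?x = ?x \<otimes> (w \<ominus> \<one>)"
      using w cu iw by (simp add: minus_eq r_distr r_minus m_assoc)
    moreover have "vge R v (?x \<otimes> (w \<ominus> \<one>)) (0 + 1)"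
      by (rule vge_mult) (use x w iw cu in \<open>auto simp: valuation_ring_def\<close>)
    ultimately have "c \<ominus> ?x \<in> \<mm>" using cu iw w by (simp add: mm_iff)
    then have "res ?x = a" using res_eq_iff[OF c(1) x] c by simp
    then have "?x \<in> a" using mem_res_iff[OF c(1), of ?x] x c by simp
    then show ?thesis using xq by blast
  qed
  moreover have "x = y" if x: "?T x" and y: "?T y" for x y
  proof -
    have xu: "x \<in> carrier R - {\<zero>}" "v x = 0" and yu: "y \<in> carrier R - {\<zero>}" "v y = 0"
      using memb x y by auto
    have "res x = res y" "x \<in> valuation_ring R v" "y \<in> valuation_ring R v"
      using x y c mem_res_iff[OF c(1)] by auto
    then have "x \<ominus> y \<in> \<mm>" using res_eq_iff by simp
    note t = div_in_one_units[OF xu yu this]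
    have cancel: "z [^] (q - 1) = \<one>" if z: "z \<in> carrier R - {\<zero>}" "z [^] q = z" for z
    proof -
      have "z [^] (q - 1) \<otimes> z = \<one> \<otimes> z" using z q by (metis DiffD1 l_one nat_pow_Suc)
      then show ?thesis using z m_rcancel[of z "z [^] (q - 1)" \<one>] by simp
    qed
    note iy = nz_inv[OF yu(1)]
    have "(x \<otimes> inv y) [^] (q - 1) = x [^] (q - 1) \<otimes> inv y [^] (q - 1)"
      using xu iy by (simp add: nat_pow_distrib)
    also have "\<dots> = y [^] (q - 1) \<otimes> inv y [^] (q - 1)"
      using cancel[of x] cancel[of y] x y xu yu by simp
    also have "\<dots> = \<one>" using nat_pow_distrib[of y "inv y" "q - 1"] yu iy by simp
    finally have "x \<otimes> inv y = \<one>" using one_unit_root_unique[OF q_minus_1_unit t] iy by simp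
    then have "x \<otimes> inv y \<otimes> y = y" using yu by simp
    then show "x = y" using iy xu yu by (simp add: m_assoc)
  qed
  ultimately have "?T (teichmuller R v a)"
    unfolding teichmuller_def by (intro theI'[of ?T]) blast
  then show "teichmuller R v a \<in> valuation_ring R v" "res (teichmuller R v a) = a"
    using mem_res_iff[OF c(1)] c by auto
qed

section \<open>Unit classes modulo e-th powers\<close>

lemma unit_powers_subgroup: "subgroup (unit_powers R e) (Multiplicative_Group.mult_of R)"
proof -
  interpret G: group "Multiplicative_Group.mult_of R" by (rule field_mult_group)
  show ?thesis
  proof (rule G.subgroupI)
    fix a assume "a \<in> unit_powers R e"
    then obtain x where x: "x \<in> carrier (Multiplicative_Group.mult_of R)" "a = x [^] e"
      by (auto simp: unit_powers_def)
    then have "inv\<^bsub>Multiplicative_Group.mult_of R\<^esub> a = (inv\<^bsub>Multiplicative_Group.mult_of R\<^esub> x) [^] e"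
      using G.nat_pow_inv[of x e] by (simp add: Multiplicative_Group.nat_pow_mult_of)
    then show "inv\<^bsub>Multiplicative_Group.mult_of R\<^esub> a \<in> unit_powers R e"
      using G.inv_closed[OF x(1)] by (auto simp: unit_powers_def)
  next
    fix a b assume "a \<in> unit_powers R e" "b \<in> unit_powers R e"
    then obtain x y where "x \<in> carrier R - {\<zero>}" "a = x [^] e" "y \<in> carrier R - {\<zero>}" "b = y [^] e"
      by (auto simp: unit_powers_def)
    then have "a \<otimes> b = (x \<otimes> y) [^] e" "x \<otimes> y \<in> carrier R - {\<zero>}"
      by (auto simp: nat_pow_distrib integral_iff)
    then show "a \<otimes>\<^bsub>Multiplicative_Group.mult_of R\<^esub> b \<in> unit_powers R e"
      by (auto simp: unit_powers_def)
  qed (use nz_pow in \<open>auto simp: unit_powers_def\<close>)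
qed

text \<open>A unit and the Teichmueller lift of its residue differ by a principal unit, which is an
  e-th power. Afterwards only the condition v x = 0 has to be handled.\<close>

lemma residue_unit_classes_eq:
  assumes e: "add_pow R e \<one> \<notin> \<mm>"
  shows "residue_unit_classes R v e =
    (\<lambda>x. unit_powers R e #>\<^bsub>Multiplicative_Group.mult_of R\<^esub> x) ` {x \<in> carrier R - {\<zero>}. v x = 0}"
    (is "_ = ?c ` ?U")
proof
  show "residue_unit_classes R v e \<subseteq> ?c ` ?U"
    unfolding residue_unit_classes_def
  proof (rule image_subsetI)
    fix a assume "a \<in> carrier (Multiplicative_Group.mult_of \<kk>)"
    then have a: "a \<in> carrier \<kk> - {\<zero>\<^bsub>\<kk>\<^esub>}" by simp
    show "?c (teichmuller R v a) \<in> ?c ` ?U"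
      using teichmuller_lift[OF a] a valuation_ring_unit[of "teichmuller R v a"]
        res_eq_zero_iff[of "teichmuller R v a"] by auto
  qed
  show "?c ` ?U \<subseteq> residue_unit_classes R v e"
  proof (rule image_subsetI)
    fix x assume "x \<in> ?U"
    then have x: "x \<in> carrier R - {\<zero>}" "v x = 0" by auto
    then have xO: "x \<in> valuation_ring R v" "x \<notin> \<mm>" using valuation_ring_unit_iff by auto
    define t where "t = teichmuller R v (res x)"
    have a: "res x \<in> carrier \<kk> - {\<zero>\<^bsub>\<kk>\<^esub>}" using xO res_eq_zero_iff by (auto simp: carrier_kk)
    note tl = teichmuller_lift[OF a, folded t_def]
    have t: "t \<in> carrier R - {\<zero>}" "v t = 0"
      using tl a valuation_ring_unit[of t] res_eq_zero_iff[of t] by auto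
    have "x \<ominus> t \<in> \<mm>" using res_eq_iff[OF xO(1) tl(1)] tl by simp
    note d = div_in_one_units[OF x t this]
    obtain w where w: "w \<in> carrier R" "vge R v (w \<ominus> \<one>) 1" "w [^] e = x \<otimes> inv t"
      using one_unit_root[OF e d] by auto
    have "x = w [^] e \<otimes> t" using w x t nz_inv[OF t(1)] by (simp add: m_assoc)
    then have "x \<in> ?c t" using one_unit(1)[OF w(1,2)]
      by (auto simp: r_coset_def unit_powers_def)
    then have "?c t = ?c x"
      using group.repr_independence[OF field_mult_group _ _ unit_powers_subgroup, of x e t] t by simp
    then show "?c x \<in> residue_unit_classes R v e"
      unfolding residue_unit_classes_def t_def using a by (intro image_eqI[of _ _ "res x"]) auto
  qed
qed
end

section \<open>Integral elements\<close>

context ring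
begin

lemma Span_Cons_iff:
  "x \<in> Span S (u # us) \<longleftrightarrow> (\<exists>c\<in>S. \<exists>y\<in>Span S us. x = c \<otimes> u \<oplus> y)"
  using line_extension_mem_iff by simp

lemma Span_least:
  assumes "\<zero> \<in> N" "\<And>x y. \<lbrakk>x \<in> N; y \<in> N\<rbrakk> \<Longrightarrow> x \<oplus> y \<in> N"
    and "\<And>c u. \<lbrakk>c \<in> S; u \<in> set us\<rbrakk> \<Longrightarrow> c \<otimes> u \<in> N"
  shows "Span S us \<subseteq> N"
  using assms(3)
proof (induction us)
  case Nil
  then show ?case using assms(1) by simp
next
  case (Cons u us)
  show ?case
  proof
    fix x assume "x \<in> Span S (u # us)"
    then obtain c y where "c \<in> S" "y \<in> Span S us" "x = c \<otimes> u \<oplus> y"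
      unfolding Span_Cons_iff by blast
    moreover have "Span S us \<subseteq> N" using Cons by simp
    ultimately show "x \<in> N" using assms(2)[of "c \<otimes> u" y] Cons.prems[of c u] by auto
  qed
qed

text \<open>Scalars range over a subring, not a subfield: \<open>S\<close> will be the valuation
  ring or \<open>A0\<close>, and \<open>Span S us\<close> the module generated by the list.\<close>

lemma Span_submodule:
  assumes S: "subring S R" and us: "set us \<subseteq> carrier R"
  shows "Span S us \<subseteq> carrier R" "\<zero> \<in> Span S us"
    and "\<lbrakk>x \<in> Span S us; y \<in> Span S us\<rbrakk> \<Longrightarrow> x \<oplus> y \<in> Span S us"
    and "\<lbrakk>c \<in> S; x \<in> Span S us\<rbrakk> \<Longrightarrow> c \<otimes> x \<in> Span S us"
proof -
  note Sc = subsetD[OF subringE(1)[OF S]]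
  have zero: "\<zero> \<in> Span S us" if "set us \<subseteq> carrier R" for us
    using that
  proof (induction us)
    case (Cons u us)
    then show ?case unfolding Span_Cons_iff
      using subringE(2)[OF S] by (intro bexI[of _ \<zero>]) auto
  qed simp
  have sub': "Span S us \<subseteq> carrier R" if "set us \<subseteq> carrier R" for us
    by (rule Span_least) (use that Sc in auto)
  show "Span S us \<subseteq> carrier R" "\<zero> \<in> Span S us" using zero sub' us by auto
  show "x \<oplus> y \<in> Span S us" if "x \<in> Span S us" "y \<in> Span S us"
    using us that
  proof (induction us arbitrary: x y)
    case (Cons u us)
    obtain c a d b where x: "c \<in> S" "a \<in> Span S us" "x = c \<otimes> u \<oplus> a"
      and y: "d \<in> S" "b \<in> Span S us" "y = d \<otimes> u \<oplus> b"
      using Cons.prems(2,3) unfolding Span_Cons_iff by blast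
    have "a \<in> carrier R" "b \<in> carrier R" using x y sub'[of us] Cons.prems by auto
    then have "x \<oplus> y = (c \<oplus> d) \<otimes> u \<oplus> (a \<oplus> b)"
      using x y Sc Cons.prems by (simp add: l_distr a_ac)
    moreover have "a \<oplus> b \<in> Span S us" using Cons x y by auto
    ultimately show ?case unfolding Span_Cons_iff using subringE(7)[OF S] x y by blast
  qed simp
  show "c \<otimes> x \<in> Span S us" if "c \<in> S" "x \<in> Span S us"
    using us that
  proof (induction us arbitrary: x)
    case (Cons u us)
    obtain d a where x: "d \<in> S" "a \<in> Span S us" "x = d \<otimes> u \<oplus> a"
      using Cons.prems(3) unfolding Span_Cons_iff by blast
    have "a \<in> carrier R" using x sub'[of us] Cons.prems by auto
    then have "c \<otimes> x = (c \<otimes> d) \<otimes> u \<oplus> c \<otimes> a"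
      using x Sc Cons.prems by (simp add: r_distr m_assoc)
    moreover have "c \<otimes> a \<in> Span S us" using Cons x by auto
    ultimately show ?case unfolding Span_Cons_iff using subringE(6)[OF S] x Cons.prems by blast
  qed (use Sc in auto)
qed

lemma Span_base:
  assumes S: "subring S R" and us: "set us \<subseteq> carrier R" and u: "u \<in> set us"
  shows "u \<in> Span S us"
  using us u
proof (induction us)
  case (Cons w us)
  note Sc = subsetD[OF subringE(1)[OF S]]
  show ?case
  proof (cases "u = w")
    case True
    then show ?thesis unfolding Span_Cons_iff
      using Cons.prems subringE(3)[OF S] Span_submodule(2)[OF S, of us]
      by (intro bexI[of _ \<one>] bexI[of _ \<zero>]) auto
  next
    case False
    then show ?thesis unfolding Span_Cons_iff
      using Cons subringE(2)[OF S] Span_submodule(1)[OF S, of us]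
      by (intro bexI[of _ \<zero>] bexI[of _ u]) auto
  qed
qed simp

text \<open>Noetherianity in sequential form; the assumption \<open>dv\<close> on \<open>S\<close> is what is left of being a
  discrete valuation ring.\<close>

lemma Span_ascending_chain:
  fixes x :: "nat \<Rightarrow> 'a"
  assumes S: "subring S R"
    and dv: "\<And>a::nat \<Rightarrow> 'a. range a \<subseteq> S \<Longrightarrow> \<exists>m. \<forall>n. \<exists>r\<in>S. a n = r \<otimes> a m"
    and us: "set us \<subseteq> carrier R" and x: "\<And>n. x n \<in> Span S us"
  shows "\<exists>n. x n \<in> Span S (map x [0..<n])"
  using us x
proof (induction us arbitrary: x)
  case Nil
  then show ?case by (intro exI[of _ 0]) simp
next
  case (Cons u us)
  note Sc = subsetD[OF subringE(1)[OF S]]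
  have us: "set us \<subseteq> carrier R" and u: "u \<in> carrier R" using Cons.prems by auto
  have "\<forall>n. \<exists>c b. c \<in> S \<and> b \<in> Span S us \<and> x n = c \<otimes> u \<oplus> b"
    using Cons.prems(2) unfolding Span_Cons_iff by blast
  then obtain c b where c: "\<And>n. c n \<in> S" and b: "\<And>n. b n \<in> Span S us"
    and xn: "\<And>n. x n = c n \<otimes> u \<oplus> b n" by metis
  have cc: "c n \<in> carrier R" "b n \<in> carrier R" "x n \<in> carrier R" for n
    using c[of n] b[of n] Span_submodule(1)[OF S us] Sc xn[of n] u by auto
  \<comment> \<open>The coefficient \<open>c m\<close> divides all the others, so subtracting
    multiples of \<open>x m\<close> from the later terms removes \<open>u\<close> and leaves a
    sequence in the span of the shorter list.\<close>
  obtain m r where r: "\<And>n. r n \<in> S" "\<And>n. c n = r n \<otimes> c m"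
    using dv[of c] c by (metis image_subsetI)
  have rc: "r n \<in> carrier R" for n using r Sc by auto
  define x' where "x' i = x (Suc m + i) \<oplus> (\<ominus> r (Suc m + i)) \<otimes> x m" for i
  have "x' i = b (Suc m + i) \<oplus> (\<ominus> r (Suc m + i)) \<otimes> b m" for i
  proof -
    have "(rr \<otimes> cm \<otimes> u \<oplus> b1) \<oplus> (\<ominus> rr) \<otimes> (cm \<otimes> u \<oplus> b2) = b1 \<oplus> (\<ominus> rr) \<otimes> b2"
      if "rr \<in> carrier R" "cm \<in> carrier R" "b1 \<in> carrier R" "b2 \<in> carrier R" for rr cm b1 b2
      using that u by (simp add: r_distr l_minus m_assoc a_assoc)
        (metis (no_types, lifting) a_closed a_comm a_lcomm add.inv_closed m_closed r_neg1)
    then show ?thesis unfolding x'_def xn using r(2)[of "Suc m + i"] rc cc by metis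
  qed
  then have "x' i \<in> Span S us" for i
    using Span_submodule(3,4)[OF S us] b r(1) subringE(5)[OF S] by simp
  then obtain n where n: "x' n \<in> Span S (map x' [0..<n])" using Cons.IH[OF us] by blast
  let ?n = "Suc m + n"
  let ?N = "Span S (map x [0..<?n])"
  have xs: "set (map x [0..<?n]) \<subseteq> carrier R" using cc by auto
  note N = Span_submodule[OF S xs]
  have xN: "x i \<in> ?N" if "i < ?n" for i using that by (intro Span_base[OF S xs]) (auto simp del: upt_Suc)
  have "x' i \<in> ?N" if "i < n" for i
    unfolding x'_def using that xN N r(1) subringE(5)[OF S] by simp
  then have "Span S (map x' [0..<n]) \<subseteq> ?N"
    using N by (intro Span_least) auto
  then have "x' n \<oplus> r ?n \<otimes> x m \<in> ?N" using n N(3)[OF _ N(4)[OF r(1) xN]] by auto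
  moreover have "x' n \<oplus> r ?n \<otimes> x m = x ?n"
    using cc rc by (simp add: x'_def a_assoc l_minus l_neg)
  ultimately show ?case by metis
qed

lemma eval_combination:
  assumes "set p \<subseteq> carrier R" "set q \<subseteq> carrier R" "length p = length q" "a \<in> carrier R"
  shows "eval (map2 (\<oplus>) p q) a = eval p a \<oplus> eval q a"
  using assms(3,1,2)
proof (induction p q rule: list_induct2)
  case (Cons x xs y ys)
  then show ?case using assms(4)
    by (auto simp: l_distr a_ac eval_in_carrier)
qed simp

lemma eval_scale:
  assumes "set p \<subseteq> carrier R" "c \<in> carrier R" "a \<in> carrier R"
  shows "eval (map ((\<otimes>) c) p) a = c \<otimes> eval p a"
  using assms by (induction p) (auto simp: r_distr m_assoc eval_in_carrier)

text \<open>The chain of spans of 1, a, a^2, ... inside a finitely generated module becomes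
  stationary, so some power of a is a combination of the lower ones; that is a monic
  equation.\<close>

lemma integral_if_powers_in_Span:
  assumes S: "subring S R"
    and dv: "\<And>a::nat \<Rightarrow> 'a. range a \<subseteq> S \<Longrightarrow> \<exists>m. \<forall>n. \<exists>r\<in>S. a n = r \<otimes> a m"
    and us: "set us \<subseteq> carrier R" and a: "a \<in> carrier R" "\<And>n::nat. a [^] n \<in> Span S us"
  shows "\<exists>p. p \<noteq> [] \<and> set p \<subseteq> S \<and> hd p = \<one> \<and> eval p a = \<zero>"
proof -
  obtain n where n: "a [^] n \<in> Span S (map (\<lambda>i. a [^] i) [0..<n])"
    using Span_ascending_chain[OF S dv us, of "\<lambda>n. a [^] n"] a(2) by blast
  note Sc = subringE(1)[OF S]
  \<comment> \<open>Lists of fixed length with leading zeros allowed: unlike normalised polynomials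
    they are closed under entrywise sums.\<close>
  let ?N = "{eval p a | p. set p \<subseteq> S \<and> length p = n}"
  have scale: "c \<otimes> y \<in> ?N" if "c \<in> S" "y \<in> ?N" for c y
  proof -
    obtain p where "set p \<subseteq> S" "length p = n" "y = eval p a" using \<open>y \<in> ?N\<close> by blast
    moreover from this have "set p \<subseteq> carrier R" "c \<in> carrier R" using Sc that by auto
    ultimately show ?thesis using eval_scale[of p c a] that a subringE(6)[OF S]
      by (intro CollectI exI[of _ "map ((\<otimes>) c) p"]) auto
  qed
  have base: "a [^] i \<in> ?N" if "i < n" for i
  proof -
    have "set (monom \<one> i) \<subseteq> carrier R" by (auto simp: monom_def)
    then have "eval (replicate (n - Suc i) \<zero> @ monom \<one> i) a = a [^] i"
      using eval_replicate[of "monom \<one> i" a] eval_monom[of \<one> a i] a(1) by simp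
    then show ?thesis using that subringE(2,3)[OF S]
      by (intro CollectI exI[of _ "replicate (n - Suc i) \<zero> @ monom \<one> i"]) (auto simp: monom_def)
  qed
  have "Span S (map (\<lambda>i. a [^] i) [0..<n]) \<subseteq> ?N"
  proof (rule Span_least)
    have "eval (replicate n \<zero>) a = \<zero>" using eval_replicate[of "[]" a n] a by simp
    then show "\<zero> \<in> ?N" using subringE(2)[OF S]
      by (intro CollectI exI[of _ "replicate n \<zero>"]) auto
    fix x y assume "x \<in> ?N" "y \<in> ?N"
    then obtain p r where "set p \<subseteq> S" "length p = n" "x = eval p a" "set r \<subseteq> S" "length r = n" "y = eval r a"
      by blast
    moreover have "set (map2 (\<oplus>) p r) \<subseteq> S" if "set p \<subseteq> S" "set r \<subseteq> S"
    proof
      fix z assume "z \<in> set (map2 (\<oplus>) p r)"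
      then obtain s t where "(s, t) \<in> set (zip p r)" "z = s \<oplus> t" by auto
      then show "z \<in> S" using that subringE(7)[OF S] by (meson subsetD set_zip_leftD set_zip_rightD)
    qed
    ultimately show "x \<oplus> y \<in> ?N" using eval_combination[of p r a] Sc a
      by (intro CollectI exI[of _ "map2 (\<oplus>) p r"]) auto
  qed (use scale base in auto)
  \<comment> \<open>Once -a^n is the value of a list of length n, a leading 1 in front of that list
    gives the monic relation.\<close>
  then have "\<ominus> \<one> \<otimes> a [^] n \<in> ?N" using scale n subringE(3,5)[OF S] by blast
  then obtain p where p: "set p \<subseteq> S" "length p = n" "\<ominus> \<one> \<otimes> a [^] n = eval p a" by auto
  then have "eval (\<one> # p) a = a [^] n \<oplus> \<ominus> \<one> \<otimes> a [^] n" using a by simp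
  also have "\<dots> = \<zero>" using a by (simp add: l_minus r_neg)
  finally show ?thesis using p subringE(3)[OF S] by (intro exI[of _ "\<one> # p"]) auto
qed

end

context cring
begin

text \<open>Multiplying the monic equation of degree d by (t^m)^d turns the top term into (xt^m)^d,
  while every lower term keeps a factor t^m, and m > 0. It serves once for \<pi> over the valuation
  ring and once for \<omega> over \<open>A\<close>.\<close>

lemma integral_fraction:
  assumes A: "subring A R" and S: "S \<subseteq> A" and x: "x \<in> carrier R" and t: "t \<in> A"
    and xt: "x \<otimes> t [^] (m::nat) \<in> A" and m: "m > 0"
    and p: "p \<noteq> []" "set p \<subseteq> S" "hd p = \<one>" "eval p x = \<zero>"
  shows "\<exists>d::nat. \<exists>b\<in>A. (x \<otimes> t [^] m) [^] d = t \<otimes> b"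
proof -
  note Ac = subsetD[OF subringE(1)[OF A]]
  have tc: "t \<in> carrier R" using t Ac by auto
  have Apow: "a [^] (n::nat) \<in> A" if "a \<in> A" for a n
    by (induction n) (use that subringE(3,6)[OF A] in auto)
  \<comment> \<open>The degree of r is below its length, so each monomial leaves at least one factor
    t^m over after its own x is cleared.\<close>
  have *: "\<exists>b\<in>A. eval r x \<otimes> (t [^] m) [^] length r = t [^] m \<otimes> b" if "set r \<subseteq> S" for r
    using that
  proof (induction r)
    case Nil
    show ?case using tc subringE(2)[OF A] by (intro bexI[of _ \<zero>]) auto
  next
    case (Cons c r)
    then obtain b where b: "b \<in> A" "eval r x \<otimes> (t [^] m) [^] length r = t [^] m \<otimes> b" by auto
    let ?T = "t [^] m" and ?n = "length r"
    have c: "c \<in> A" "c \<in> carrier R" "set r \<subseteq> carrier R" using Cons.prems S Ac by auto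
    have cl: "?T \<in> carrier R" "?T [^] ?n \<in> carrier R" "x [^] ?n \<in> carrier R" "eval r x \<in> carrier R" "b \<in> carrier R"
      using tc x c b Ac eval_in_carrier by auto
    have "eval (c # r) x \<otimes> ?T [^] length (c # r) =
        c \<otimes> x [^] ?n \<otimes> (?T [^] ?n \<otimes> ?T) \<oplus> eval r x \<otimes> (?T [^] ?n \<otimes> ?T)"
      using cl c by (simp add: l_distr)
    also have "\<dots> = ?T \<otimes> (c \<otimes> (x [^] ?n \<otimes> ?T [^] ?n)) \<oplus> (eval r x \<otimes> ?T [^] ?n) \<otimes> ?T"
      using cl c by (simp add: m_ac)
    also have "x [^] ?n \<otimes> ?T [^] ?n = (x \<otimes> ?T) [^] ?n" using x tc by (simp add: nat_pow_distrib)
    also have "?T \<otimes> (c \<otimes> (x \<otimes> ?T) [^] ?n) \<oplus> (eval r x \<otimes> ?T [^] ?n) \<otimes> ?T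
        = ?T \<otimes> (c \<otimes> (x \<otimes> ?T) [^] ?n \<oplus> ?T \<otimes> b)"
      using cl c x b(2) by (simp add: r_distr m_comm)
    finally show ?case
      using subringE(6,7)[OF A] c(1) Apow[OF xt, of ?n] Apow[OF t, of m] b(1) by blast
  qed
  obtain r where r: "p = \<one> # r" using p by (cases p) auto
  obtain b where b: "b \<in> A" "eval r x \<otimes> (t [^] m) [^] length r = t [^] m \<otimes> b"
    using *[of r] p r by auto
  have cl: "eval r x \<in> carrier R" "x [^] length r \<in> carrier R" "(t [^] m) [^] length r \<in> carrier R" "b \<in> carrier R" "t [^] m \<in> carrier R"
    using p r S Ac x tc b by (auto intro!: eval_in_carrier)
  have "x [^] length r \<oplus> eval r x = \<zero>" using p(4) r cl by simp
  then have "x [^] length r = \<ominus> eval r x" using cl by (simp add: add.inv_equality minus_equality[symmetric])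
  then have "(x \<otimes> t [^] m) [^] length r = \<ominus> eval r x \<otimes> (t [^] m) [^] length r"
    using x tc by (simp add: nat_pow_distrib)
  also have "\<dots> = t [^] m \<otimes> (\<ominus> b)" using cl b by (simp add: l_minus r_minus)
  also have "\<dots> = t \<otimes> t [^] (m - 1) \<otimes> (\<ominus> b)" using m tc by (cases m) (auto simp: m_comm)
  finally have "(x \<otimes> t [^] m) [^] length r = t \<otimes> (t [^] (m - 1) \<otimes> (\<ominus> b))"
    using tc cl by (simp add: m_assoc)
  then show ?thesis using subringE(5,6)[OF A] Apow[OF t] b by blast
qed

end

text \<open>Because t^e lies in \<open>A\<close>, the powers of t below e span A[t] over
  \<open>A\<close>; their products with the generators of \<open>A\<close> span it over
  \<open>S\<close>.\<close>

lemma (in cring) simple_extension_subset_Span: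
  assumes A: "subring A R" and S: "subring S R" and us: "set us \<subseteq> carrier R" "A \<subseteq> Span S us"
    and t: "t \<in> carrier R" "t [^] (e::nat) \<in> A" and e: "e > 0"
  shows "\<exists>us'. set us' \<subseteq> carrier R \<and> simple_extension A t \<subseteq> Span S us'"
proof -
  define ts where "ts = map (\<lambda>j. t [^] j) [0..<e]"
  define us' where "us' = concat (map (\<lambda>s. map (\<lambda>g. g \<otimes> s) us) ts)"
  have ts: "set ts \<subseteq> carrier R" using t by (auto simp: ts_def)
  have us': "set us' \<subseteq> carrier R" using ts us by (auto simp: us'_def)
  note M = Span_submodule[OF A ts] and N = Span_submodule[OF S us']
  note Ac = subsetD[OF subringE(1)[OF A]]
  \<comment> \<open>The case j = e is included because multiplication by t takes the last generator
    t^(e-1) there.\<close>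
  have pow: "t [^] j \<in> Span A ts" if "j \<le> e" for j
  proof (cases "j = e")
    case True
    have "\<one> \<in> Span A ts"
      using e by (intro Span_base[OF A ts]) (force simp: ts_def)
    then show ?thesis using M(4)[OF t(2), of \<one>] t True by simp
  next
    case False
    then show ?thesis using that by (intro Span_base[OF A ts]) (auto simp: ts_def)
  qed
  have "Span A ts \<subseteq> {x \<in> carrier R. x \<otimes> t \<in> Span A ts}"
  proof (rule Span_least)
    fix c u assume c: "c \<in> A" "u \<in> set ts"
    then obtain j where j: "j < e" "u = t [^] j" by (auto simp: ts_def)
    have "c \<otimes> u \<otimes> t = c \<otimes> t [^] Suc j" using c j t Ac by (simp add: m_assoc)
    then show "c \<otimes> u \<in> {x \<in> carrier R. x \<otimes> t \<in> Span A ts}"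
      using M(4)[OF c(1) pow[of "Suc j"]] j c t Ac by auto
  qed (use M t in \<open>auto simp: l_distr\<close>)
  then have tM: "x \<otimes> t \<in> Span A ts" if "x \<in> Span A ts" for x using that by auto
  have "simple_extension A t \<subseteq> Span A ts"
  proof
    fix x assume "x \<in> simple_extension A t"
    then show "x \<in> Span A ts"
    proof (induction rule: simple_extension.induct)
      case (lin k1 k2)
      then show ?case using M(3)[OF tM M(4)[OF lin(2) pow[of 0]]] Ac by simp
    qed (rule M)
  qed
  moreover have "Span A ts \<subseteq> Span S us'"
  proof (rule Span_least)
    fix c s assume c: "c \<in> A" "s \<in> set ts"
    have sc: "s \<in> carrier R" using c ts by auto
    have "Span S us \<subseteq> {y \<in> carrier R. y \<otimes> s \<in> Span S us'}"
    proof (rule Span_least)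
      fix d g assume d: "d \<in> S" "g \<in> set us"
      have "g \<otimes> s \<in> Span S us'"
        using d c by (intro Span_base[OF S us']) (auto simp: us'_def)
      moreover have "d \<in> carrier R" "g \<in> carrier R" using d us subringE(1)[OF S] by auto
      ultimately show "d \<otimes> g \<in> {y \<in> carrier R. y \<otimes> s \<in> Span S us'}"
        using N(4)[OF d(1)] sc by (simp add: m_assoc)
    qed (use N sc in \<open>auto simp: l_distr\<close>)
    then show "c \<otimes> s \<in> Span S us'" using us c by auto
  qed (use N in auto)
  ultimately show ?thesis using us' by blast
qed

section \<open>Radical extensions of the residue field\<close>

lemma (in cring) binomial_theorem:
  assumes ab: "a \<in> carrier R" "b \<in> carrier R"
  shows "(a \<oplus> b) [^] (n::nat) = (\<Oplus>i\<in>{..n}. add_pow R (n choose i) (a [^] i \<otimes> b [^] (n - i)))"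
proof (induction n)
  case 0
  show ?case using ab by simp
next
  case (Suc n)
  \<comment> \<open>Multiplying the expansion for n by a gives the terms \<open>g\<close>, by b the
    terms \<open>h\<close>; Pascal's rule combines them, with a shift of index, into
    \<open>f\<close>.\<close>
  define h where "h i = add_pow R (n choose i) (a [^] i \<otimes> b [^] (Suc n - i))" for i
  define g where "g i = add_pow R (n choose i) (a [^] Suc i \<otimes> b [^] (n - i))" for i
  define f where "f i = add_pow R (Suc n choose i) (a [^] i \<otimes> b [^] (Suc n - i))" for i
  have cl: "h i \<in> carrier R" "g i \<in> carrier R" "f i \<in> carrier R" for i
    using ab by (auto simp: h_def g_def f_def)
  have f_Suc: "f (Suc i) = g i \<oplus> h (Suc i)" for i
    using ab by (simp add: f_def g_def h_def add.nat_pow_mult)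
  have f_0: "f 0 = h 0" using ab by (simp add: f_def h_def)
  have h_top: "h (Suc n) = \<zero>" using ab by (simp add: h_def binomial_eq_0)
  have "(\<Oplus>i\<in>{..Suc n}. f i) = ((\<Oplus>i\<in>{..n}. g i) \<oplus> (\<Oplus>i\<in>{..n}. h (Suc i))) \<oplus> h 0"
    using cl by (subst finsum_Suc2) (auto simp: f_Suc f_0 finsum_addf)
  also have "\<dots> = (\<Oplus>i\<in>{..n}. g i) \<oplus> (\<Oplus>i\<in>{..Suc n}. h i)"
    using cl by (subst finsum_Suc2[of h]) (auto simp: a_assoc)
  also have "(\<Oplus>i\<in>{..Suc n}. h i) = (\<Oplus>i\<in>{..n}. h i)"
    using cl h_top by (subst finsum_Suc) auto
  also have "(\<Oplus>i\<in>{..n}. g i) = (a \<oplus> b) [^] n \<otimes> a"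
  proof -
    have "g i = add_pow R (n choose i) (a [^] i \<otimes> b [^] (n - i)) \<otimes> a" for i
      using ab by (simp add: g_def add_pow_ldistr m_assoc m_comm[of a "b [^] (n - i)"])
    then show ?thesis unfolding Suc.IH using ab by (simp add: finsum_ldistr)
  qed
  also have "(\<Oplus>i\<in>{..n}. h i) = (a \<oplus> b) [^] n \<otimes> b"
  proof -
    have "h i = add_pow R (n choose i) (a [^] i \<otimes> b [^] (n - i)) \<otimes> b" if "i \<le> n" for i
      using ab that by (simp add: h_def add_pow_ldistr m_assoc Suc_diff_le)
    then have "(\<Oplus>i\<in>{..n}. h i) = (\<Oplus>i\<in>{..n}. add_pow R (n choose i) (a [^] i \<otimes> b [^] (n - i)) \<otimes> b)"
      using ab by (intro finsum_cong') auto
    then show ?thesis unfolding Suc.IH using ab by (simp add: finsum_ldistr)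
  qed
  finally have "(\<Oplus>i\<in>{..Suc n}. f i) = (a \<oplus> b) [^] Suc n" using ab by (simp add: r_distr)
  then show ?case by (simp add: f_def)
qed

text \<open>The prime p divides the inner binomial coefficients and vanishes in the ring; iteration
  passes from p to p^f.\<close>

lemma (in cring) frobenius_add:
  assumes p: "Factorial_Ring.prime p" "add_pow R p \<one> = \<zero>" and ab: "a \<in> carrier R" "b \<in> carrier R"
  shows "(a \<oplus> b) [^] p ^ f = a [^] p ^ f \<oplus> b [^] (p ^ f :: nat)"
proof -
  have *: "(a \<oplus> b) [^] p = a [^] p \<oplus> b [^] p" if ab: "a \<in> carrier R" "b \<in> carrier R" for a b
  proof -
    define h where "h i = add_pow R (p choose i) (a [^] i \<otimes> b [^] (p - i))" for i
    have cl: "h i \<in> carrier R" for i using ab by (auto simp: h_def)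
    have h0: "h i = \<zero>" if i: "0 < i" "i < p" for i
    proof -
      have c: "a [^] i \<otimes> b [^] (p - i) \<in> carrier R" using ab by simp
      obtain m where "p choose i = p * m"
        using dvd_choose_prime[of i p] p(1) i unfolding dvd_def by auto
      then have "h i = add_pow R m (add_pow R p (a [^] i \<otimes> b [^] (p - i)))"
        using c by (simp add: h_def add.nat_pow_pow)
      also have "add_pow R p (a [^] i \<otimes> b [^] (p - i)) = \<zero>"
        using add_pow_ldistr[of \<one> _ p] p c by simp
      finally show ?thesis by simp
    qed
    \<comment> \<open>Writing p as m + 2 lets the two outer terms be split off, one at each end of
      the sum.\<close>
    obtain m where m: "p = Suc (Suc m)"
      using p(1) by (metis One_nat_def Suc_lessD less_imp_Suc_add plus_nat.add_0 prime_gt_1_nat add_Suc)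
    have "(\<Oplus>i\<in>{..p}. h i) = h p \<oplus> ((\<Oplus>i\<in>{..m}. h (Suc i)) \<oplus> h 0)"
      unfolding m using cl by (subst finsum_Suc, simp, subst finsum_Suc2) auto
    also have "(\<Oplus>i\<in>{..m}. h (Suc i)) = \<zero>"
      using h0 m by (intro add.finprod_one_eqI) auto
    finally show ?thesis
      using binomial_theorem[OF ab, of p] cl ab by (simp add: h_def)
  qed
  show ?thesis
  proof (induction f)
    case (Suc f)
    have "(a \<oplus> b) [^] p ^ Suc f = ((a \<oplus> b) [^] p ^ f) [^] p"
      using ab by (simp add: nat_pow_pow mult.commute)
    also have "\<dots> = (a [^] p ^ f) [^] p \<oplus> (b [^] p ^ f) [^] p" using Suc * ab by simp
    finally show ?case using ab by (simp add: nat_pow_pow mult.commute)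
  qed (use ab in simp)
qed

lemma (in ring) finsum_lessThan_Suc:
  assumes "f \<in> UNIV \<rightarrow> carrier R"
  shows "(\<Oplus>j\<in>{..<Suc n}. f j) = f n \<oplus> (\<Oplus>j\<in>{..<n}. f j)"
  using assms by (subst lessThan_Suc, subst finsum_insert) auto

lemma (in cring) geometric_sum:
  assumes "t \<in> carrier R"
  shows "(t \<ominus> \<one>) \<otimes> (\<Oplus>j\<in>{..<n}. t [^] (j::nat)) = t [^] n \<ominus> \<one>"
proof (induction n)
  case 0
  show ?case using assms by (simp add: minus_eq r_neg)
next
  case (Suc n)
  have "(t \<ominus> \<one>) \<otimes> (T \<oplus> S) = T \<otimes> t \<ominus> \<one>"
    if "(t \<ominus> \<one>) \<otimes> S = T \<ominus> \<one>" "T \<in> carrier R" "S \<in> carrier R" for T S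
  proof -
    have "(t \<ominus> \<one>) \<otimes> (T \<oplus> S) = (t \<ominus> \<one>) \<otimes> T \<oplus> (T \<ominus> \<one>)" using that assms by (simp add: r_distr)
    also have "\<dots> = T \<otimes> t \<ominus> \<one>" using that(2) assms
      by (simp add: minus_eq m_comm[of _ T] r_distr r_minus a_assoc r_neg1)
    finally show ?thesis .
  qed
  then show ?case using Suc assms finsum_lessThan_Suc[of "\<lambda>j. t [^] j" n] by auto
qed

text \<open>The Frobenius map \<open>F\<close> generates a cyclic group of order \<open>e\<close>, and the trace
  \<open>1 + F + \<dots> + F\<^sup>e\<^sup>-\<^sup>1\<close> takes values in \<open>k\<close>. Hence an idempotent lies in \<open>k\<close>, so it is trivial; but
  each \<open>w\<close> with \<open>w [^] Q = w\<close> gives the idempotent \<open>w [^] (Q - 1)\<close>.\<close>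

lemma (in cring) kummer_residue_extension_field:
  fixes q e :: nat
  assumes k: "subring k R" and kq: "\<And>c. c \<in> k \<Longrightarrow> c [^] q = c"
    and kinv: "\<And>c. \<lbrakk>c \<in> k; c \<noteq> \<zero>\<rbrakk> \<Longrightarrow> \<exists>d\<in>k. c \<otimes> d = \<one>"
    and frob: "\<And>a b. \<lbrakk>a \<in> carrier R; b \<in> carrier R\<rbrakk> \<Longrightarrow> (a \<oplus> b) [^] q = a [^] q \<oplus> b [^] q"
    and q: "q > 1" and e: "e > 0" "add_pow R e \<one> \<noteq> \<zero>"
    and y: "y \<in> carrier R" "y [^] q = z \<otimes> y" "y [^] e \<in> k"
    and z: "z \<in> k" "z [^] e = \<one>" "\<And>i::nat. z [^] i = \<one> \<Longrightarrow> e dvd i"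
    and gen: "carrier R = simple_extension k y"
    and w: "w \<in> carrier R" "w \<noteq> \<zero>"
  shows "\<exists>b\<in>carrier R. w \<otimes> b = \<one>"
proof -
  note kc = subsetD[OF subringE(1)[OF k]]
  note kE = subringE[OF k]
  have kpow: "c [^] (n::nat) \<in> k" if "c \<in> k" for c n
    by (induction n) (use that kE(3,6) in auto)
  have F_Suc: "a [^] q ^ Suc j = (a [^] q ^ j) [^] q" if "a \<in> carrier R" for a j
    using that by (simp add: nat_pow_pow mult.commute)
  have F_add: "(a \<oplus> b) [^] q ^ j = a [^] q ^ j \<oplus> b [^] q ^ j" if "a \<in> carrier R" "b \<in> carrier R" for a b j
    by (induction j) (use that frob F_Suc in \<open>auto simp del: power_Suc\<close>)
  have F_k: "c [^] q ^ j = c" if "c \<in> k" for c j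
    by (induction j) (use that kq kc F_Suc in \<open>auto simp del: power_Suc\<close>)
  \<comment> \<open>The scalar z lies in \<open>k\<close> and is fixed by the q-th power, so the
    j-th iterate multiplies y by z^j; as z^e = 1, the e-th iterate is trivial.\<close>
  have F_y: "y [^] q ^ j = z [^] j \<otimes> y" for j
  proof (induction j)
    case (Suc j)
    have "y [^] q ^ Suc j = (z [^] j) [^] q \<otimes> y [^] q"
      unfolding F_Suc[OF y(1)] Suc using y z kc by (simp add: nat_pow_distrib)
    also have "\<dots> = z [^] j \<otimes> (z \<otimes> y)" using y kq[OF kpow[OF z(1)]] by simp
    finally show ?case using y z kc by (simp add: m_assoc)
  qed (use y in simp)
  have F_e: "a [^] q ^ e = a" if "a \<in> carrier R" for a
    using that unfolding gen
  proof (induction rule: simple_extension.induct)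
    case zero
    show ?case using q by (simp add: nat_pow_zero)
  next
    case (lin a c)
    have "a \<in> carrier R" using lin(1) gen by simp
    then have "(a \<otimes> y \<oplus> c) [^] q ^ e = a [^] q ^ e \<otimes> y [^] q ^ e \<oplus> c [^] q ^ e"
      using lin(2) kc y by (simp add: F_add nat_pow_distrib)
    then show ?case using lin F_k[OF lin(2), of e] F_y[of e] z y by simp
  qed
  define Tr where "Tr a = (\<Oplus>j\<in>{..<e}. a [^] q ^ j)" for a
  have Tr_add: "Tr (a \<oplus> b) = Tr a \<oplus> Tr b" if "a \<in> carrier R" "b \<in> carrier R" for a b
    unfolding Tr_def using that F_add by (simp add: finsum_addf)
  \<comment> \<open>The iterates multiply the monomial by the powers of t = z^i. If e divides i then
    y^i lies in \<open>k\<close>. Otherwise t - 1 is invertible and its product with the sum of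
    these powers is t^e - 1 = 0, so the trace vanishes.\<close>
  have Tr_monom: "Tr (c \<otimes> y [^] i) \<in> k" if c: "c \<in> k" for c and i :: nat
  proof -
    let ?S = "\<Oplus>j\<in>{..<e}. (z [^] i) [^] j"
    have S: "(\<Oplus>j\<in>{..<n}. (z [^] i) [^] j) \<in> k" for n :: nat
    proof (induction n)
      case (Suc n)
      then show ?case
        using finsum_lessThan_Suc[of "\<lambda>j. (z [^] i) [^] j" n] kpow[OF kpow[OF z(1)]] kE(7) kc by auto
    qed (use kE in simp)
    have "(c \<otimes> y [^] i) [^] q ^ j = c \<otimes> y [^] i \<otimes> (z [^] i) [^] j" for j
    proof -
      have "(c \<otimes> y [^] i) [^] q ^ j = c [^] q ^ j \<otimes> (y [^] q ^ j) [^] i"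
        using c kc y by (simp add: nat_pow_distrib nat_pow_pow mult.commute)
      also have "\<dots> = c \<otimes> ((z [^] i) [^] j \<otimes> y [^] i)"
        using F_k[OF c, of j] F_y[of j] y z kc by (simp add: nat_pow_distrib nat_pow_pow mult.commute)
      finally show ?thesis using c kc y z by (simp add: m_ac)
    qed
    then have Tr: "Tr (c \<otimes> y [^] i) = c \<otimes> y [^] i \<otimes> ?S"
      unfolding Tr_def using c kc y z by (simp add: finsum_rdistr)
    show ?thesis
    proof (cases "e dvd i")
      case True
      then obtain m where "i = e * m" by blast
      then have "y [^] i = (y [^] e) [^] m" using y by (simp add: nat_pow_pow)
      then have "y [^] i \<in> k" using kpow[OF y(3)] by simp
      then show ?thesis using Tr S[of e] c kE(6) by simp
    next
      case False
      let ?t = "z [^] i"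
      have tk: "?t \<in> k" using kpow[OF z(1)] .
      have "?t \<ominus> \<one> \<in> k" using tk kE(3,5,7) by (simp add: minus_eq)
      moreover have "?t \<ominus> \<one> \<noteq> \<zero>" using False z(3)[of i] tk kc by auto
      ultimately obtain d where d: "d \<in> k" "(?t \<ominus> \<one>) \<otimes> d = \<one>" using kinv by blast
      have "(?t \<ominus> \<one>) \<otimes> ?S = (z [^] e) [^] i \<ominus> \<one>"
        using geometric_sum[of ?t e] tk kc z(1) by (simp add: nat_pow_pow mult.commute)
      also have "\<dots> = \<zero>" using z(2) by (simp add: minus_eq r_neg)
      finally have "d \<otimes> ((?t \<ominus> \<one>) \<otimes> ?S) = \<zero>" using d kc by simp
      moreover have "d \<otimes> ((?t \<ominus> \<one>) \<otimes> ?S) = (?t \<ominus> \<one>) \<otimes> d \<otimes> ?S"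
        using d(1) tk kc S[of e] m_assoc m_comm by auto
      ultimately have "?S = \<zero>" using d S[of e] kc by simp
      then show ?thesis using Tr c kc y kE(2) by simp
    qed
  qed
  \<comment> \<open>The extra factor y^i is what the Horner induction needs: its step raises i by
    one.\<close>
  have Tr_k': "Tr (a \<otimes> y [^] i) \<in> k" if "a \<in> simple_extension k y" for a and i :: nat
    using that
  proof (induction arbitrary: i rule: simple_extension.induct)
    case zero
    show ?case using Tr_monom[of \<zero> i] kE(2) by simp
  next
    case (lin a c)
    have a: "a \<in> carrier R" "c \<in> carrier R" using lin gen kc by auto
    have "(a \<otimes> y \<oplus> c) \<otimes> y [^] i = a \<otimes> y [^] Suc i \<oplus> c \<otimes> y [^] i"
      using a y(1) by (simp add: l_distr m_assoc m_comm[of y "y [^] i"])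
    then show ?case
      using Tr_add[of "a \<otimes> y [^] Suc i" "c \<otimes> y [^] i"] a y lin.IH[of "Suc i"] Tr_monom[OF lin(2), of i] kE(7)
      by simp
  qed
  have Tr_k: "Tr a \<in> k" if "a \<in> carrier R" for a
    using Tr_k'[of a 0] that gen by simp
  define Q where "Q = q ^ e"
  have Q: "Q \<ge> 2" using q e unfolding Q_def
    by (metis One_nat_def Suc_leI one_less_power numeral_2_eq_2)
  obtain r where r: "Q = Suc (Suc r)" using Q by (metis Suc_le_D numeral_2_eq_2 Suc_le_mono)
  have wQ: "w [^] Q = w" using F_e w by (simp add: Q_def)
  define \<epsilon> where "\<epsilon> = w [^] (Q - 1)"
  have \<epsilon>c: "\<epsilon> \<in> carrier R" using w by (simp add: \<epsilon>_def)
  have w\<epsilon>: "w \<otimes> \<epsilon> = w"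
  proof -
    have "w [^] Suc (Q - 1) = w" using wQ Q by simp
    then show ?thesis using w by (simp add: \<epsilon>_def m_comm)
  qed
  have \<epsilon>\<epsilon>: "\<epsilon> \<otimes> \<epsilon> = \<epsilon>"
  proof -
    have "\<epsilon> = w [^] r \<otimes> w" by (simp add: \<epsilon>_def r)
    then show ?thesis using w\<epsilon> \<epsilon>c w by (metis m_assoc nat_pow_closed)
  qed
  have \<epsilon>pow: "\<epsilon> [^] n = \<epsilon>" if "n > 0" for n :: nat
    using that \<epsilon>c by (induction n rule: nat_induct_non_zero) (auto simp: \<epsilon>\<epsilon>)
  \<comment> \<open>Positive powers fix the idempotent, so its trace is e times itself; dividing by
    e, which is invertible in \<open>k\<close>, puts it in \<open>k\<close>.\<close>
  have "Tr \<epsilon> = add_pow R e \<epsilon>"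
  proof -
    have "Tr \<epsilon> = (\<Oplus>j\<in>{..<e}. \<epsilon>)" unfolding Tr_def using \<epsilon>c \<epsilon>pow q by (intro finsum_cong') auto
    also have "\<dots> = add_pow R e \<epsilon>" using add.finprod_const[OF \<epsilon>c, of "{..<e}"] by simp
    finally show ?thesis .
  qed
  also have "\<dots> = add_pow R e \<one> \<otimes> \<epsilon>" using \<epsilon>c add_pow_ldistr[of \<one> \<epsilon> e] by simp
  finally have Tr\<epsilon>: "add_pow R e \<one> \<otimes> \<epsilon> \<in> k" using Tr_k[OF \<epsilon>c] by simp
  have "add_pow R n \<one> \<in> k" for n :: nat
    by (induction n) (use kE in auto)
  then obtain d where d: "d \<in> k" "add_pow R e \<one> \<otimes> d = \<one>" using kinv e by blast
  then have "d \<otimes> (add_pow R e \<one> \<otimes> \<epsilon>) \<in> k" using Tr\<epsilon> kE(6) by blast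
  moreover have "d \<otimes> (add_pow R e \<one> \<otimes> \<epsilon>) = (add_pow R e \<one> \<otimes> d) \<otimes> \<epsilon>"
    using d kc \<epsilon>c m_assoc m_comm by auto
  ultimately have \<epsilon>k: "\<epsilon> \<in> k" using d \<epsilon>c by simp
  \<comment> \<open>A nonzero idempotent of the field \<open>k\<close> is 1, so w^(Q-2) is the
    inverse of w.\<close>
  have "\<epsilon> \<noteq> \<zero>" using w w\<epsilon> by auto
  then obtain b where b: "b \<in> k" "\<epsilon> \<otimes> b = \<one>" using kinv \<epsilon>k by blast
  have "\<epsilon> = \<epsilon> \<otimes> (\<epsilon> \<otimes> b)" using b \<epsilon>c by simp
  also have "\<dots> = \<epsilon> \<otimes> \<epsilon> \<otimes> b" using b(1) \<epsilon>c kc m_assoc by simp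
  also have "\<dots> = \<one>" using b \<epsilon>\<epsilon> by simp
  finally have "w \<otimes> w [^] r = \<one>" using w by (simp add: \<epsilon>_def r m_comm)
  then show ?thesis using w by blast
qed

section \<open>Divisibility, roots of unity and e-th powers in a local field\<close>

context local_field
begin

lemma valuation_ring_divides:
  assumes "x \<in> carrier R" "y \<in> carrier R - {\<zero>}" "vge R v x (v y)"
  shows "\<exists>r\<in>valuation_ring R v. x = r \<otimes> y"
proof (rule bexI[of _ "x \<otimes> inv y"])
  have "vge R v (x \<otimes> inv y) (v y + - v y)"
    by (rule vge_mult) (use assms nz_inv[OF assms(2)] v_inv[OF assms(2)] in \<open>auto simp: vge_def\<close>)
  then show "x \<otimes> inv y \<in> valuation_ring R v"
    using assms nz_inv[OF assms(2)] by (simp add: valuation_ring_def)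
  show "x = x \<otimes> inv y \<otimes> y" using assms nz_inv[OF assms(2)] by (simp add: m_assoc)
qed

text \<open>A nonzero term of least valuation divides all terms. This discharges the assumption
  \<open>dv\<close> of the integrality lemmas.\<close>

lemma valuation_ring_sequence_min:
  assumes a: "range (a :: nat \<Rightarrow> 'a) \<subseteq> valuation_ring R v"
  shows "\<exists>m. \<forall>n. \<exists>r\<in>valuation_ring R v. a n = r \<otimes> a m"
proof (cases "\<forall>n. a n = \<zero>")
  case True
  then show ?thesis using valuation_ring_one by (intro exI[of _ 0]) (auto intro!: bexI[of _ \<one>])
next
  case False
  have ac: "a n \<in> carrier R" "vge R v (a n) 0" for n
    using a by (auto simp: valuation_ring_def)
  obtain m where m: "a m \<noteq> \<zero>" and min: "\<And>n. a n \<noteq> \<zero> \<Longrightarrow> nat (v (a m)) \<le> nat (v (a n))"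
    using False exists_least_lemma[of "\<lambda>N. \<exists>m. a m \<noteq> \<zero> \<and> nat (v (a m)) = N"]
    by (metis ex_has_least_nat[of "\<lambda>n. a n \<noteq> \<zero>" _ "\<lambda>n. nat (v (a n))"])
  have "vge R v (a n) (v (a m))" for n
    using min[of n] ac[of n] ac[of m] m by (auto simp: vge_def)
  then show ?thesis using valuation_ring_divides[of "a _" "a m"] ac m by blast
qed

lemma mm_multiple:
  assumes "\<pi> \<in> carrier R - {\<zero>}" "v \<pi> = 1" "x \<in> \<mm>"
  shows "\<exists>r\<in>valuation_ring R v. x = r \<otimes> \<pi>"
  using valuation_ring_divides[of x \<pi>] assms by (simp add: mm_iff)

lemma root_of_unity_valuation:
  assumes "z \<in> carrier R" "z [^] e = \<one>" "e > (0::nat)"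
  shows "z \<in> carrier R - {\<zero>}" "v z = 0" "z \<in> valuation_ring R v"
proof -
  show z: "z \<in> carrier R - {\<zero>}" using assms by (auto simp: nat_pow_zero)
  show "v z = 0" using v_pow[OF z, of e] assms v_one by simp
  then show "z \<in> valuation_ring R v" using z valuation_ring_unit_iff by auto
qed

lemma root_of_unity_eq_one:
  assumes e: "add_pow R (e::nat) \<one> \<notin> \<mm>" and z: "z \<in> carrier R" "z [^] e = \<one>" "z \<ominus> \<one> \<in> \<mm>"
  shows "z = \<one>"
  using one_unit_root_unique[OF e z(1) _ z(2)] z(3) by (simp add: mm_iff)

text \<open>Reduction is injective on e-th roots of 1, since the only principal unit among them is
  1. Their images satisfy x^d = 1 for d = gcd(e, q - 1), which has at most d solutions, so e \<le>
  d.\<close>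

lemma exponent_dvd_q_minus_1:
  assumes e: "add_pow R e \<one> \<notin> \<mm>" "e > 0" and card: "card (roots_of_unity R e) = e"
  shows "e dvd q - 1"
proof -
  let ?\<mu> = "roots_of_unity R e" and ?d = "gcd e (q - 1)"
  have d: "?d > 0" using e by simp
  have mu: "z \<in> carrier R - {\<zero>} \<and> v z = 0 \<and> z \<in> valuation_ring R v \<and> z [^] e = \<one>" if "z \<in> ?\<mu>" for z
    using that root_of_unity_valuation[of z e] e by (auto simp: roots_of_unity_def)
  have "inj_on (\<lambda>z. res z) ?\<mu>"
  proof (rule inj_onI)
    fix x y assume xy: "x \<in> ?\<mu>" "y \<in> ?\<mu>" "res x = res y"
    note x = mu[OF xy(1)] and y = mu[OF xy(2)]
    then have "x \<ominus> y \<in> \<mm>" using res_eq_iff xy by simp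
    note t = div_in_one_units[of x y, OF _ _ _ _ this]
    have iy: "inv y \<in> carrier R" "y \<otimes> inv y = \<one>" "inv y \<otimes> y = \<one>" using nz_inv[of y] y by auto
    have "(x \<otimes> inv y) [^] e = x [^] e \<otimes> inv y [^] e" using x iy by (simp add: nat_pow_distrib)
    also have "\<dots> = y [^] e \<otimes> inv y [^] e" using x y by simp
    also have "\<dots> = (y \<otimes> inv y) [^] e" using y iy(1) by (simp add: nat_pow_distrib)
    also have "\<dots> = \<one>" using iy(2) by simp
    finally have "x \<otimes> inv y = \<one>" using one_unit_root_unique[OF e(1)] t x y by simp
    then have "x \<otimes> inv y \<otimes> y = y" using y by simp
    then show "x = y" using iy x y by (simp add: m_assoc)
  qed
  then have "e = card ((\<lambda>z. res z) ` ?\<mu>)" using card by (simp add: card_image)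
  also have "\<dots> \<le> card {x \<in> carrier \<kk>. x [^]\<^bsub>\<kk>\<^esub> ?d = \<one>\<^bsub>\<kk>\<^esub>}"
  proof (rule card_mono)
    show "finite {x \<in> carrier \<kk>. x [^]\<^bsub>\<kk>\<^esub> ?d = \<one>\<^bsub>\<kk>\<^esub>}" using finite_kk by simp
    interpret G: group "Multiplicative_Group.mult_of \<kk>" by (rule kk.field_mult_group)
    show "(\<lambda>z. res z) ` ?\<mu> \<subseteq> {x \<in> carrier \<kk>. x [^]\<^bsub>\<kk>\<^esub> ?d = \<one>\<^bsub>\<kk>\<^esub>}"
    proof (rule image_subsetI)
      fix z assume "z \<in> ?\<mu>"
      note z = mu[OF this]
      have "res z [^]\<^bsub>\<kk>\<^esub> e = \<one>\<^bsub>\<kk>\<^esub>" using z res_pow[of z e] res_one by simp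
      moreover from this have r: "res z \<in> carrier (Multiplicative_Group.mult_of \<kk>)"
        using z e by (auto simp: carrier_kk kk.nat_pow_zero)
      ultimately have "G.ord (res z) dvd e"
        using G.pow_eq_id[OF r] by (simp add: Multiplicative_Group.nat_pow_mult_of)
      moreover have "G.ord (res z) dvd q - 1" using G.ord_dvd_group_order[OF r] order_mult_of_kk by simp
      ultimately have "res z [^]\<^bsub>\<kk>\<^esub> ?d = \<one>\<^bsub>\<kk>\<^esub>"
        using G.pow_eq_id[OF r, of ?d] by (simp add: Multiplicative_Group.nat_pow_mult_of)
      then show "res z \<in> {x \<in> carrier \<kk>. x [^]\<^bsub>\<kk>\<^esub> ?d = \<one>\<^bsub>\<kk>\<^esub>}" using r by simp
    qed
  qed
  also have "\<dots> \<le> ?d" using kk.card_power_roots(2)[OF _ d] by simp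
  finally have "?d = e" using e by (simp add: gcd_le1_nat le_antisym)
  then show ?thesis by (metis gcd_dvd2)
qed

text \<open>Modulo e-th powers the group of K is generated by \<pi> and u: remove the valuation,
  match the residue by a power of u, and take an e-th root of the remaining principal unit. The
  exponent of \<pi> is pinned to v x mod e because it will be tested by roots of unity.\<close>

lemma unit_decomposition:
  assumes e: "add_pow R e \<one> \<notin> \<mm>" "e > 0"
    and \<pi>: "\<pi> \<in> carrier R - {\<zero>}" "v \<pi> = 1"
    and u: "u \<in> carrier R - {\<zero>}" "v u = 0"
      "\<And>x. \<lbrakk>x \<in> carrier R - {\<zero>}; v x = 0\<rbrakk> \<Longrightarrow> \<exists>i::nat. x \<ominus> u [^] i \<in> \<mm>"
    and x: "x \<in> carrier R - {\<zero>}"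
  obtains t and i j :: nat where "t \<in> carrier R - {\<zero>}" "int j = v x mod int e"
    "x = \<pi> [^] j \<otimes> u [^] i \<otimes> t [^] e"
proof -
  define j where "j = nat (v x mod int e)"
  have j: "int j = v x mod int e" using e by (simp add: j_def)
  \<comment> \<open>The e-th power of \<open>s\<close> absorbs the quotient of v x by e, leaving the
    remainder for \<pi>.\<close>
  obtain s where s: "s \<in> carrier R - {\<zero>}" "v s = v x div int e"
    by (metis UNIV_I imageE v_normalised)
  define r where "r = \<pi> [^] j \<otimes> s [^] e"
  have r: "r \<in> carrier R - {\<zero>}" unfolding r_def using nz_pow \<pi> s by (intro nz_mult) auto
  have vr: "v r = v x"
    unfolding r_def using v_mult[of "\<pi> [^] j" "s [^] e"] nz_pow v_pow \<pi> s j by simp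
  note ir = nz_inv[OF r]
  define c where "c = x \<otimes> inv r"
  have c: "c \<in> carrier R - {\<zero>}" "v c = 0"
    unfolding c_def using nz_mult[OF x ir(1)] v_mult[OF x ir(1)] v_inv[OF r] vr by auto
  have x': "x = c \<otimes> r" using x ir r by (simp add: c_def m_assoc)
  obtain i :: nat where i: "c \<ominus> u [^] i \<in> \<mm>" using u(3)[OF c] by blast
  have ui: "u [^] i \<in> carrier R - {\<zero>}" "v (u [^] i) = 0" using nz_pow[OF u(1)] v_pow[OF u(1)] u by auto
  obtain w where w: "w \<in> carrier R" "vge R v (w \<ominus> \<one>) 1" "w [^] e = c \<otimes> inv (u [^] i)"
    using one_unit_root[OF e(1) div_in_one_units[OF c ui i]] by blast
  have c': "c = u [^] i \<otimes> w [^] e" using w c nz_inv[OF ui(1)] ui m_comm[of "u [^] i"] by (simp add: m_assoc)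
  have "x = \<pi> [^] j \<otimes> u [^] i \<otimes> (w \<otimes> s) [^] e"
  proof -
    have "(A \<otimes> B) \<otimes> (C \<otimes> D) = C \<otimes> A \<otimes> (B \<otimes> D)"
      if "A \<in> carrier R" "B \<in> carrier R" "C \<in> carrier R" "D \<in> carrier R" for A B C D
      using that by (simp add: m_ac)
    from this[of "u [^] i" "w [^] e" "\<pi> [^] j" "s [^] e"] show ?thesis
      unfolding x' c' r_def using w(1) s \<pi> u by (simp add: nat_pow_distrib)
  qed
  moreover have "w \<otimes> s \<in> carrier R - {\<zero>}" using nz_mult one_unit(1) w s by blast
  ultimately show thesis using that j by blast
qed

lemma valuation_ring_denominator:
  assumes "x \<in> carrier R" "\<pi> \<in> carrier R - {\<zero>}" "v \<pi> = 1"
  shows "\<exists>m::nat. x \<otimes> \<pi> [^] m \<in> valuation_ring R v"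
proof (cases "x = \<zero>")
  case True
  then show ?thesis using assms by (auto simp: valuation_ring_def)
next
  case False
  have "v (x \<otimes> \<pi> [^] n) = v x + int n" for n :: nat
    using v_mult[of x "\<pi> [^] n"] nz_pow[OF assms(2), of n] v_pow[OF assms(2), of n] assms False by simp
  moreover obtain n :: nat where "0 \<le> v x + int n" by (rule that[of "nat \<bar>v x\<bar>"]) simp
  ultimately have "0 \<le> v (x \<otimes> \<pi> [^] n)" by simp
  moreover have "x \<otimes> \<pi> [^] n \<in> carrier R" using assms by simp
  ultimately show ?thesis unfolding valuation_ring_def vge_def by blast
qed

end

section \<open>The ring of integers of the Kummer extension\<close>

lemma (in ring) subring_add_pow: "add_pow (R\<lparr>carrier := S\<rparr>) (n::nat) x = add_pow R n x"
  by (simp add: add_pow_def nat_pow_def)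

lemma (in ring) subring_pow_closed: "\<lbrakk>subring S R; x \<in> S\<rbrakk> \<Longrightarrow> x [^] (n::nat) \<in> S"
  by (induction n) (auto dest: subringE(3,6))

lemma (in ring_hom_ring) image_simple_extension:
  assumes "k \<subseteq> carrier R" "y \<in> carrier R"
  shows "h ` R.simple_extension k y = S.simple_extension (h ` k) (h y)"
proof
  have c: "R.simple_extension k y \<subseteq> carrier R" using R.simple_extension_in_carrier[OF assms] .
  show "h ` R.simple_extension k y \<subseteq> S.simple_extension (h ` k) (h y)"
  proof (rule image_subsetI)
    fix x assume "x \<in> R.simple_extension k y"
    then show "h x \<in> S.simple_extension (h ` k) (h y)"
    proof (induction rule: R.simple_extension.induct)
      case zero
      show ?case by simp
    next
      case (lin k1 k2)
      have "k1 \<in> carrier R" "k2 \<in> carrier R" using lin c assms by auto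
      then show ?case using S.simple_extension.lin[OF lin.IH, of "h k2"] lin assms by simp
    qed
  qed
  show "S.simple_extension (h ` k) (h y) \<subseteq> h ` R.simple_extension k y"
  proof
    fix x assume "x \<in> S.simple_extension (h ` k) (h y)"
    then show "x \<in> h ` R.simple_extension k y"
    proof (induction rule: S.simple_extension.induct)
      case zero
      show ?case using hom_zero by (metis R.simple_extension.zero imageI)
    next
      case (lin k1 k2)
      then obtain a b where ab: "a \<in> R.simple_extension k y" "k1 = h a" "b \<in> k" "k2 = h b" by auto
      then have "h (a \<otimes>\<^bsub>R\<^esub> y \<oplus>\<^bsub>R\<^esub> b) = k1 \<otimes>\<^bsub>S\<^esub> h y \<oplus>\<^bsub>S\<^esub> k2"
        using c assms by (auto simp: subset_iff)
      then show ?case using R.simple_extension.lin[OF ab(1,3)] by (metis imageI)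
    qed
  qed
qed

text \<open>Bundles the choices so that the rings built from them have names. \<open>u_ord\<close>
  is what gives u^((q-1)/e) exact order e in the residue field. The abbreviation \<open>M\<close>
  below is the tower K(\<eta>)(\<omega>), identified with \<open>kummer_extension\<close> only
  later.\<close>

locale kummer_generators = algebraic_closure L K for L (structure) and K +
  fixes v :: "'a \<Rightarrow> int" and e :: nat and \<pi> u \<eta> \<omega> :: 'a
  assumes local_field_K: "local_field (L\<lparr>carrier := K\<rparr>) v"
    and e_pos: "e > 0"
    and e_coprime: "\<not> ring_char (residue_field (L\<lparr>carrier := K\<rparr>) v) dvd e"
    and card_roots: "card (roots_of_unity (L\<lparr>carrier := K\<rparr>) e) = e"
    and \<pi>: "\<pi> \<in> K" "\<pi> \<noteq> \<zero>" "v \<pi> = 1"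
    and u: "u \<in> K" "u \<noteq> \<zero>" "v u = 0"
    and u_gen: "\<And>x. \<lbrakk>x \<in> K; x \<noteq> \<zero>; v x = 0\<rbrakk>
      \<Longrightarrow> \<exists>i::nat. x \<ominus> u [^] i \<in> valuation_ideal (L\<lparr>carrier := K\<rparr>) v"
    and u_ord: "\<And>j::nat. u [^] j \<ominus> \<one> \<in> valuation_ideal (L\<lparr>carrier := K\<rparr>) v
      \<Longrightarrow> card (carrier (residue_field (L\<lparr>carrier := K\<rparr>) v)) - 1 dvd j"
    and \<eta>: "\<eta> \<in> carrier L" "\<eta> [^] e = u"
    and \<omega>: "\<omega> \<in> carrier L" "\<omega> [^] e = \<pi>"
begin

sublocale B: local_field "L\<lparr>carrier := K\<rparr>" v
  by (rule local_field_K)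

abbreviation OK where "OK \<equiv> valuation_ring (L\<lparr>carrier := K\<rparr>) v"
abbreviation mK where "mK \<equiv> valuation_ideal (L\<lparr>carrier := K\<rparr>) v"
abbreviation A0 where "A0 \<equiv> simple_extension OK \<eta>"
abbreviation A where "A \<equiv> simple_extension A0 \<omega>"
abbreviation K0 where "K0 \<equiv> simple_extension K \<eta>"
abbreviation M where "M \<equiv> simple_extension K0 \<omega>"

lemma K_subring: "subring K L" by (rule subfieldE(1)[OF subfield_axioms])
lemma K_carrier: "x \<in> K \<Longrightarrow> x \<in> carrier L" using subset by auto

lemma K_inv: "\<lbrakk>x \<in> K; x \<noteq> \<zero>\<rbrakk> \<Longrightarrow> inv x \<in> K \<and> inv x \<noteq> \<zero> \<and> x \<otimes> inv x = \<one> \<and> inv x \<otimes> x = \<one>"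
  using subfield_m_inv[OF subfield_axioms, of x] by auto

lemma OK_K: "x \<in> OK \<Longrightarrow> x \<in> K" by (simp add: valuation_ring_def)

lemma OK_subring: "subring OK L"
proof (rule ring_incl_imp_subring)
  show "OK \<subseteq> carrier L" using OK_K K_carrier by auto
  show "ring (L\<lparr>carrier := OK\<rparr>)" using B.OO.ring_axioms by simp
qed

lemma OK_carrier: "x \<in> OK \<Longrightarrow> x \<in> carrier L" using OK_K K_carrier by blast

lemma \<pi>_OK: "\<pi> \<in> OK" and u_OK: "u \<in> OK" and \<pi>_mK: "\<pi> \<in> mK"
  using \<pi> u by (auto simp: valuation_ring_def valuation_ideal_def vge_def)

lemma mK_multiple: "x \<in> mK \<Longrightarrow> \<exists>r\<in>OK. x = r \<otimes> \<pi>"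
  using B.mm_multiple[of \<pi> x] \<pi> by simp

lemma A0_subring: "subring A0 L"
  by (rule simple_extension_is_subring[OF OK_subring \<eta>(1)])
lemma A_subring: "subring A L"
  by (rule simple_extension_is_subring[OF A0_subring \<omega>(1)])
lemma A0_carrier: "x \<in> A0 \<Longrightarrow> x \<in> carrier L" using subringE(1)[OF A0_subring] by auto
lemma A_carrier: "x \<in> A \<Longrightarrow> x \<in> carrier L" using subringE(1)[OF A_subring] by auto
lemma OK_A0: "x \<in> OK \<Longrightarrow> x \<in> A0"
  using simple_extension_incl[OF subringE(1)[OF OK_subring] \<eta>(1)] by auto
lemma A0_A: "x \<in> A0 \<Longrightarrow> x \<in> A"
  using simple_extension_incl[OF subringE(1)[OF A0_subring] \<omega>(1)] by auto
lemma \<eta>_A0: "\<eta> \<in> A0" by (rule simple_extension_mem[OF OK_subring \<eta>(1)])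
lemma \<omega>_A: "\<omega> \<in> A" by (rule simple_extension_mem[OF A0_subring \<omega>(1)])
lemma \<pi>_carrier: "\<pi> \<in> carrier L" using \<pi> K_carrier by simp
lemma \<omega>_nonzero: "\<omega> \<noteq> \<zero>" using \<omega> \<pi> e_pos by (auto simp: nat_pow_zero)

text \<open>Adjoining \<eta> and then \<omega> keeps the ring inside a finitely generated module
  over the valuation ring, which therefore contains all powers of a.\<close>

lemma A_integral:
  assumes "a \<in> A"
  shows "\<exists>p. p \<noteq> [] \<and> set p \<subseteq> OK \<and> hd p = \<one> \<and> eval p a = \<zero>"
proof -
  have "OK \<subseteq> Span OK [\<one>]"
  proof
    fix x assume x: "x \<in> OK"
    have "\<one> \<in> Span OK [\<one>]" by (rule Span_base[OF OK_subring]) auto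
    from Span_submodule(4)[OF OK_subring _ x this] show "x \<in> Span OK [\<one>]"
      using OK_carrier[OF x] by simp
  qed
  then obtain us where "set us \<subseteq> carrier L" "A0 \<subseteq> Span OK us"
    using simple_extension_subset_Span[OF OK_subring OK_subring, of "[\<one>]" \<eta> e] \<eta> u_OK e_pos by auto
  then obtain us where us: "set us \<subseteq> carrier L" "A \<subseteq> Span OK us"
    using simple_extension_subset_Span[OF A0_subring OK_subring, of us \<omega> e] \<omega> OK_A0[OF \<pi>_OK] e_pos by auto
  show ?thesis
  proof (rule integral_if_powers_in_Span[OF OK_subring _ us(1)])
    show "a \<in> carrier L" "\<And>n::nat. a [^] n \<in> Span OK us"
      using assms A_carrier us(2) subring_pow_closed[OF A_subring] by auto
    show "\<exists>m. \<forall>n. \<exists>r\<in>OK. f n = r \<otimes> f m" if "range f \<subseteq> OK" for f :: "nat \<Rightarrow> 'a"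
      using B.valuation_ring_sequence_min[OF that] by simp
  qed
qed

text \<open>An inverse a of \<pi> would be integral, and clearing denominators gives 1 = (a\<pi>)^d
  = \<pi>b with b in the valuation ring of K.\<close>

lemma inv_\<pi>_not_in_A:
  assumes "a \<in> A" shows "\<pi> \<otimes> a \<noteq> \<one>"
proof
  assume 1: "\<pi> \<otimes> a = \<one>"
  obtain p where "p \<noteq> []" "set p \<subseteq> OK" "hd p = \<one>" "eval p a = \<zero>"
    using A_integral[OF assms] by blast
  then obtain d :: nat and b where b: "b \<in> OK" "(a \<otimes> \<pi> [^] (1::nat)) [^] d = \<pi> \<otimes> b"
    using integral_fraction[OF OK_subring order_refl A_carrier[OF assms] \<pi>_OK, of 1 p]
      1 m_comm[of a \<pi>] A_carrier[OF assms] \<pi>_carrier subringE(3)[OF OK_subring] by auto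
  then have "\<pi> \<otimes> b = \<one>" using 1 m_comm[of a \<pi>] A_carrier[OF assms] \<pi>_carrier by simp
  then have "\<one> \<in> mK" using B.mm.I_r_closed[OF \<pi>_mK, of b] b by simp
  then show False using B.one_notin_mm by simp
qed

lemma \<omega>_not_unit:
  assumes "a \<in> A" shows "\<omega> \<otimes> a \<noteq> \<one>"
proof
  assume "\<omega> \<otimes> a = \<one>"
  then have "\<pi> \<otimes> a [^] e = \<one>"
    using nat_pow_distrib[of \<omega> a e] \<omega> A_carrier[OF assms] by simp
  then show False using inv_\<pi>_not_in_A[of "a [^] e"] subring_pow_closed[OF A_subring assms] by simp
qed

lemma \<pi>_\<omega>: "\<pi> = \<omega> \<otimes> \<omega> [^] (e - 1)"
  using \<omega> e_pos by (cases e) (auto simp: m_comm)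

lemma K_minus: "\<lbrakk>x \<in> K; y \<in> K\<rbrakk> \<Longrightarrow> x \<ominus>\<^bsub>L\<lparr>carrier := K\<rparr>\<^esub> y = x \<ominus> y"
  by (rule subring_minus[OF K_subring])

lemma OK_pow: "x \<in> OK \<Longrightarrow> x [^] (n::nat) \<in> OK"
  using subring_pow_closed[OF OK_subring] .

lemma OK_unit: "\<lbrakk>x \<in> OK; x \<notin> mK\<rbrakk> \<Longrightarrow> \<exists>d\<in>OK. x \<otimes> d = \<one>"
  using B.valuation_ring_unit[of x] by auto

text \<open>The trace argument is applied to the quotient of \<open>A0\<close> by \<pi>, with the
  image of the valuation ring as \<open>k\<close>. The outcome is put as a Bezout identity so that
  later arguments work with elements instead of cosets.\<close>

lemma A0_mod_\<pi>:
  assumes w: "w \<in> A0"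
  shows "(\<exists>a\<in>A0. w = \<pi> \<otimes> a) \<or> (\<exists>a\<in>A0. \<exists>b\<in>A0. w \<otimes> a \<oplus> \<pi> \<otimes> b = \<one>)"
proof (cases "\<exists>a\<in>A0. w = \<pi> \<otimes> a")
  case False
  define I where "I = (\<lambda>a. \<pi> \<otimes> a) ` A0"
  define R0 where "R0 = L\<lparr>carrier := A0\<rparr>"
  have R0s: "carrier R0 = A0" "\<one>\<^bsub>R0\<^esub> = \<one>" "\<zero>\<^bsub>R0\<^esub> = \<zero>" "\<And>x y. x \<otimes>\<^bsub>R0\<^esub> y = x \<otimes> y"
    "\<And>x y. x \<oplus>\<^bsub>R0\<^esub> y = x \<oplus> y" by (auto simp: R0_def)
  have R0_pow: "x [^]\<^bsub>R0\<^esub> (n::nat) = x [^] n" for x n by (simp add: R0_def subring_nat_pow)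
  have R0_minus: "x \<ominus>\<^bsub>R0\<^esub> y = x \<ominus> y" if "x \<in> A0" "y \<in> A0" for x y
    unfolding R0_def by (rule subring_minus[OF A0_subring that])
  interpret R0: cring R0
    using subring_is_domain[OF A0_subring] by (simp add: R0_def domain_def)
  note A0E = subringE[OF A0_subring]
  have \<pi>A0: "\<pi> \<in> A0" using OK_A0 \<pi>_OK by simp
  have I_PIdl: "I = PIdl\<^bsub>R0\<^esub> \<pi>"
    unfolding I_def cgenideal_def using A0_carrier \<pi>A0 m_comm by (force simp: R0s)
  interpret I: ideal I R0
    unfolding I_PIdl using R0.cgenideal_ideal \<pi>A0 by (simp add: R0s)
  define Q where "Q = R0 Quot I"
  interpret Q: cring Q unfolding Q_def by (rule I.quotient_is_cring[OF R0.cring_axioms])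
  define h where "h x = I +>\<^bsub>R0\<^esub> x" for x
  interpret h: ring_hom_ring R0 Q h
    unfolding Q_def h_def using I.rcos_ring_hom_ring by simp
  have h_eq: "h x = h y \<longleftrightarrow> x \<ominus> y \<in> I" if "x \<in> A0" "y \<in> A0" for x y
    using I.rcos_eq_iff[of x y] R0_minus that by (simp add: h_def R0s)
  have Q_carrier: "carrier Q = h ` A0"
    by (auto simp: Q_def FactRing_def A_RCOSETS_def' h_def R0s)
  have mK_I: "x \<in> I" if "x \<in> mK" for x
    using mK_multiple[OF that] OK_A0 A0_carrier \<pi>_carrier m_comm unfolding I_def by force
  have one_I: "\<one> \<notin> I" unfolding I_def using inv_\<pi>_not_in_A A0_A by force
  \<comment> \<open>A unit of the valuation ring cannot lie in \<pi>A0, as \<pi> has no inverse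
    there; so the image of the valuation ring in \<open>Q\<close> is a copy of the residue
    field.\<close>
  have OK_I: "x \<in> mK" if x: "x \<in> OK" "x \<in> I" for x
  proof (rule ccontr)
    assume "x \<notin> mK"
    then obtain d where "d \<in> OK" "x \<otimes> d = \<one>" using OK_unit x by blast
    then show False using I.I_r_closed[OF x(2), of d] OK_A0 one_I by (simp add: R0s)
  qed
  have h_OK: "h x = h y" if "x \<in> OK" "y \<in> OK" "x \<ominus> y \<in> mK" for x y
    using h_eq that OK_A0 mK_I by simp
  have h_one: "h \<one> = \<one>\<^bsub>Q\<^esub>" using h.hom_one by (simp add: R0s)
  have h_zero: "h x = \<zero>\<^bsub>Q\<^esub> \<longleftrightarrow> x \<in> I" if "x \<in> A0" for x
    using h_eq[OF that, of \<zero>] h.hom_zero A0E(2) A0_carrier[OF that] by (simp add: R0s minus_eq)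
  have h_mult: "h (x \<otimes> y) = h x \<otimes>\<^bsub>Q\<^esub> h y" if "x \<in> A0" "y \<in> A0" for x y
    using h.hom_mult[of x y] that by (simp add: R0s)
  have h_pow: "h (x [^] n) = h x [^]\<^bsub>Q\<^esub> (n::nat)" if "x \<in> A0" for x n
    using h.hom_nat_pow[of x n] that by (simp add: R0s R0_pow)
  have h_add_pow: "h (add_pow L n \<one>) = add_pow Q (n::nat) \<one>\<^bsub>Q\<^esub>" and n_OK: "add_pow L n \<one> \<in> OK" for n :: nat
  proof -
    show "add_pow L n \<one> \<in> OK" for n :: nat
      using B.add_pow_valuation_ring[of n] by (simp add: subring_add_pow)
    then show "h (add_pow L n \<one>) = add_pow Q (n::nat) \<one>\<^bsub>Q\<^esub>"
    proof (induction n)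
      case 0
      show ?case using h_zero[of \<zero>] A0E(2) I.zero_closed by (simp add: R0s)
    next
      case (Suc n)
      then show ?case using h.hom_add[of "add_pow L n \<one>" \<one>] OK_A0 h_one A0E(3) by (simp add: R0s)
    qed
  qed
  obtain f where f: "B.q = ring_char B.\<kk> ^ f" using B.q_prime_power by auto
  have dvd: "e dvd B.q - 1"
    using B.exponent_dvd_q_minus_1[of e] e_coprime e_pos card_roots B.add_pow_one_mem_mm by simp
  then obtain s where s: "B.q - 1 = e * s" by blast
  have s_pos: "s > 0" using s B.q_gt_1 by (cases s) auto
  have "\<exists>b\<in>carrier Q. h w \<otimes>\<^bsub>Q\<^esub> b = \<one>\<^bsub>Q\<^esub>"
  proof (rule Q.kummer_residue_extension_field[where k = "h ` OK" and q = B.q and e = e and y = "h \<eta>" and z = "h (u [^] s)"])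
    have "subring OK R0"
      using R0.ring_incl_imp_subring[of OK] OK_A0 B.OO.ring_axioms by (auto simp: R0_def)
    then show "subring (h ` OK) Q" by (rule h.img_is_subring)
    fix c assume "c \<in> h ` OK"
    then obtain x where x: "x \<in> OK" "c = h x" by blast
    have "x [^] B.q \<ominus> x \<in> mK"
      using B.valuation_ring_pow_q[OF x(1)] x OK_pow[of x] OK_K by (simp add: subring_nat_pow K_minus)
    then show "c [^]\<^bsub>Q\<^esub> B.q = c" using h_OK[of "x [^] B.q" x] x OK_pow h_pow OK_A0 by simp
    assume "c \<noteq> \<zero>\<^bsub>Q\<^esub>"
    then have "x \<notin> mK" using x h_zero OK_A0 mK_I by blast
    then obtain d where "d \<in> OK" "x \<otimes> d = \<one>" using OK_unit x by blast
    then show "\<exists>d\<in>h ` OK. c \<otimes>\<^bsub>Q\<^esub> d = \<one>\<^bsub>Q\<^esub>"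
      using h_mult[of x d] x OK_A0 h_one by auto
  next
    have "add_pow L (ring_char B.\<kk>) \<one> \<in> mK"
      using B.add_pow_one_mem_mm[of "ring_char B.\<kk>"] by (simp add: subring_add_pow)
    then have "add_pow Q (ring_char B.\<kk>) \<one>\<^bsub>Q\<^esub> = \<zero>\<^bsub>Q\<^esub>"
      using h_add_pow h_zero n_OK OK_A0 mK_I by metis
    then show "(a \<oplus>\<^bsub>Q\<^esub> b) [^]\<^bsub>Q\<^esub> B.q = a [^]\<^bsub>Q\<^esub> B.q \<oplus>\<^bsub>Q\<^esub> b [^]\<^bsub>Q\<^esub> B.q"
      if "a \<in> carrier Q" "b \<in> carrier Q" for a b
      unfolding f using Q.frobenius_add[OF B.residue_char_prime _ that] by simp
    show "B.q > 1" by (rule B.q_gt_1)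
    show "e > 0" by (rule e_pos)
    have "add_pow L e \<one> \<notin> mK"
      using B.add_pow_one_mem_mm[of e] e_coprime by (simp add: subring_add_pow)
    then show "add_pow Q e \<one>\<^bsub>Q\<^esub> \<noteq> \<zero>\<^bsub>Q\<^esub>"
      using h_add_pow h_zero n_OK OK_A0 OK_I by metis
    show "h \<eta> \<in> carrier Q" using \<eta>_A0 Q_carrier by blast
    \<comment> \<open>From q = 1 + es, the q-th power of \<eta> is u^s\<eta>; this is where the
      scalar z of the trace argument comes from.\<close>
    have "B.q = Suc (e * s)" using s B.q_gt_1 by linarith
    then have "\<eta> [^] B.q = \<eta> [^] Suc (e * s)" by (rule arg_cong)
    also have "\<dots> = u [^] s \<otimes> \<eta>" using \<eta> by (simp flip: nat_pow_pow)
    finally show "h \<eta> [^]\<^bsub>Q\<^esub> B.q = h (u [^] s) \<otimes>\<^bsub>Q\<^esub> h \<eta>"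
      using h_pow[OF \<eta>_A0] h_mult[of "u [^] s" \<eta>] \<eta>_A0 OK_A0[OF OK_pow[OF u_OK]] by metis
    show "h \<eta> [^]\<^bsub>Q\<^esub> e \<in> h ` OK" using h_pow[OF \<eta>_A0, of e] \<eta> u_OK by auto
    show "h (u [^] s) \<in> h ` OK" using OK_pow[OF u_OK] by blast
    have us: "h (u [^] s) [^]\<^bsub>Q\<^esub> n = h (u [^] (s * n))" for n :: nat
      using h_pow[of "u [^] s" n] OK_A0[OF OK_pow[OF u_OK, of s]] u K_carrier by (simp add: nat_pow_pow)
    have "u [^] (B.q - 1) \<ominus> \<one> \<in> mK"
      using B.unit_pow_q_minus_1[of u] u OK_pow[OF u_OK] OK_K subringE(3)[OF K_subring]
      by (simp add: subring_nat_pow K_minus)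
    then show "h (u [^] s) [^]\<^bsub>Q\<^esub> e = \<one>\<^bsub>Q\<^esub>"
      using us[of e] h_OK[of "u [^] (B.q - 1)" \<one>] OK_pow[OF u_OK] subringE(3)[OF OK_subring] h_one s
      by (simp add: mult.commute)
    \<comment> \<open>If u^(si) reduces to 1, then q - 1 = es divides si.\<close>
    show "e dvd i" if "h (u [^] s) [^]\<^bsub>Q\<^esub> i = \<one>\<^bsub>Q\<^esub>" for i :: nat
    proof -
      have 1: "u [^] (s * i) \<in> OK" "\<one> \<in> OK" using OK_pow[OF u_OK] subringE(3)[OF OK_subring] by auto
      have "h (u [^] (s * i)) = h \<one>" using that us[of i] h_one by simp
      then have "u [^] (s * i) \<ominus> \<one> \<in> I" using h_eq 1 OK_A0 by blast
      moreover have "u [^] (s * i) \<ominus> \<one> \<in> OK"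
        using 1 subringE(5,7)[OF OK_subring] by (simp add: minus_eq)
      ultimately have "B.q - 1 dvd s * i" using OK_I u_ord by blast
      then show "e dvd i" using s s_pos by (simp add: mult.commute)
    qed
    show "carrier Q = Q.simple_extension (h ` OK) (h \<eta>)"
      using h.image_simple_extension[of OK \<eta>] OK_A0 \<eta>_A0 Q_carrier
        simple_extension_consistent[OF A0_subring] by (auto simp: R0_def)
    show "h w \<in> carrier Q" using w Q_carrier by blast
    show "h w \<noteq> \<zero>\<^bsub>Q\<^esub>" using h_zero[OF w] False by (auto simp: I_def)
  qed
  then obtain b where b: "b \<in> A0" "h w \<otimes>\<^bsub>Q\<^esub> h b = \<one>\<^bsub>Q\<^esub>" using Q_carrier by auto
  then have "h \<one> = h (w \<otimes> b)" using h_mult w h_one by simp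
  then have "\<one> \<ominus> w \<otimes> b \<in> I" using h_eq A0E w b by simp
  then obtain c where c: "c \<in> A0" "\<one> \<ominus> w \<otimes> b = \<pi> \<otimes> c" by (auto simp: I_def)
  have "w \<otimes> b \<oplus> (\<one> \<ominus> w \<otimes> b) = \<one>" using w b A0_carrier by (simp add: minus_eq a_lcomm r_neg)
  then show ?thesis using b c by auto
qed auto

lemma A_decompose:
  assumes "x \<in> A" obtains x1 x0 where "x1 \<in> A" "x0 \<in> A0" "x = x1 \<otimes> \<omega> \<oplus> x0"
  using assms
proof (cases rule: simple_extension.cases)
  case zero
  then show thesis using that[of \<zero> \<zero>] subringE(2)[OF A_subring] subringE(2)[OF A0_subring] \<omega> by simp
qed (use that in blast)

text \<open>Modulo \<omega> an element of \<open>A\<close> agrees with its constant term in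
  \<open>A0\<close>, and \<pi> is a multiple of \<omega>, so the dichotomy modulo \<pi> is
  inherited.\<close>

lemma A_mod_\<omega>:
  assumes x: "x \<in> A"
  shows "(\<exists>a\<in>A. x = \<omega> \<otimes> a) \<or> (\<exists>a\<in>A. \<exists>b\<in>A. x \<otimes> a \<oplus> \<omega> \<otimes> b = \<one>)"
proof -
  obtain x1 x0 where d: "x1 \<in> A" "x0 \<in> A0" "x = x1 \<otimes> \<omega> \<oplus> x0" by (rule A_decompose[OF x])
  note AE = subringE[OF A_subring]
  let ?r = "\<omega> [^] (e - 1)"
  have r: "?r \<in> A" by (rule subring_pow_closed[OF A_subring \<omega>_A])
  have c: "x1 \<in> carrier L" "x0 \<in> carrier L" "?r \<in> carrier L" "\<omega> \<in> carrier L"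
    using d A_carrier A0_A r \<omega> by auto
  from A0_mod_\<pi>[OF d(2)] show ?thesis
  proof (elim disjE bexE)
    fix a assume a: "a \<in> A0" "x0 = \<pi> \<otimes> a"
    then have "x = \<omega> \<otimes> (x1 \<oplus> ?r \<otimes> a)"
      using d c A0_carrier[of a] \<pi>_\<omega> by (simp add: r_distr m_assoc m_comm[of x1])
    then show ?thesis using AE(6,7) d r a A0_A by blast
  next
    fix a b assume a: "a \<in> A0" "b \<in> A0" "x0 \<otimes> a \<oplus> \<pi> \<otimes> b = \<one>"
    have "x \<otimes> a \<oplus> \<omega> \<otimes> (?r \<otimes> b \<oplus> \<ominus> (x1 \<otimes> a)) = x0 \<otimes> a \<oplus> (\<omega> \<otimes> ?r) \<otimes> b"
      unfolding d(3) using c A0_carrier[OF a(1)] A0_carrier[OF a(2)]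
      by (algebra)
    then have "x \<otimes> a \<oplus> \<omega> \<otimes> (?r \<otimes> b \<oplus> \<ominus> (x1 \<otimes> a)) = \<one>" using a \<pi>_\<omega> by simp
    moreover have "?r \<otimes> b \<oplus> \<ominus> (x1 \<otimes> a) \<in> A"
      by (intro AE(5,6,7) d(1) r A0_A a)
    ultimately show ?thesis using A0_A[OF a(1)] by blast
  qed
qed

text \<open>If x were invertible modulo \<omega>, so would be x^d; as x^d lies in \<omega>A, this
  would make \<omega> a unit.\<close>

lemma A_mod_\<omega>_reduced:
  assumes x: "x \<in> A" and xd: "x [^] (d::nat) = \<omega> \<otimes> b" "b \<in> A"
  shows "\<exists>a\<in>A. x = \<omega> \<otimes> a"
proof (rule ccontr)
  assume "\<not> ?thesis"
  then obtain a c where a: "a \<in> A" "c \<in> A" "x \<otimes> a \<oplus> \<omega> \<otimes> c = \<one>" using A_mod_\<omega>[OF x] by blast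
  note AE = subringE[OF A_subring]
  have "\<exists>a'\<in>A. \<exists>c'\<in>A. x [^] n \<otimes> a' \<oplus> \<omega> \<otimes> c' = \<one>" for n :: nat
  proof (induction n)
    case 0
    show ?case using AE(2,3) \<omega> by (intro bexI[of _ \<one>] bexI[of _ \<zero>]) auto
  next
    case (Suc n)
    then obtain a' c' where a': "a' \<in> A" "c' \<in> A" "x [^] n \<otimes> a' \<oplus> \<omega> \<otimes> c' = \<one>" by blast
    let ?c = "x [^] n \<otimes> (a' \<otimes> c) \<oplus> c'"
    have "x [^] Suc n \<otimes> (a \<otimes> a') \<oplus> \<omega> \<otimes> ?c
      = (x [^] n \<otimes> a') \<otimes> (x \<otimes> a \<oplus> \<omega> \<otimes> c) \<oplus> \<omega> \<otimes> c'"
    proof -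
      have "(P \<otimes> x) \<otimes> (a \<otimes> a') \<oplus> \<omega> \<otimes> (P \<otimes> (a' \<otimes> c) \<oplus> c')
        = (P \<otimes> a') \<otimes> (x \<otimes> a \<oplus> \<omega> \<otimes> c) \<oplus> \<omega> \<otimes> c'" if "P \<in> carrier L" for P
        using that A_carrier[OF x] A_carrier[OF a(1)] A_carrier[OF a(2)] A_carrier[OF a'(1)]
          A_carrier[OF a'(2)] \<omega>(1) by algebra
      then show ?thesis using A_carrier[OF x] by simp
    qed
    also have "\<dots> = \<one>" using a a' A_carrier x by simp
    finally have "x [^] Suc n \<otimes> (a \<otimes> a') \<oplus> \<omega> \<otimes> ?c = \<one>" .
    moreover have "a \<otimes> a' \<in> A" "?c \<in> A"
      by (intro AE(6,7) a a' subring_pow_closed[OF A_subring x])+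
    ultimately show ?case by blast
  qed
  then obtain a' c' where a': "a' \<in> A" "c' \<in> A" "x [^] d \<otimes> a' \<oplus> \<omega> \<otimes> c' = \<one>" by blast
  then have "\<omega> \<otimes> (b \<otimes> a' \<oplus> c') = \<one>" using xd A_carrier \<omega> by (simp add: r_distr m_assoc)
  moreover have "b \<otimes> a' \<oplus> c' \<in> A" by (intro AE(6,7) a' xd)
  ultimately show False using \<omega>_not_unit by blast
qed

section \<open>The tower of fields and the denominators of its elements\<close>

lemma K_K0: "x \<in> K \<Longrightarrow> x \<in> K0"
  using simple_extension_incl[OF subset \<eta>(1)] by auto
lemma K0_subfield: "subfield K0 L"
  using simple_extension_is_subfield[OF subfield_axioms \<eta>(1)] algebraic_extension[OF \<eta>(1)] by simp
lemma K0_carrier: "x \<in> K0 \<Longrightarrow> x \<in> carrier L" using subfieldE(3)[OF K0_subfield] by auto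
lemma K0_subring: "subring K0 L" by (rule subfieldE(1)[OF K0_subfield])
lemma M_subfield: "subfield M L"
proof -
  have "K \<subseteq> K0" using K_K0 by blast
  then have "(algebraic over K0) \<omega>" using algebraic_mono algebraic_extension[OF \<omega>(1)] by blast
  then show ?thesis using simple_extension_is_subfield[OF K0_subfield \<omega>(1)] by simp
qed
lemma M_subring: "subring M L" by (rule subfieldE(1)[OF M_subfield])
lemma M_carrier: "x \<in> M \<Longrightarrow> x \<in> carrier L" using subfieldE(3)[OF M_subfield] by auto
lemma K0_M: "x \<in> K0 \<Longrightarrow> x \<in> M"
  using simple_extension_incl[OF subringE(1)[OF K0_subring] \<omega>(1)] by auto
lemma \<eta>_K0: "\<eta> \<in> K0" by (rule simple_extension_mem[OF K_subring \<eta>(1)])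
lemma \<omega>_M: "\<omega> \<in> M" by (rule simple_extension_mem[OF K0_subring \<omega>(1)])
lemma A0_K0: "x \<in> A0 \<Longrightarrow> x \<in> K0"
  using subsetD[OF mono_simple_extension[of OK K \<eta>]] OK_K by auto
lemma A_M: "x \<in> A \<Longrightarrow> x \<in> M"
  using subsetD[OF mono_simple_extension[of A0 K0 \<omega>]] A0_K0 by auto

text \<open>This is S[1/t] inside L. Being a ring, it contains a whole simple extension as soon as
  it contains the base and the generator.\<close>

lemma denominators_subring:
  assumes S: "subring S L" and t: "t \<in> S"
  shows "subring {x \<in> carrier L. \<exists>m::nat. x \<otimes> t [^] m \<in> S} L"
proof (rule subringI)
  note SE = subringE[OF S]
  have tc: "t \<in> carrier L" using SE(1) t by blast
  have tp: "t [^] (m::nat) \<in> S" for m by (rule subring_pow_closed[OF S t])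
  let ?D = "{x \<in> carrier L. \<exists>m::nat. x \<otimes> t [^] m \<in> S}"
  show "?D \<subseteq> carrier L" by blast
  show "\<one> \<in> ?D" using SE(3) by (auto intro!: exI[of _ 0])
  show "\<ominus> h \<in> ?D" if "h \<in> ?D" for h
    using that SE(5) tc by (auto simp: l_minus)
  fix x y assume "x \<in> ?D" "y \<in> ?D"
  then obtain m n :: nat where x: "x \<in> carrier L" "x \<otimes> t [^] m \<in> S" and y: "y \<in> carrier L" "y \<otimes> t [^] n \<in> S"
    by auto
  have e: "t [^] (m + n) = t [^] m \<otimes> t [^] n" using tc by (simp add: nat_pow_mult)
  have "(x \<otimes> y) \<otimes> (P \<otimes> Q) = (x \<otimes> P) \<otimes> (y \<otimes> Q)" "(x \<oplus> y) \<otimes> (P \<otimes> Q) = (x \<otimes> P) \<otimes> Q \<oplus> (y \<otimes> Q) \<otimes> P"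
    if "P \<in> carrier L" "Q \<in> carrier L" for P Q
    using that x(1) y(1) by algebra+
  then have "(x \<otimes> y) \<otimes> t [^] (m + n) = (x \<otimes> t [^] m) \<otimes> (y \<otimes> t [^] n)"
    "(x \<oplus> y) \<otimes> t [^] (m + n) = (x \<otimes> t [^] m) \<otimes> t [^] n \<oplus> (y \<otimes> t [^] n) \<otimes> t [^] m"
    using tc e by simp_all
  then have "(x \<otimes> y) \<otimes> t [^] (m + n) \<in> S" "(x \<oplus> y) \<otimes> t [^] (m + n) \<in> S"
    using x y tp SE(6,7) by metis+
  then show "x \<otimes> y \<in> ?D" "x \<oplus> y \<in> ?D" using x y by blast+
qed

lemma K_denominator: "x \<in> K \<Longrightarrow> \<exists>m::nat. x \<otimes> \<pi> [^] m \<in> OK"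
  using B.valuation_ring_denominator[of x \<pi>] \<pi> by (simp add: subring_nat_pow)

lemma K0_denominator:
  assumes "x \<in> K0" shows "\<exists>m::nat. x \<otimes> \<pi> [^] m \<in> A0"
proof -
  let ?D = "{x \<in> carrier L. \<exists>m::nat. x \<otimes> \<pi> [^] m \<in> A0}"
  have "K0 \<subseteq> ?D"
  proof (rule simple_extension_subring_incl)
    show "subring ?D L" by (rule denominators_subring[OF A0_subring OK_A0[OF \<pi>_OK]])
    show "K \<subseteq> ?D" using K_denominator OK_A0 K_carrier by blast
    show "\<eta> \<in> ?D" using \<eta> \<eta>_A0 by (auto intro!: exI[of _ 0])
  qed
  then show ?thesis using assms by blast
qed

lemma M_denominator:
  assumes "x \<in> M" shows "\<exists>m::nat. x \<otimes> \<omega> [^] m \<in> A"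
proof -
  let ?D = "{x \<in> carrier L. \<exists>m::nat. x \<otimes> \<omega> [^] m \<in> A}"
  have "M \<subseteq> ?D"
  proof (rule simple_extension_subring_incl)
    show "subring ?D L" by (rule denominators_subring[OF A_subring \<omega>_A])
    show "K0 \<subseteq> ?D"
    proof
      fix x assume x: "x \<in> K0"
      then obtain m :: nat where "x \<otimes> \<pi> [^] m \<in> A0" using K0_denominator by blast
      moreover have "\<pi> [^] m = \<omega> [^] (e * m)" using \<omega> by (simp flip: nat_pow_pow)
      ultimately show "x \<in> ?D" using K0_carrier[OF x] A0_A by auto
    qed
    show "\<omega> \<in> ?D" using \<omega> \<omega>_A by (auto intro!: exI[of _ 0])
  qed
  then show ?thesis using assms by blast
qed

lemma integral_closure_eq: "integral_closure L OK M = A"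
proof
  show "A \<subseteq> integral_closure L OK M"
    unfolding integral_closure_def using A_M A_integral by blast
  show "integral_closure L OK M \<subseteq> A"
  proof
    fix x assume "x \<in> integral_closure L OK M"
    then obtain p where x: "x \<in> M" and p: "p \<noteq> []" "set p \<subseteq> OK" "hd p = \<one>" "eval p x = \<zero>"
      unfolding integral_closure_def by blast
    have xc: "x \<in> carrier L" using M_carrier x by simp
    \<comment> \<open>The denominator exponent is taken minimal, so that cancelling one \<omega>
      contradicts a positive value.\<close>
    define m where "m = (LEAST m::nat. x \<otimes> \<omega> [^] m \<in> A)"
    have m: "x \<otimes> \<omega> [^] m \<in> A" unfolding m_def using M_denominator[OF x] by (rule LeastI_ex)
    show "x \<in> A"
    proof (cases m)
      case 0
      then show ?thesis using m xc by simp
    next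
      case (Suc l)
      obtain d :: nat and b where "b \<in> A" "(x \<otimes> \<omega> [^] m) [^] d = \<omega> \<otimes> b"
        using integral_fraction[OF A_subring _ xc \<omega>_A m _ p] OK_A0 A0_A Suc by blast
      then obtain a where a: "a \<in> A" "x \<otimes> \<omega> [^] m = \<omega> \<otimes> a"
        using A_mod_\<omega>_reduced[OF m] by blast
      have "\<omega> \<otimes> (x \<otimes> \<omega> [^] l) = \<omega> \<otimes> a"
        using a Suc xc \<omega> by (simp add: m_ac)
      then have "x \<otimes> \<omega> [^] l = a"
        using m_lcancel[OF \<omega>_nonzero \<omega>(1), of "x \<otimes> \<omega> [^] l" a] xc \<omega> A_carrier[OF a(1)] by simp
      then have "m \<le> l" unfolding m_def using a by (intro Least_le) simp
      then show ?thesis using Suc by simp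
    qed
  qed
qed

lemma extension_integers_eq: "extension_integers L M K v = L\<lparr>carrier := A\<rparr>"
  by (simp add: extension_integers_def integral_closure_eq)

lemma extension_ideal_iff:
  "x \<in> extension_ideal L M K v \<longleftrightarrow> x \<in> A \<and> \<not> (\<exists>y\<in>A. x \<otimes> y = \<one>)"
proof -
  have "x \<otimes> y = y \<otimes> x" if "x \<in> A" "y \<in> A" for x y
    using that A_carrier m_comm by blast
  then show ?thesis
    unfolding extension_ideal_def extension_integers_eq Units_def by force
qed

section \<open>Radicals of elements of K\<close>

text \<open>K already contains e of the at most e roots of X^e - 1 in L.\<close>

lemma roots_of_unity_K:
  assumes "z \<in> carrier L" "z [^] e = \<one>"
  shows "z \<in> K" "z \<noteq> \<zero>" "v z = 0" "z \<in> OK"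
proof -
  have "roots_of_unity (L\<lparr>carrier := K\<rparr>) e = {z \<in> carrier L. z [^] e = \<one>}"
  proof (rule card_seteq)
    show "finite {z \<in> carrier L. z [^] e = \<one>}" using card_power_roots[OF _ e_pos] by simp
    show "roots_of_unity (L\<lparr>carrier := K\<rparr>) e \<subseteq> {z \<in> carrier L. z [^] e = \<one>}"
      using K_carrier by (auto simp: roots_of_unity_def subring_nat_pow)
    show "card {z \<in> carrier L. z [^] e = \<one>} \<le> card (roots_of_unity (L\<lparr>carrier := K\<rparr>) e)"
      using card_power_roots[OF _ e_pos] card_roots by simp
  qed
  then have "z \<in> roots_of_unity (L\<lparr>carrier := K\<rparr>) e" using assms by simp
  then have z: "z \<in> K" by (auto simp: roots_of_unity_def)
  note r = B.root_of_unity_valuation[of z e] 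
  show "z \<in> K" "z \<noteq> \<zero>" "v z = 0" "z \<in> OK"
    using r z assms e_pos by (auto simp: subring_nat_pow)
qed

text \<open>The decomposition of y^e gives a product of radicals with the same e-th power as y; the
  quotient is a root of 1, which lies in K and is absorbed into t.\<close>

lemma radical_decomposition:
  assumes y: "y \<in> carrier L" "y [^] e \<in> K - {\<zero>}"
  obtains t and i j :: nat where "t \<in> K - {\<zero>}" "int j = v (y [^] e) mod int e"
    "y = \<omega> [^] j \<otimes> \<eta> [^] i \<otimes> t"
proof -
  have coprime: "add_pow (L\<lparr>carrier := K\<rparr>) e \<one>\<^bsub>L\<lparr>carrier := K\<rparr>\<^esub> \<notin> mK"
    using B.add_pow_one_mem_mm[of e] e_coprime by simp
  obtain t and i j :: nat where t: "t \<in> K - {\<zero>}" "int j = v (y [^] e) mod int e"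
    "y [^] e = \<pi> [^] j \<otimes> u [^] i \<otimes> t [^] e"
  proof (rule B.unit_decomposition[OF coprime e_pos, of \<pi> u "y [^] e"])
    show "\<exists>i::nat. x \<ominus>\<^bsub>L\<lparr>carrier := K\<rparr>\<^esub> u [^]\<^bsub>L\<lparr>carrier := K\<rparr>\<^esub> i \<in> mK"
      if "x \<in> carrier (L\<lparr>carrier := K\<rparr>) - {\<zero>\<^bsub>L\<lparr>carrier := K\<rparr>\<^esub>}" "v x = 0" for x
      using u_gen[of x] that u subring_pow_closed[OF K_subring] by (simp add: K_minus subring_nat_pow)
  qed (use \<pi> u y in \<open>auto simp: subring_nat_pow\<close>)
  define y' where "y' = \<omega> [^] j \<otimes> \<eta> [^] i \<otimes> t"
  have tc: "t \<in> carrier L" using t K_carrier by auto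
  have y'c: "y' \<in> carrier L" using \<omega> \<eta> tc by (simp add: y'_def)
  have y'e: "y' [^] e = y [^] e"
    using \<omega> \<eta> tc t(3) by (simp add: y'_def nat_pow_distrib nat_pow_pow mult.commute[of _ e] flip: nat_pow_pow[of _ e])
  have "y' \<noteq> \<zero>" using y'e y e_pos by (auto simp: nat_pow_zero)
  then have inv: "inv y' \<in> carrier L" "y' \<otimes> inv y' = \<one>" "inv y' \<otimes> y' = \<one>"
    using field_Units y'c by auto
  define z where "z = y \<otimes> inv y'"
  have zy: "y = y' \<otimes> z" using inv y y'c by (simp add: z_def m_lcomm[of y'])
  have zc: "z \<in> carrier L" using inv y by (simp add: z_def)
  have "z [^] e = y' [^] e \<otimes> inv y' [^] e" using inv y y'e by (simp add: z_def nat_pow_distrib)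
  also have "\<dots> = (y' \<otimes> inv y') [^] e" using y'c inv(1) by (simp add: nat_pow_distrib)
  also have "\<dots> = \<one>" using inv by simp
  finally have z: "z \<in> K" "z \<noteq> \<zero>" using roots_of_unity_K zc by auto
  have "y = \<omega> [^] j \<otimes> \<eta> [^] i \<otimes> (t \<otimes> z)"
    unfolding zy y'_def using \<omega> \<eta> tc zc by (simp add: m_assoc)
  moreover have "t \<otimes> z \<in> K - {\<zero>}" using z t subringE(6)[OF K_subring] tc zc by (auto simp: integral_iff)
  ultimately show thesis using that t(2) by blast
qed

lemma kummer_extension_eq: "kummer_extension L K e = M"
proof
  let ?Y = "{y \<in> carrier L. y [^] e \<in> K - {\<zero>}}"
  have sub: "K \<union> ?Y \<subseteq> carrier L" using K_carrier by blast
  have "y \<in> M" if y: "y \<in> ?Y" for y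
  proof -
    obtain t and i j :: nat where "t \<in> K - {\<zero>}" "y = \<omega> [^] j \<otimes> \<eta> [^] i \<otimes> t"
      by (rule radical_decomposition[of y]) (use y in auto)
    moreover have "\<omega> [^] j \<in> M" "\<eta> [^] i \<in> M"
      by (intro subring_pow_closed[OF M_subring] \<omega>_M K0_M \<eta>_K0)+
    ultimately show ?thesis
      using subringE(6)[OF M_subring] K0_M[OF K_K0, of t] by auto
  qed
  then have "K \<union> ?Y \<subseteq> M" using K_K0 K0_M by blast
  then show "kummer_extension L K e \<subseteq> M"
    unfolding kummer_extension_def by (rule generate_field_min_subfield1[OF sub M_subfield])
  let ?G = "kummer_extension L K e"
  have G: "subring ?G L"
    unfolding kummer_extension_def by (rule subfieldE(1)[OF generate_field_is_subfield[OF sub]])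
  have "K \<union> ?Y \<subseteq> ?G" unfolding kummer_extension_def by (auto intro: generate_field.incl)
  then have "K \<subseteq> ?G" "\<eta> \<in> ?G" "\<omega> \<in> ?G" using \<eta> \<omega> u \<pi> by auto
  then show "M \<subseteq> ?G"
    by (intro simple_extension_subring_incl[OF G])
qed

end

section \<open>Automorphisms and inertia\<close>

lemma (in ring) eval_in_subring:
  assumes "subring S R" "set p \<subseteq> S" "x \<in> S" shows "eval p x \<in> S"
  using assms(2)
  by (induction p) (use assms subringE[OF assms(1)] subring_pow_closed[OF assms(1)] in auto)

lemma (in domain) pow_nonzero: "\<lbrakk>a \<in> carrier R; a \<noteq> \<zero>\<rbrakk> \<Longrightarrow> a [^] (n::nat) \<noteq> \<zero>"
  by (induction n) (auto simp: integral_iff)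

section \<open>Linear independence of the powers of \<omega> over K(\<eta>)\<close>

context kummer_generators
begin

text \<open>Lists start at the top coefficient, so \<open>d\<close> is the constant term. It lies in
  \<omega>A, hence in \<pi>A0: otherwise it would be invertible modulo \<pi> and \<omega> would be a
  unit. With n < e further coefficients, \<pi>A lies in \<omega>^(n+1)A, so after removing d one
  \<omega> cancels and the shorter list is in the same situation.\<close>

lemma A0_coefficients_divisible:
  assumes "set r \<subseteq> A0" "length r \<le> e" "eval r \<omega> = \<omega> [^] length r \<otimes> b" "b \<in> A" "c \<in> set r"
  shows "\<exists>a\<in>A0. c = \<pi> \<otimes> a"
  using assms
proof (induction r arbitrary: b c rule: rev_induct)
  case (snoc d r)
  note AE = subringE[OF A_subring]
  let ?n = "length r"
  define E where "E = eval r \<omega>"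
  have r: "set r \<subseteq> A0" "set r \<subseteq> A" "d \<in> A0" "?n < e" using snoc.prems A0_A by auto
  have E: "E \<in> A" unfolding E_def by (rule eval_in_subring[OF A_subring r(2) \<omega>_A])
  have rc: "set r \<subseteq> carrier L" using r A0_carrier by blast
  have c: "d \<in> carrier L" "b \<in> carrier L" "E \<in> carrier L" using r snoc.prems E A_carrier A0_A by auto
  have pw: "\<omega> [^] n \<in> A" for n :: nat by (rule subring_pow_closed[OF A_subring \<omega>_A])
  have "E \<otimes> \<omega> \<oplus> d = \<omega> [^] Suc ?n \<otimes> b"
    using snoc.prems(3) eval_append_aux[OF rc c(1) \<omega>(1)] by (simp add: E_def)
  moreover have "d = \<omega> \<otimes> (W \<otimes> b \<ominus> E) \<and> E \<otimes> \<omega> = \<omega> \<otimes> (W \<otimes> b) \<ominus> d"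
    if "W \<in> carrier L" "E \<otimes> \<omega> \<oplus> d = W \<otimes> \<omega> \<otimes> b" for W
  proof
    have 1: "d = (E \<otimes> \<omega> \<oplus> d) \<ominus> E \<otimes> \<omega>" using c \<omega>(1) by algebra
    have 2: "W \<otimes> \<omega> \<otimes> b \<ominus> E \<otimes> \<omega> = \<omega> \<otimes> (W \<otimes> b \<ominus> E)" using that(1) c \<omega>(1) by algebra
    show "d = \<omega> \<otimes> (W \<otimes> b \<ominus> E)" using 1 2 that(2) by simp
    have 3: "E \<otimes> \<omega> = (E \<otimes> \<omega> \<oplus> d) \<ominus> d" using c \<omega>(1) by algebra
    have 4: "W \<otimes> \<omega> \<otimes> b = \<omega> \<otimes> (W \<otimes> b)" using that(1) c \<omega>(1) by algebra
    show "E \<otimes> \<omega> = \<omega> \<otimes> (W \<otimes> b) \<ominus> d" using 3 4 that(2) by simp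
  qed
  ultimately have d: "d = \<omega> \<otimes> (\<omega> [^] ?n \<otimes> b \<ominus> E)" and E\<omega>: "E \<otimes> \<omega> = \<omega> \<otimes> (\<omega> [^] ?n \<otimes> b) \<ominus> d"
    using \<omega>(1) by (metis nat_pow_Suc nat_pow_closed)+
  have "\<exists>a\<in>A0. d = \<pi> \<otimes> a"
  proof (rule ccontr)
    assume "\<not> ?thesis"
    then obtain a a' where a: "a \<in> A0" "a' \<in> A0" "d \<otimes> a \<oplus> \<pi> \<otimes> a' = \<one>"
      using A0_mod_\<pi>[OF r(3)] by blast
    let ?D = "\<omega> [^] ?n \<otimes> b \<ominus> E"
    have D: "?D \<in> A" unfolding minus_eq by (intro AE(5,6,7) pw snoc.prems E)
    have "\<omega> \<otimes> (D \<otimes> a \<oplus> W \<otimes> a') = (\<omega> \<otimes> D) \<otimes> a \<oplus> (\<omega> \<otimes> W) \<otimes> a'"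
      if "D \<in> carrier L" "W \<in> carrier L" for D W
      using that A0_carrier[OF a(1)] A0_carrier[OF a(2)] \<omega>(1) by algebra
    from this[of ?D "\<omega> [^] (e - 1)"]
    have "\<omega> \<otimes> (?D \<otimes> a \<oplus> \<omega> [^] (e - 1) \<otimes> a') = d \<otimes> a \<oplus> \<pi> \<otimes> a'"
      unfolding d[symmetric] \<pi>_\<omega>[symmetric] using A_carrier[OF D] \<omega>(1) by simp
    moreover have "?D \<otimes> a \<oplus> \<omega> [^] (e - 1) \<otimes> a' \<in> A" by (intro AE(6,7) D pw A0_A a)
    ultimately show False using \<omega>_not_unit a(3) by simp
  qed
  then obtain a where a: "a \<in> A0" "d = \<pi> \<otimes> a" by blast
  \<comment> \<open>As \<pi> = \<omega>^(n+1)\<omega>^(e-n-1), removing d = \<pi>a from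
    \<omega>^(n+1)b amounts to this change of b.\<close>
  define b' where "b' = b \<ominus> \<omega> [^] (e - Suc ?n) \<otimes> a"
  have b': "b' \<in> A" unfolding b'_def minus_eq by (intro AE(5,6,7) pw snoc.prems A0_A a)
  have "\<pi> = \<omega> [^] (Suc ?n + (e - Suc ?n))" using \<omega>(2) r(4) by simp
  also have "\<dots> = \<omega> \<otimes> \<omega> [^] ?n \<otimes> \<omega> [^] (e - Suc ?n)"
    using \<omega>(1) by (simp only: nat_pow_mult[symmetric] nat_pow_Suc2)
  finally have \<pi>': "\<pi> = \<omega> \<otimes> \<omega> [^] ?n \<otimes> \<omega> [^] (e - Suc ?n)" .
  have "\<omega> \<otimes> (W \<otimes> b) \<ominus> (\<omega> \<otimes> W \<otimes> V) \<otimes> a = \<omega> \<otimes> (W \<otimes> (b \<ominus> V \<otimes> a))"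
    if "W \<in> carrier L" "V \<in> carrier L" for W V
    using that c(2) A0_carrier[OF a(1)] \<omega>(1) by algebra
  from this[of "\<omega> [^] ?n" "\<omega> [^] (e - Suc ?n)"]
  have "\<omega> \<otimes> (\<omega> [^] ?n \<otimes> b) \<ominus> d = \<omega> \<otimes> (\<omega> [^] ?n \<otimes> b')"
    unfolding a(2) b'_def \<pi>'[symmetric] using \<omega>(1) by simp
  then have "\<omega> \<otimes> E = \<omega> \<otimes> (\<omega> [^] ?n \<otimes> b')"
    using E\<omega> m_comm[OF c(3) \<omega>(1)] by simp
  then have E': "E = \<omega> [^] ?n \<otimes> b'"
    using m_lcancel[OF \<omega>_nonzero \<omega>(1), of E] c A_carrier[OF b'] \<omega>(1) by simp
  show ?case
  proof (cases "c = d")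
    case False
    then show ?thesis using snoc.IH[OF r(1) _ E'[unfolded E_def] b', of c] snoc.prems by simp
  qed (use a in blast)
qed simp

text \<open>A relation with value zero is the divisibility lemma with b = 0; since \<pi> cancels,
  the quotients of the coefficients by \<pi> satisfy the same relation.\<close>

lemma A0_coefficients_infinitely_divisible:
  assumes "set r \<subseteq> A0" "length r \<le> e" "eval r \<omega> = \<zero>" "c \<in> set r"
  shows "\<exists>a\<in>A0. c = \<pi> [^] (n::nat) \<otimes> a"
  using assms
proof (induction n arbitrary: r c)
  case 0
  then show ?case using A0_carrier by (intro bexI[of _ c]) auto
next
  case (Suc n)
  have "\<exists>a. a \<in> A0 \<and> c = \<pi> \<otimes> a" if "c \<in> set r" for c
    using A0_coefficients_divisible[OF Suc.prems(1,2) _ subringE(2)[OF A_subring] that] Suc.prems \<omega>(1) by auto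
  then obtain f where f: "\<And>c. c \<in> set r \<Longrightarrow> f c \<in> A0 \<and> c = \<pi> \<otimes> f c" by metis
  let ?r = "map f r"
  have c: "set ?r \<subseteq> carrier L" using f A0_carrier by auto
  have "r = map ((\<otimes>) \<pi>) ?r" using f by (auto simp: map_idI[symmetric])
  then have "eval r \<omega> = \<pi> \<otimes> eval ?r \<omega>" using eval_scale[OF c \<pi>_carrier \<omega>(1)] by simp
  then have "\<pi> \<otimes> eval ?r \<omega> = \<zero>" using Suc.prems(3) by metis
  then have "eval ?r \<omega> = \<zero>"
    using integral[OF _ \<pi>_carrier eval_in_carrier[OF c \<omega>(1)]] \<pi>(2) by blast
  then obtain a where a: "a \<in> A0" "f c = \<pi> [^] n \<otimes> a"
    using Suc.IH[of ?r "f c"] f Suc.prems by auto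
  have "c = \<pi> \<otimes> (\<pi> [^] n \<otimes> a)" using f Suc.prems(4) a(2) by metis
  also have "\<dots> = \<pi> [^] Suc n \<otimes> a" using a A0_carrier \<pi>_carrier by (simp add: m_ac)
  finally show ?case using a by blast
qed

text \<open>A nonzero d would have an inverse with denominator \<pi>^m; writing d as a multiple of
  \<pi>^(m+1) then makes \<pi> invertible.\<close>

lemma infinitely_divisible_zero:
  assumes d: "d \<in> K0" "\<And>n::nat. \<exists>a\<in>A0. d = \<pi> [^] n \<otimes> a"
  shows "d = \<zero>"
proof (rule ccontr)
  assume "d \<noteq> \<zero>"
  then have i: "inv d \<in> K0" "d \<otimes> inv d = \<one>" using subfield_m_inv[OF K0_subfield, of d] d by auto
  obtain m :: nat where m: "inv d \<otimes> \<pi> [^] m \<in> A0" using K0_denominator[OF i(1)] by blast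
  obtain a where a: "a \<in> A0" "d = \<pi> [^] Suc m \<otimes> a" using d(2) by blast
  let ?g = "inv d \<otimes> \<pi> [^] m"
  have c: "d \<in> carrier L" "inv d \<in> carrier L" "a \<in> carrier L" "?g \<in> carrier L" "\<pi> [^] m \<in> carrier L"
    using d i a m K0_carrier A0_carrier \<pi>_carrier by auto
  have "\<pi> [^] m \<otimes> \<one> = d \<otimes> ?g" using c i by (simp flip: m_assoc)
  also have "\<dots> = \<pi> [^] Suc m \<otimes> a \<otimes> ?g" using a(2) by metis
  also have "\<dots> = \<pi> [^] m \<otimes> (\<pi> \<otimes> (a \<otimes> ?g))" using c(3-5) \<pi>_carrier by (simp add: m_assoc)
  finally have "\<one> = \<pi> \<otimes> (a \<otimes> ?g)"
    using m_lcancel[of "\<pi> [^] m" \<one> "\<pi> \<otimes> (a \<otimes> ?g)"] c \<pi>_carrier \<pi>(2)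
      pow_nonzero[OF \<pi>_carrier \<pi>(2), of m] by simp
  then show False using inv_\<pi>_not_in_A[of "a \<otimes> ?g"] subringE(6)[OF A_subring] A0_A a m by metis
qed

text \<open>A common power of \<pi> moves the coefficients into \<open>A0\<close>, where infinite
  divisibility kills them. In other words, X^e - \<pi> is irreducible over K(\<eta>).\<close>

lemma \<omega>_powers_independent:
  assumes r: "set r \<subseteq> K0" "length r \<le> e" "eval r \<omega> = \<zero>"
  shows "set r \<subseteq> {\<zero>}"
proof
  fix c assume c: "c \<in> set r"
  have pA: "\<pi> [^] n \<in> A0" for n :: nat by (rule subring_pow_closed[OF A0_subring OK_A0[OF \<pi>_OK]])
  have "\<exists>m::nat. \<forall>c\<in>set s. \<pi> [^] m \<otimes> c \<in> A0" if "set s \<subseteq> K0" for s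
    using that
  proof (induction s)
    case (Cons d s)
    then obtain m :: nat where m: "\<forall>c\<in>set s. \<pi> [^] m \<otimes> c \<in> A0" by auto
    obtain n :: nat where n: "d \<otimes> \<pi> [^] n \<in> A0" using K0_denominator[of d] Cons.prems by auto
    have "\<pi> [^] (m + n) \<otimes> c \<in> A0" if "c \<in> set (d # s)" for c
    proof (cases "c = d")
      case True
      then have "\<pi> [^] (m + n) \<otimes> c = \<pi> [^] m \<otimes> (d \<otimes> \<pi> [^] n)"
        using Cons.prems K0_carrier \<pi>_carrier by (simp add: m_ac flip: nat_pow_mult)
      then show ?thesis using n pA subringE(6)[OF A0_subring] by simp
    next
      case False
      then have "\<pi> [^] (m + n) \<otimes> c = \<pi> [^] n \<otimes> (\<pi> [^] m \<otimes> c)"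
        using Cons.prems K0_carrier \<pi>_carrier that by (auto simp add: m_ac subset_iff simp flip: nat_pow_mult)
      then show ?thesis using m pA subringE(6)[OF A0_subring] that False by simp
    qed
    then show ?case by blast
  qed simp
  then obtain m :: nat where m: "\<And>c. c \<in> set r \<Longrightarrow> \<pi> [^] m \<otimes> c \<in> A0" using r(1) by blast
  let ?r = "map ((\<otimes>) (\<pi> [^] m)) r"
  have rc: "set r \<subseteq> carrier L" using r K0_carrier by blast
  have "eval ?r \<omega> = \<zero>" using eval_scale[OF rc _ \<omega>(1), of "\<pi> [^] m"] r(3) \<pi>_carrier by simp
  then have "\<exists>a\<in>A0. \<pi> [^] m \<otimes> c = \<pi> [^] n \<otimes> a" for n :: nat
    using A0_coefficients_infinitely_divisible[of ?r "\<pi> [^] m \<otimes> c" n] m r(2) c by auto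
  then have "\<pi> [^] m \<otimes> c = \<zero>" using infinitely_divisible_zero A0_K0 m[OF c] by blast
  moreover have "\<pi> [^] m \<noteq> \<zero>" using \<pi> \<pi>_carrier by (simp add: pow_nonzero)
  ultimately show "c \<in> {\<zero>}" using c rc \<pi>_carrier by (auto simp: integral_iff)
qed

text \<open>Divide p by X^e - \<pi>: the remainder vanishes at \<omega>, hence is zero by
  independence, so p vanishes at every e-th root of \<pi>.\<close>

lemma eval_conjugate_zero:
  assumes p: "p \<in> carrier (K0[X])" "eval p \<omega> = \<zero>" and t: "t \<in> carrier L" "t [^] e = \<pi>"
  shows "eval p t = \<zero>"
proof -
  let ?b = "\<one> # replicate (e - 1) \<zero> @ [\<ominus> \<pi>]"
  note KE = subringE[OF K0_subring]
  have b: "?b \<in> carrier (K0[X])"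
    using KE(2,3) KE(5)[OF K_K0[OF \<pi>(1)]] by (auto simp: sym[OF univ_poly_carrier] polynomial_def)
  obtain q r where qr: "q \<in> carrier (K0[X])" "r \<in> carrier (K0[X])"
    "p = (?b \<otimes>\<^bsub>K0[X]\<^esub> q) \<oplus>\<^bsub>K0[X]\<^esub> r" "r = \<zero>\<^bsub>K0[X]\<^esub> \<or> degree r < degree ?b"
    using field_long_division_theorem_shell[OF K0_subfield p(1) b] by (auto simp: univ_poly_zero)
  have ev: "eval p s = eval ?b s \<otimes> eval q s \<oplus> eval r s" if s: "s \<in> carrier L" for s
  proof -
    interpret h: ring_hom_ring "K0[X]" L "\<lambda>p. eval p s" by (rule eval_ring_hom[OF K0_subring s])
    show ?thesis using h.hom_add h.hom_mult qr b by simp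
  qed
  have b0: "eval ?b s = \<zero>" if "s \<in> carrier L" "s [^] e = \<pi>" for s
    using eval_binomial[OF \<pi>_carrier that(1) e_pos] that(2) \<pi>_carrier by simp
  have set: "set s \<subseteq> K0" if "s \<in> carrier (K0[X])" for s
    using that polynomial_incl by (auto simp: sym[OF univ_poly_carrier])
  have cl: "eval s x \<in> carrier L" if "s \<in> carrier (K0[X])" "x \<in> carrier L" for s x
    using set[OF that(1)] K0_carrier eval_in_carrier[OF _ that(2)] by blast
  have "eval r \<omega> = \<zero>" using ev[OF \<omega>(1)] b0[OF \<omega>] p(2) cl qr \<omega>(1) by simp
  \<comment> \<open>The degree is the length minus one and the divisor has degree e, so the
    remainder has at most e coefficients, just within reach of the independence lemma.\<close>
  moreover have "length r \<le> e" using qr(4) e_pos by (auto simp: univ_poly_zero)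
  ultimately have "set r \<subseteq> {\<zero>}" using \<omega>_powers_independent set qr(2) by blast
  then have "r = []"
    using qr(2) by (cases r) (auto simp: sym[OF univ_poly_carrier] polynomial_def)
  then show ?thesis using ev[OF t(1)] b0[OF t] cl qr t(1) by simp
qed

section \<open>Automorphisms over K(\<eta>)\<close>

text \<open>The automorphism sending \<omega> to z\<omega>: write x as a polynomial in \<omega> and
  evaluate it at z\<omega>. The chosen polynomial does not matter, by
  \<open>eval_conjugate_zero\<close>; \<open>restrict\<close> provides the extensionality that
  \<open>Bij\<close> demands.\<close>

definition twist :: "'a \<Rightarrow> 'a \<Rightarrow> 'a"
  where "twist z = restrict (\<lambda>x. eval (SOME p. p \<in> carrier (K0[X]) \<and> eval p \<omega> = x) (z \<otimes> \<omega>)) M"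

lemma M_eval: "M = (\<lambda>p. eval p \<omega>) ` carrier (K0[X])"
  using simple_extension_as_eval_img[OF subringE(1)[OF K0_subring] \<omega>(1)] .

context
  fixes z assumes z: "z \<in> carrier L" "z [^] e = \<one>"
begin

lemma z_\<omega>: "z \<otimes> \<omega> \<in> carrier L" "(z \<otimes> \<omega>) [^] e = \<pi>"
  using z \<omega> \<pi>_carrier by (auto simp: nat_pow_distrib)

interpretation at_\<omega>: ring_hom_ring "K0[X]" L "\<lambda>p. eval p \<omega>" by (rule eval_ring_hom[OF K0_subring \<omega>(1)])
interpretation at_z\<omega>: ring_hom_ring "K0[X]" L "\<lambda>p. eval p (z \<otimes> \<omega>)" by (rule eval_ring_hom[OF K0_subring z_\<omega>(1)])

lemma twist_eval:
  assumes p: "p \<in> carrier (K0[X])"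
  shows "twist z (eval p \<omega>) = eval p (z \<otimes> \<omega>)"
proof -
  define p' where "p' = (SOME p'. p' \<in> carrier (K0[X]) \<and> eval p' \<omega> = eval p \<omega>)"
  have p': "p' \<in> carrier (K0[X])" "eval p' \<omega> = eval p \<omega>"
    using someI[of "\<lambda>p'. p' \<in> carrier (K0[X]) \<and> eval p' \<omega> = eval p \<omega>" p] p by (auto simp: p'_def)
  have "eval (p' \<ominus>\<^bsub>K0[X]\<^esub> p) \<omega> = \<zero>"
    using p p' at_\<omega>.hom_add at_\<omega>.hom_a_inv at_\<omega>.hom_closed by (simp add: a_minus_def r_neg)
  then have "eval (p' \<ominus>\<^bsub>K0[X]\<^esub> p) (z \<otimes> \<omega>) = \<zero>"
    by (rule eval_conjugate_zero[OF at_\<omega>.R.minus_closed[OF p'(1) p] _ z_\<omega>])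
  then have "eval p' (z \<otimes> \<omega>) \<ominus> eval p (z \<otimes> \<omega>) = \<zero>"
    using p p' at_z\<omega>.hom_add at_z\<omega>.hom_a_inv by (simp add: a_minus_def)
  then have "eval p' (z \<otimes> \<omega>) = eval p (z \<otimes> \<omega>)" using p p' at_z\<omega>.hom_closed by simp
  then show ?thesis using p M_eval by (auto simp: twist_def p'_def)
qed

lemma twist_K0: "x \<in> K0 \<Longrightarrow> twist z x = x"
proof -
  assume x: "x \<in> K0"
  let ?p = "if x = \<zero> then [] else [x]"
  have "?p \<in> carrier (K0[X])" using x by (auto simp: sym[OF univ_poly_carrier] polynomial_def)
  moreover have "eval ?p t = x" if "t \<in> carrier L" for t using that K0_carrier[OF x] by auto
  ultimately show ?thesis using twist_eval[of ?p] z_\<omega> \<omega>(1) by simp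
qed

lemma twist_\<omega>: "twist z \<omega> = z \<otimes> \<omega>"
  using twist_eval[OF var_closed(1)[OF K0_subring]] eval_var z_\<omega> \<omega>(1) by simp

lemma twist_hom: "twist z \<in> ring_hom (L\<lparr>carrier := M\<rparr>) (L\<lparr>carrier := M\<rparr>)"
proof (rule ring_hom_memI)
  have zM: "z \<otimes> \<omega> \<in> M"
    using subringE(6)[OF M_subring] K0_M[OF K_K0[OF roots_of_unity_K(1)[OF z]]] \<omega>_M by simp
  have KM: "K0 \<subseteq> M" using K0_M by blast
  show "twist z x \<in> carrier (L\<lparr>carrier := M\<rparr>)" if x: "x \<in> carrier (L\<lparr>carrier := M\<rparr>)" for x
  proof -
    obtain p where p: "p \<in> carrier (K0[X])" "x = eval p \<omega>" using x M_eval by auto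
    then have "set p \<subseteq> M" using KM polynomial_incl by (auto simp: sym[OF univ_poly_carrier])
    then show ?thesis using twist_eval[OF p(1)] p eval_in_subring[OF M_subring _ zM] by simp
  qed
  fix x y assume "x \<in> carrier (L\<lparr>carrier := M\<rparr>)" "y \<in> carrier (L\<lparr>carrier := M\<rparr>)"
  then obtain p q where p: "p \<in> carrier (K0[X])" "x = eval p \<omega>" and q: "q \<in> carrier (K0[X])" "y = eval q \<omega>"
    using M_eval by auto
  show "twist z (x \<otimes>\<^bsub>L\<lparr>carrier := M\<rparr>\<^esub> y) = twist z x \<otimes>\<^bsub>L\<lparr>carrier := M\<rparr>\<^esub> twist z y"
    using twist_eval[of "p \<otimes>\<^bsub>K0[X]\<^esub> q"] twist_eval p q at_\<omega>.hom_mult at_z\<omega>.hom_mult by simp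
  show "twist z (x \<oplus>\<^bsub>L\<lparr>carrier := M\<rparr>\<^esub> y) = twist z x \<oplus>\<^bsub>L\<lparr>carrier := M\<rparr>\<^esub> twist z y"
    using twist_eval[of "p \<oplus>\<^bsub>K0[X]\<^esub> q"] twist_eval p q at_\<omega>.hom_add at_z\<omega>.hom_add by simp
next
  show "twist z \<one>\<^bsub>L\<lparr>carrier := M\<rparr>\<^esub> = \<one>\<^bsub>L\<lparr>carrier := M\<rparr>\<^esub>"
    using twist_K0 subringE(3)[OF K0_subring] by simp
qed

text \<open>Injective as a unital homomorphism on a field; surjective because z\<omega> generates M
  over K(\<eta>) as well, z being invertible in K.\<close>

lemma twist_galois: "twist z \<in> carrier (galois_group L M K)"
proof -
  have h: "twist z x \<in> M" "twist z (x \<otimes> y) = twist z x \<otimes> twist z y" "twist z (x \<oplus> y) = twist z x \<oplus> twist z y"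
    if "x \<in> M" "y \<in> M" for x y
    using twist_hom that by (auto simp: ring_hom_def)
  have one: "twist z \<one> = \<one>" and zero: "twist z \<zero> = \<zero>"
    using twist_K0 subringE(2,3)[OF K0_subring] by auto
  have "inj_on (twist z) M"
  proof (rule inj_onI)
    fix x y assume xy: "x \<in> M" "y \<in> M" "twist z x = twist z y"
    show "x = y"
    proof (rule ccontr)
      assume "x \<noteq> y"
      define d where "d = x \<ominus> y"
      have ym: "\<ominus> y \<in> M" and d: "d \<in> M" "d \<noteq> \<zero>"
        using xy \<open>x \<noteq> y\<close> subringE(5,7)[OF M_subring] M_carrier by (auto simp: d_def minus_eq)
           (metis M_carrier minus_eq r_right_minus_eq)
      have x: "x = d \<oplus> y" unfolding d_def using xy M_carrier by (simp add: minus_eq a_assoc l_neg)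
      have "twist z x = twist z d \<oplus> twist z y" using h(3)[OF d(1) xy(2)] x by simp
      moreover have "twist z d = (twist z d \<oplus> twist z y) \<ominus> twist z y"
        using M_carrier[OF h(1)[OF d(1) d(1)]] M_carrier[OF h(1)[OF xy(2,2)]]
        by (simp add: minus_eq a_assoc r_neg)
      ultimately have "twist z d = \<zero>"
        using xy(3) M_carrier[OF h(1)[OF xy(2,2)]] by (simp add: minus_eq r_neg)
      moreover have "inv d \<in> M" "d \<otimes> inv d = \<one>" using subfield_m_inv[OF M_subfield, of d] d by auto
      ultimately have "\<one> = \<zero> \<otimes> twist z (inv d)" "twist z (inv d) \<in> carrier L"
        using h(2)[OF d(1), of "inv d"] one h(1)[of "inv d"] M_carrier by auto
      then show False by simp
    qed
  qed
  moreover have "twist z ` M = M"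
  proof
    show "twist z ` M \<subseteq> M" using h by blast
    note zK = roots_of_unity_K[OF z]
    have zc: "K0 \<subseteq> carrier L" using K0_carrier by blast
    have "subring (simple_extension K0 (z \<otimes> \<omega>)) L" by (rule simple_extension_is_subring[OF K0_subring z_\<omega>(1)])
    moreover have "K0 \<subseteq> simple_extension K0 (z \<otimes> \<omega>)" by (rule simple_extension_incl[OF zc z_\<omega>(1)])
    moreover have "\<omega> \<in> simple_extension K0 (z \<otimes> \<omega>)"
    proof -
      have i: "inv z \<in> K0" "inv z \<otimes> z = \<one>" using K_inv[OF zK(1,2)] K_K0 by auto
      have "\<omega> = inv z \<otimes> (z \<otimes> \<omega>)" using i z \<omega>(1) K0_carrier by (simp flip: m_assoc)
      then show ?thesis using calculation subringE(6)[OF calculation(1)] i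
          simple_extension_mem[OF K0_subring z_\<omega>(1)] by (metis subsetD)
    qed
    ultimately have "M \<subseteq> simple_extension K0 (z \<otimes> \<omega>)" by (rule simple_extension_subring_incl)
    also have "\<dots> = (\<lambda>p. eval p (z \<otimes> \<omega>)) ` carrier (K0[X])"
      by (rule simple_extension_as_eval_img[OF zc z_\<omega>(1)])
    also have "\<dots> \<subseteq> twist z ` M"
    proof (rule image_subsetI)
      fix p assume p: "p \<in> carrier (K0[X])"
      then have "eval p \<omega> \<in> M" using M_eval by simp
      then show "eval p (z \<otimes> \<omega>) \<in> twist z ` M" using twist_eval[OF p] by force
    qed
    finally show "M \<subseteq> twist z ` M" .
  qed
  ultimately have "twist z \<in> Bij M" by (auto simp: Bij_def bij_betw_def twist_def)
  then show ?thesis using twist_hom twist_K0 K_K0 by (simp add: galois_group_def)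
qed

end

section \<open>Inertia and the fixing of radicals\<close>

lemma galois_hom:
  assumes "g \<in> carrier (galois_group L M K)"
  shows "x \<in> M \<Longrightarrow> g x \<in> M" "\<lbrakk>x \<in> M; y \<in> M\<rbrakk> \<Longrightarrow> g (x \<otimes> y) = g x \<otimes> g y"
    "\<lbrakk>x \<in> M; y \<in> M\<rbrakk> \<Longrightarrow> g (x \<oplus> y) = g x \<oplus> g y" "x \<in> K \<Longrightarrow> g x = x"
    "x \<in> M \<Longrightarrow> g (x [^] (n::nat)) = g x [^] n"
proof -
  show 1: "x \<in> M \<Longrightarrow> g x \<in> M" "\<lbrakk>x \<in> M; y \<in> M\<rbrakk> \<Longrightarrow> g (x \<otimes> y) = g x \<otimes> g y"
    "\<lbrakk>x \<in> M; y \<in> M\<rbrakk> \<Longrightarrow> g (x \<oplus> y) = g x \<oplus> g y" "x \<in> K \<Longrightarrow> g x = x" for x y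
    using assms by (auto simp: galois_group_def ring_hom_def)
  show "x \<in> M \<Longrightarrow> g (x [^] (n::nat)) = g x [^] n"
    by (induction n) (use 1 subringE(3)[OF K_subring] subring_pow_closed[OF M_subring] in auto)
qed

text \<open>Such a g fixes \<open>A0\<close> pointwise and multiplies \<omega> by a root of 1, so it
  is the identity modulo \<omega>; and multiples of \<omega> are non-units.\<close>

lemma inertia_if_fixes_\<eta>:
  assumes g: "g \<in> carrier (galois_group L M K)" "g \<eta> = \<eta>"
  shows "g \<in> inertia_subgroup L M K v"
proof -
  note s = galois_hom[OF g(1)]
  have A0_fixed: "g x = x" if "x \<in> A0" for x
    using that
  proof (induction rule: simple_extension.induct)
    case zero
    show ?case using s(4) subringE(2)[OF K_subring] by simp
  next
    case (lin k1 k2)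
    have "k1 \<in> M" "k2 \<in> K" "\<eta> \<in> M" using lin A0_K0 K0_M OK_K \<eta>_K0 by auto
    then show ?case using s lin g(2) K_K0 K0_M subringE(6)[OF M_subring] by simp
  qed
  have \<omega>c: "inv \<omega> \<in> carrier L" "\<omega> \<otimes> inv \<omega> = \<one>" "inv \<omega> \<otimes> \<omega> = \<one>"
    using field_Units \<omega>(1) \<omega>_nonzero by auto
  have g\<omega>c: "g \<omega> \<in> carrier L" using s(1)[OF \<omega>_M] M_carrier by blast
  define z where "z = g \<omega> \<otimes> inv \<omega>"
  have zc: "z \<in> carrier L" using g\<omega>c \<omega>c by (simp add: z_def)
  have g\<omega>: "g \<omega> = z \<otimes> \<omega>" using g\<omega>c \<omega>c \<omega>(1) by (simp add: z_def m_assoc)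
  have "g \<omega> [^] e = \<omega> [^] e" using s(5)[OF \<omega>_M, of e] \<omega>(2) s(4)[OF \<pi>(1)] by simp
  then have "z [^] e = \<omega> [^] e \<otimes> inv \<omega> [^] e"
    using g\<omega>c \<omega>c by (simp add: z_def nat_pow_distrib)
  also have "\<dots> = \<one>" using nat_pow_distrib[of \<omega> "inv \<omega>" e] \<omega>c \<omega>(1) by simp
  finally have z: "z \<in> A" using roots_of_unity_K zc OK_A0 A0_A by blast
  note AE = subringE[OF A_subring]
  have shift: "\<exists>a\<in>A. g x = x \<oplus> \<omega> \<otimes> a" if x: "x \<in> A" for x
    using x
  proof (induction rule: simple_extension.induct)
    case zero
    show ?case using s(4)[of \<zero>] subringE(2)[OF K_subring] AE(2) \<omega>(1) by (intro bexI[of _ \<zero>]) auto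
  next
    case (lin k1 k2)
    then obtain a where a: "a \<in> A" "g k1 = k1 \<oplus> \<omega> \<otimes> a" by blast
    have k: "k1 \<in> M" "k2 \<in> M" "k1 \<otimes> \<omega> \<in> M"
      using lin A_M A0_A \<omega>_M subringE(6)[OF M_subring] by auto
    have c: "k1 \<in> carrier L" "k2 \<in> carrier L" "a \<in> carrier L" using lin A_carrier A0_carrier a by auto
    \<comment> \<open>Read off from (k1 + \<omega>a)z\<omega> = k1\<omega> + \<omega>((k1 +
      \<omega>a)z - k1).\<close>
    let ?a = "(k1 \<oplus> \<omega> \<otimes> a) \<otimes> z \<oplus> \<ominus> k1"
    have "g (k1 \<otimes> \<omega> \<oplus> k2) = (k1 \<oplus> \<omega> \<otimes> a) \<otimes> (z \<otimes> \<omega>) \<oplus> k2"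
      using s(2,3) k \<omega>_M a g\<omega> A0_fixed[OF lin(2)] by simp
    also have "\<dots> = (k1 \<otimes> \<omega> \<oplus> k2) \<oplus> \<omega> \<otimes> ?a" using c zc \<omega>(1) by algebra
    finally have "g (k1 \<otimes> \<omega> \<oplus> k2) = (k1 \<otimes> \<omega> \<oplus> k2) \<oplus> \<omega> \<otimes> ?a" .
    moreover have "?a \<in> A" by (intro AE(5,6,7) a(1) lin(1) z \<omega>_A)
    ultimately show ?case by blast
  qed
  have "g x \<ominus> x \<in> extension_ideal L M K v" if x: "x \<in> A" for x
  proof -
    obtain a where a: "a \<in> A" "g x = x \<oplus> \<omega> \<otimes> a" using shift[OF x] by blast
    have c: "x \<in> carrier L" "a \<in> carrier L" using x a A_carrier by auto
    have "g x \<ominus> x = \<omega> \<otimes> a" unfolding a(2) using c \<omega>(1) by algebra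
    moreover have "\<omega> \<otimes> a \<in> A" using AE(6) \<omega>_A a by simp
    moreover have "\<omega> \<otimes> a \<otimes> y \<noteq> \<one>" if y: "y \<in> A" for y
      using \<omega>_not_unit[OF AE(6)[OF a(1) y]] c A_carrier[OF y] \<omega>(1) by (simp add: m_assoc)
    ultimately show ?thesis by (simp add: extension_ideal_iff)
  qed
  then show ?thesis using g(1) by (simp add: inertia_subgroup_def extension_integers_eq)
qed

lemma inertia_fixes_unit_radicals:
  assumes g: "g \<in> inertia_subgroup L M K v" and y: "y \<in> M" "y [^] e \<in> K - {\<zero>}" "v (y [^] e) = 0"
  shows "g y = y"
proof -
  have gG: "g \<in> carrier (galois_group L M K)" using g by (simp add: inertia_subgroup_def)
  note s = galois_hom[OF gG]
  note AE = subringE[OF A_subring]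
  have yc: "y \<in> carrier L" using y M_carrier by simp
  have y0: "y \<noteq> \<zero>" using y e_pos by (auto simp: nat_pow_zero)
  \<comment> \<open>Applied to y and to its inverse, this makes y a unit of
    \<open>A\<close>.\<close>
  have integral: "x \<in> A" if x: "x \<in> M" "x [^] e \<in> OK" for x
  proof -
    have xc: "x \<in> carrier L" using x M_carrier by simp
    define p where "p = \<one> # replicate (e - 1) \<zero> @ [\<ominus> (x [^] e)]"
    have "eval p x = \<zero>"
      unfolding p_def using eval_binomial[of "x [^] e" x e] xc e_pos by simp
    moreover have "set p \<subseteq> {\<one>, \<zero>, \<ominus> (x [^] e)}" by (auto simp: p_def)
    then have "set p \<subseteq> OK" using subringE(2,3)[OF OK_subring] subringE(5)[OF OK_subring x(2)] by blast
    moreover have "p \<noteq> []" "hd p = \<one>" by (simp_all add: p_def)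
    ultimately have "x \<in> integral_closure L OK M" unfolding integral_closure_def using x(1) by blast
    then show ?thesis using integral_closure_eq by simp
  qed
  have iy: "inv y \<in> M" "y \<otimes> inv y = \<one>" "inv y \<otimes> y = \<one>" "inv y \<noteq> \<zero>"
    using subfield_m_inv[OF M_subfield, of y] y y0 by auto
  have iyc: "inv y \<in> carrier L" using iy M_carrier by simp
  have ye: "y [^] e \<in> OK" "y [^] e \<notin> mK"
    using B.valuation_ring_unit_iff[of "y [^] e"] y by auto
  obtain d where d: "d \<in> OK" "y [^] e \<otimes> d = \<one>" using OK_unit[OF ye] by blast
  have "inv y [^] e \<otimes> (y [^] e \<otimes> d) = (inv y \<otimes> y) [^] e \<otimes> d"
    using iyc yc OK_carrier[OF d(1)] by (simp add: nat_pow_distrib m_assoc)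
  then have "inv y [^] e = d" using iy d iyc OK_carrier[OF d(1)] by simp
  then have iyA: "inv y \<in> A" using integral[OF iy(1)] d by simp
  have yA: "y \<in> A" using integral[OF y(1) ye(1)] .
  have syc: "g y \<in> carrier L" using s(1)[OF y(1)] M_carrier by simp
  define z where "z = g y \<otimes> inv y"
  have zc: "z \<in> carrier L" using syc iyc by (simp add: z_def)
  have sy: "g y = z \<otimes> y" using syc iyc iy yc by (simp add: z_def m_assoc)
  have "g y [^] e = y [^] e" using s(5)[OF y(1), of e] s(4) y(2) by simp
  then have "z [^] e = (y \<otimes> inv y) [^] e"
    using syc iyc yc by (simp add: z_def nat_pow_distrib)
  then have ze: "z [^] e = \<one>" using iy by simp
  note zK = roots_of_unity_K[OF zc ze]
  have "z = \<one>"
  proof (rule ccontr)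
    assume "z \<noteq> \<one>"
    have zm: "z \<ominus> \<one> \<in> OK" unfolding minus_eq using zK(4) subringE(3,5,7)[OF OK_subring] by simp
    have "add_pow (L\<lparr>carrier := K\<rparr>) e \<one>\<^bsub>L\<lparr>carrier := K\<rparr>\<^esub> \<notin> mK"
      using B.add_pow_one_mem_mm[of e] e_coprime by simp
    \<comment> \<open>The only e-th root of 1 that is a principal unit is 1 itself, so here z - 1 is
      a unit of the valuation ring.\<close>
    then have "z \<ominus> \<one> \<notin> mK"
      using B.root_of_unity_eq_one[of e z] \<open>z \<noteq> \<one>\<close> zK(1) ze subringE(3)[OF K_subring]
      by (auto simp: subring_nat_pow K_minus)
    then obtain c where c: "c \<in> OK" "(z \<ominus> \<one>) \<otimes> c = \<one>" using OK_unit zm by blast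
    have cc: "c \<in> carrier L" using OK_carrier c by blast
    have "g y \<ominus> y = (z \<ominus> \<one>) \<otimes> y" unfolding sy using zc yc by (simp add: minus_eq l_distr l_minus)
    then have "(g y \<ominus> y) \<otimes> (c \<otimes> inv y) = ((z \<ominus> \<one>) \<otimes> c) \<otimes> (y \<otimes> inv y)"
      using zc yc cc iyc by (simp add: m_ac)
    also have "\<dots> = \<one>" using c iy by simp
    finally have "(g y \<ominus> y) \<otimes> (c \<otimes> inv y) = \<one>" .
    moreover have "c \<otimes> inv y \<in> A" using AE(6) iyA A0_A OK_A0 c by simp
    moreover have "g y \<ominus> y \<in> extension_ideal L M K v"
      using g yA by (simp add: inertia_subgroup_def extension_integers_eq)
    ultimately show False by (auto simp: extension_ideal_iff)
  qed
  then show ?thesis using sy yc by simp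
qed

section \<open>The Kummer pairing\<close>

abbreviation KR where "KR \<equiv> L\<lparr>carrier := K\<rparr>"
abbreviation cls where "cls x \<equiv> unit_powers KR e #>\<^bsub>Multiplicative_Group.mult_of KR\<^esub> x"

lemma e_notin_mK: "add_pow KR e \<one>\<^bsub>KR\<^esub> \<notin> mK"
  using B.add_pow_one_mem_mm[of e] e_coprime by simp

lemma mem_cls: "x \<in> K - {\<zero>} \<Longrightarrow> x \<in> cls x"
  using group.rcos_self[OF B.field_mult_group _ B.unit_powers_subgroup, of x] by simp

lemma cls_eq:
  assumes "t \<in> K - {\<zero>}" "x \<in> K - {\<zero>}"
  shows "cls (x \<otimes> t [^] e) = cls x"
proof -
  have c: "x \<in> carrier L" "t \<in> carrier L" using assms K_carrier by auto
  have "x \<otimes> t [^] e = t [^] e \<otimes> x" using c by (simp add: m_comm)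
  then have "x \<otimes> t [^] e \<in> cls x"
    using assms(1) by (auto simp: r_coset_def unit_powers_def subring_nat_pow)
  then show ?thesis
    using group.repr_independence[OF B.field_mult_group _ _ B.unit_powers_subgroup, of "x \<otimes> t [^] e" e x]
      assms(2) by simp
qed

lemma unit_classes_carrier: "carrier (unit_classes KR e) = cls ` (K - {\<zero>})"
  by (auto simp: unit_classes_def FactGroup_def RCOSETS_def)

lemma residue_unit_classes_cls:
  "residue_unit_classes KR v e = cls ` {x \<in> K - {\<zero>}. v x = 0}"
  using B.residue_unit_classes_eq[OF e_notin_mK] by simp

text \<open>Trades the definite description in \<open>kummer_pairing\<close> for the condition that
  one freely chosen e-th root is fixed.\<close>

lemma pairing_eq_one_iff:
  assumes g: "g \<in> carrier (galois_group L M K)" and y: "y \<in> M" "y [^] e = x" and x: "x \<in> K - {\<zero>}"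
  shows "kummer_pairing L M e g (cls x) = \<one> \<longleftrightarrow> g y = y"
proof -
  have yc: "y \<in> carrier L" "y \<noteq> \<zero>" using y x e_pos M_carrier by (auto simp: nat_pow_zero)
  have "kummer_pairing L M e g (cls x) = g y \<otimes> inv y"
    using kummer_pairing_well_defined(2)[OF algebraic_closure_axioms e_pos card_roots
        kummer_extension_eq[symmetric] g, of "cls x" x y] unit_classes_carrier x y yc mem_cls[OF x] by blast
  moreover have iy: "inv y \<in> carrier L" "y \<otimes> inv y = \<one>" "inv y \<otimes> y = \<one>"
    using field_Units yc by auto
  moreover have gy: "g y \<in> carrier L" using galois_hom(1)[OF g y(1)] M_carrier by simp
  moreover have "g y = y" if "g y \<otimes> inv y = \<one>"
  proof -
    have "g y = g y \<otimes> inv y \<otimes> y" using iy gy yc by (simp add: m_assoc)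
    then show ?thesis using that yc by simp
  qed
  ultimately show ?thesis by auto
qed

lemma radical_in_M:
  assumes x: "x \<in> K - {\<zero>}"
  obtains y where "y \<in> M" "y [^] e = x"
proof -
  obtain y where y: "y \<in> carrier L" "y [^] e = x" using exists_power_root[of x e] x K_carrier e_pos by auto
  then have "y \<in> kummer_extension L K e"
    unfolding kummer_extension_def using x by (intro generate_field.incl) auto
  then show thesis using that y kummer_extension_eq by simp
qed

text \<open>There are e roots of unity but at most j < e solutions of z^j = 1.\<close>

lemma exists_root_of_unity_power_neq_one:
  assumes j: "0 < j" "j < e"
  shows "\<exists>z\<in>carrier L. z [^] e = \<one> \<and> z [^] j \<noteq> \<one>"
proof (rule ccontr)
  assume "\<not> ?thesis"
  then have "roots_of_unity KR e \<subseteq> {z \<in> carrier L. z [^] j = \<one>}"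
    using K_carrier by (auto simp: roots_of_unity_def subring_nat_pow)
  from card_mono[OF card_power_roots(1)[OF K_carrier[OF one_closed] j(1)] this]
  have "e \<le> card {z \<in> carrier L. z [^] j = \<one>}" using card_roots by simp
  then show False using card_power_roots(2)[OF K_carrier[OF one_closed] j(1)] j by simp
qed

lemma orth_galois:
  "kummer_orth_galois L M K e (residue_unit_classes KR v e) = inertia_subgroup L M K v"
proof
  show "kummer_orth_galois L M K e (residue_unit_classes KR v e) \<subseteq> inertia_subgroup L M K v"
  proof
    fix g assume "g \<in> kummer_orth_galois L M K e (residue_unit_classes KR v e)"
    \<comment> \<open>The single class of u suffices: orthogonality to it says that g fixes
      \<eta>.\<close>
    then have g: "g \<in> carrier (galois_group L M K)" "kummer_pairing L M e g (cls u) = \<one>"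
      using u by (auto simp: kummer_orth_galois_def residue_unit_classes_cls)
    then show "g \<in> inertia_subgroup L M K v"
      using inertia_if_fixes_\<eta> pairing_eq_one_iff[OF g(1) _ \<eta>(2)] K0_M[OF \<eta>_K0] u by simp
  qed
  show "inertia_subgroup L M K v \<subseteq> kummer_orth_galois L M K e (residue_unit_classes KR v e)"
  proof
    fix g assume g: "g \<in> inertia_subgroup L M K v"
    then have gG: "g \<in> carrier (galois_group L M K)" by (simp add: inertia_subgroup_def)
    have "kummer_pairing L M e g (cls x) = \<one>" if x: "x \<in> K - {\<zero>}" "v x = 0" for x
    proof -
      obtain y where y: "y \<in> M" "y [^] e = x" by (rule radical_in_M[OF x(1)])
      then show ?thesis
        using pairing_eq_one_iff[OF gG y x(1)] inertia_fixes_unit_radicals[OF g y(1)] x by simp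
    qed
    then show "g \<in> kummer_orth_galois L M K e (residue_unit_classes KR v e)"
      using gG by (auto simp: kummer_orth_galois_def residue_unit_classes_cls)
  qed
qed

lemma orth_classes:
  "kummer_orth_classes L M K e (inertia_subgroup L M K v) = residue_unit_classes KR v e"
proof
  show "residue_unit_classes KR v e \<subseteq> kummer_orth_classes L M K e (inertia_subgroup L M K v)"
  proof
    fix C assume C: "C \<in> residue_unit_classes KR v e"
    \<comment> \<open>Purely formal: inertia is already known to be the orthogonal complement of
      these classes.\<close>
    have "kummer_pairing L M e g C = \<one>" if "g \<in> inertia_subgroup L M K v" for g
      using that C unfolding orth_galois[symmetric] by (simp add: kummer_orth_galois_def)
    then show "C \<in> kummer_orth_classes L M K e (inertia_subgroup L M K v)"
      using C by (auto simp: kummer_orth_classes_def residue_unit_classes_cls unit_classes_carrier)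
  qed
  show "kummer_orth_classes L M K e (inertia_subgroup L M K v) \<subseteq> residue_unit_classes KR v e"
  proof
    fix C assume C: "C \<in> kummer_orth_classes L M K e (inertia_subgroup L M K v)"
    then obtain x where x: "x \<in> K - {\<zero>}" "C = cls x"
      by (auto simp: kummer_orth_classes_def unit_classes_carrier)
    obtain y where y: "y \<in> M" "y [^] e = x" by (rule radical_in_M[OF x(1)])
    obtain t and i j :: nat where t: "t \<in> K - {\<zero>}" "int j = v x mod int e"
      "y = \<omega> [^] j \<otimes> \<eta> [^] i \<otimes> t"
      using radical_decomposition[of y] y x M_carrier by metis
    have tc: "t \<in> carrier L" using t K_carrier by simp
    \<comment> \<open>Otherwise some e-th root of unity z has z^j \<noteq> 1. Twisting by z fixes
      \<eta>, hence is inertia, yet it multiplies y by z^j, against the orthogonality of C.\<close>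
    have "j = 0"
    proof (rule ccontr)
      assume j0: "j \<noteq> 0"
      have "j < e" using t(2) e_pos by (metis of_nat_less_iff pos_mod_bound of_nat_0_less_iff)
      then obtain z where z: "z \<in> carrier L" "z [^] e = \<one>" "z [^] j \<noteq> \<one>"
        using exists_root_of_unity_power_neq_one j0 by auto
      let ?g = "twist z"
      note gG = twist_galois[OF z(1,2)]
      note gK0 = twist_K0[OF z(1,2)]
      have "?g \<in> inertia_subgroup L M K v"
        by (rule inertia_if_fixes_\<eta>[OF gG gK0[OF \<eta>_K0]])
      then have "kummer_pairing L M e ?g (cls x) = \<one>"
        using C x(2) by (simp add: kummer_orth_classes_def)
      then have gy: "?g y = y" using pairing_eq_one_iff[OF gG y x(1)] by simp
      define s where "s = \<eta> [^] i \<otimes> t"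
      have s: "s \<in> K0"
        unfolding s_def using subringE(6)[OF K0_subring] subring_pow_closed[OF K0_subring \<eta>_K0] t K_K0 by simp
      have sc: "s \<in> carrier L" using s K0_carrier by simp
      have ys: "y = \<omega> [^] j \<otimes> s" using t(3) \<omega>(1) \<eta>(1) tc by (simp add: s_def m_assoc)
      have "?g y = ?g (\<omega> [^] j) \<otimes> ?g s"
        unfolding ys using galois_hom(2)[OF gG subring_pow_closed[OF M_subring \<omega>_M] K0_M[OF s]] .
      also have "\<dots> = (z \<otimes> \<omega>) [^] j \<otimes> s"
        using galois_hom(5)[OF gG \<omega>_M] twist_\<omega>[OF z(1,2)] gK0[OF s] by simp
      also have "\<dots> = z [^] j \<otimes> y"
        unfolding ys using z(1) \<omega>(1) sc by (simp add: nat_pow_distrib m_assoc)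
      finally have "z [^] j \<otimes> y = \<one> \<otimes> y" using gy y M_carrier by simp
      moreover have "y \<in> carrier L" "y \<noteq> \<zero>" using y x e_pos M_carrier by (auto simp: nat_pow_zero)
      ultimately show False using m_rcancel[of y "z [^] j" \<one>] z by simp
    qed
    \<comment> \<open>Without the factor in \<omega>, x is u^i up to an e-th power from K, and u^i
      is a unit.\<close>
    then have "y = \<eta> [^] i \<otimes> t" using t(3) \<eta>(1) tc by simp
    then have "x = (\<eta> [^] i) [^] e \<otimes> t [^] e" using y(2) \<eta>(1) tc by (simp add: nat_pow_distrib)
    also have "(\<eta> [^] i) [^] e = u [^] i"
      unfolding \<eta>(2)[symmetric] using \<eta>(1) by (simp add: nat_pow_pow mult.commute)
    finally have xu: "x = u [^] i \<otimes> t [^] e" .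
    have ui: "u [^] i \<in> K - {\<zero>}" "v (u [^] i) = 0"
      using B.nz_pow[of u i] B.v_pow[of u i] u by (auto simp: subring_nat_pow)
    then show "C \<in> residue_unit_classes KR v e"
      unfolding x(2) xu cls_eq[OF t(1) ui(1)] residue_unit_classes_cls by blast
  qed
qed

end

theorem proposition6p0p1:
  fixes L :: "('a, 'b) ring_scheme" and K :: "'a set" and v :: "'a \<Rightarrow> int"
    and M :: "'a set" and e p :: nat
  assumes "algebraic_closure L K"
    and "local_field (L\<lparr>carrier := K\<rparr>) v"
    and "p = ring_char (residue_field (L\<lparr>carrier := K\<rparr>) v)"
    and "e > 0" and "\<not> [e = 0] (mod p)"
    and "card (roots_of_unity (L\<lparr>carrier := K\<rparr>) e) = e"
    and "M = kummer_extension L K e"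
  shows "kummer_orth_classes L M K e (inertia_subgroup L M K v)
           = residue_unit_classes (L\<lparr>carrier := K\<rparr>) v e \<and>
         kummer_orth_galois L M K e (residue_unit_classes (L\<lparr>carrier := K\<rparr>) v e)
           = inertia_subgroup L M K v"
proof -
  interpret algebraic_closure L K by (rule assms(1))
  interpret B: local_field "L\<lparr>carrier := K\<rparr>" v by (rule assms(2))
  have K: "subring K L" by (rule subfieldE(1)[OF subfield_axioms])
  obtain \<pi> where \<pi>: "\<pi> \<in> K" "\<pi> \<noteq> \<zero>\<^bsub>L\<^esub>" "v \<pi> = 1" using B.exists_uniformiser by auto
  obtain u where u: "u \<in> carrier (L\<lparr>carrier := K\<rparr>) - {\<zero>\<^bsub>L\<lparr>carrier := K\<rparr>\<^esub>}" "v u = 0"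
    "\<And>x. \<lbrakk>x \<in> carrier (L\<lparr>carrier := K\<rparr>) - {\<zero>\<^bsub>L\<lparr>carrier := K\<rparr>\<^esub>}; v x = 0\<rbrakk>
      \<Longrightarrow> \<exists>i::nat. x \<ominus>\<^bsub>L\<lparr>carrier := K\<rparr>\<^esub> u [^]\<^bsub>L\<lparr>carrier := K\<rparr>\<^esub> i \<in> B.\<mm>"
    "\<And>j::nat. u [^]\<^bsub>L\<lparr>carrier := K\<rparr>\<^esub> j \<ominus>\<^bsub>L\<lparr>carrier := K\<rparr>\<^esub> \<one>\<^bsub>L\<lparr>carrier := K\<rparr>\<^esub> \<in> B.\<mm> \<Longrightarrow> B.q - 1 dvd j"
    using B.residue_generator by blast
  have uK: "u \<in> K" "u [^]\<^bsub>L\<^esub> (i::nat) \<in> K" "\<one>\<^bsub>L\<^esub> \<in> K" for i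
    using u(1) subring_pow_closed[OF K] subringE(3)[OF K] by auto
  obtain \<eta> \<omega> where \<eta>: "\<eta> \<in> carrier L" "\<eta> [^]\<^bsub>L\<^esub> e = u" and \<omega>: "\<omega> \<in> carrier L" "\<omega> [^]\<^bsub>L\<^esub> e = \<pi>"
    using exists_power_root[of u e] exists_power_root[of \<pi> e] uK(1) \<pi>(1) subset assms(4) by blast
  interpret kummer_generators L K v e \<pi> u \<eta> \<omega>
  proof
    show "e > 0" by fact
    show "\<not> ring_char B.\<kk> dvd e" using assms(3,5) by (simp add: cong_0_iff)
    show "card (roots_of_unity (L\<lparr>carrier := K\<rparr>) e) = e" by fact
    show "\<exists>i::nat. x \<ominus>\<^bsub>L\<^esub> u [^]\<^bsub>L\<^esub> i \<in> B.\<mm>" if "x \<in> K" "x \<noteq> \<zero>\<^bsub>L\<^esub>" "v x = 0" for x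
      using u(3)[of x] that uK subring_minus[OF K] by (simp add: subring_nat_pow)
    show "B.q - 1 dvd j" if "u [^]\<^bsub>L\<^esub> j \<ominus>\<^bsub>L\<^esub> \<one>\<^bsub>L\<^esub> \<in> B.\<mm>" for j :: nat
      using u(4)[of j] that uK subring_minus[OF K] by (simp add: subring_nat_pow)
  qed (use \<pi> u \<eta> \<omega> in auto)
  show ?thesis using orth_classes orth_galois unfolding assms(7) kummer_extension_eq by blast
qed

end
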